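(* Let $N\ge 1$ and let $\Omega$ be an open subset of $\mathbb C$. For each $t\in\Omega$ let $(A_{n,t})_{n=1}^\infty\in\mathcal F^{N\times N}$, $$A_{n,t}=T_n(a_t)+P_nK_tP_n+W_nL_tW_n+C_{n,t}$$ with $a_t\in\mathcal B^{N\times N}$, $K_t,L_t$ trace class operators on $(\ell^2)^N$ and $(C_{n,t})_{n=1}^\infty\in\mathcal N^{N\times N}$, and assume that the map $t\in\Omega\mapsto(A_{n,t})_{n=1}^\infty\in\mathcal F^{N\times N}$ is analytic. Moreover, suppose that $a_t\in\mathcal G_1\mathcal B^{N\times N}$ for each $t\in\Omega$. Then for each $t\in\Omega$ the limit $$E_t=\lim_{n\to\infty}\frac{\det A_{n,t}}{G(a_t)^n}$$ exists, the convergence is locally uniform on $\Omega$, and $E_t$ depends analytically on $t$.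
   Context: $\mathcal B$ is the Banach algebra of all functions $\phi\in L^1(\mathbb T)$ on the unit circle $\mathbb T$ whose Fourier coefficients $\phi_k=\frac1{2\pi}\int_0^{2\pi}\phi(e^{ix})e^{-ikx}dx$ satisfy $$\|\phi\|_{\mathcal B}:=\sum_{k\in\mathbb Z}|\phi_k|+\Big(\sum_{k\in\mathbb Z}|k|\,|\phi_k|^2\Big)^{1/2}<\infty,$$ with pointwise operations. $\mathcal G\mathcal B^{N\times N}$ is the group of invertible elements of the Banach algebra $\mathcal B^{N\times N}$, and $\mathcal G_1\mathcal B^{N\times N}$ is its connected component containing the identity. For $a\in\mathcal G_1\mathcal B^{N\times N}$ put $G(a)=\exp\big(\frac1{2\pi}\int_0^{2\pi}\log\det a(e^{ix})\,dx\big)$, with a continuous logarithm of $\det a$ on $\mathbb T$ (this is well defined). Let $\ell^2=\ell^2(\mathbb Z_+)$, $\mathbb Z_+=\{0,1,\dots\}$, and define on $\ell^2$ the operators $P_n:\{x_k\}_{k\ge0}\mapsto\{x_0,\dots,x_{n-1},0,0,\dots\}$ and $W_n:\{x_k\}_{k\ge0}\mapsto\{x_{n-1},x_{n-2},\dots,x_0,0,0,\dots\}$; on $(\ell^2)^N$ they act componentwise. $T_n(a)=(a_{j-k})_{0\le j,k\le n-1}$. $\mathcal F$ is the set of all sequences $(A_n)_{n=1}^\infty$ of $n\times n$ matrices of the form $A_n=T_n(a)+P_nKP_n+W_nLW_n+C_n$, where $a\in\mathcal B$, $K,L$ are trace class operators on $\ell^2$, and $C_n$ are $n\times n$ matrices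 tending to zero in the trace norm ($P_nKP_n$, $W_nLW_n$ being identified with $n\times n$ matrices); $\mathcal N$ is the set of such sequences $(C_n)$. $\mathcal F$ is a Banach algebra with elementwise operations and norm $\|(A_n)\|_{\mathcal F}=\|a\|_{\mathcal B}+\|K\|_1+\|L\|_1+\sup_{n\ge1}\|C_n\|_1$, where $\|\cdot\|_1$ is the trace norm. $\mathcal F^{N\times N}$ is the $N\times N$ block version (sequences of $nN\times nN$ matrices of the same form with $a\in\mathcal B^{N\times N}$, $K,L$ trace class on $(\ell^2)^N$, $(C_n)\in\mathcal N^{N\times N}$). Analyticity of $t\mapsto(A_{n,t})_{n}$ means analyticity as an $\mathcal F^{N\times N}$-valued function; it is equivalent to analyticity of $t\mapsto a_t$, $t\mapsto K_t$, $t\mapsto L_t$ and $t\mapsto(C_{n,t})_n$. *)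

theory Defs
  imports "HOL-Complex_Analysis.Complex_Analysis"
begin

section \<open>The Banach algebra of symbols\<close>

text \<open>
  A function on the unit circle is a function on \<^typ>\<open>complex\<close> of which only the values
  at \<^term>\<open>cis x\<close> for \<^term>\<open>x \<in> {0..2 * pi}\<close> matter, and, as usual for
  elements of L1, two functions that agree almost everywhere represent the same element.
\<close>

definition fourier :: "(complex \<Rightarrow> complex) \<Rightarrow> int \<Rightarrow> complex" where
  "fourier \<phi> k =
     (LINT x:{0..2*pi}|lebesgue. \<phi> (cis x) * cis (- (of_int k * x))) / (2 * pi)"

definition B_alg :: "(complex \<Rightarrow> complex) set" where
  "B_alg = {\<phi>. set_integrable lebesgue {0..2*pi} (\<lambda>x. \<phi> (cis x)) \<and>
     (\<lambda>k. cmod (fourier \<phi> k)) summable_on UNIV \<and>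
     (\<lambda>k. \<bar>real_of_int k\<bar> * (cmod (fourier \<phi> k))\<^sup>2) summable_on UNIV}"

definition B_norm :: "(complex \<Rightarrow> complex) \<Rightarrow> real" where
  "B_norm \<phi> = (\<Sum>\<^sub>\<infinity>k\<in>UNIV. cmod (fourier \<phi> k)) +
     sqrt (\<Sum>\<^sub>\<infinity>k\<in>UNIV. \<bar>real_of_int k\<bar> * (cmod (fourier \<phi> k))\<^sup>2)"

definition BM_alg :: "(complex \<Rightarrow> complex ^ 'n ^ 'n::finite) set" where
  "BM_alg = {a. \<forall>\<alpha> \<beta>. (\<lambda>z. a z $ \<alpha> $ \<beta>) \<in> B_alg}"

text \<open>One of the (equivalent) submultiplicative norms on the matrix algebra.\<close>

definition BM_norm :: "(complex \<Rightarrow> complex ^ 'n ^ 'n::finite) \<Rightarrow> real" where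
  "BM_norm a = (\<Sum>\<alpha>\<in>UNIV. \<Sum>\<beta>\<in>UNIV. B_norm (\<lambda>z. a z $ \<alpha> $ \<beta>))"

text \<open>
  The norm topology. It does not separate functions that agree almost everywhere, so it is the
  pullback of the topology of the Banach algebra, and its connected components are the
  preimages of the components there.
\<close>

definition BM_open :: "(complex \<Rightarrow> complex ^ 'n ^ 'n::finite) set \<Rightarrow> bool" where
  "BM_open U \<longleftrightarrow> U \<subseteq> BM_alg \<and>
     (\<forall>a\<in>U. \<exists>\<epsilon>>0. \<forall>b\<in>BM_alg. BM_norm (\<lambda>z. b z - a z) < \<epsilon> \<longrightarrow> b \<in> U)"

definition BM_topology :: "(complex \<Rightarrow> complex ^ 'n ^ 'n::finite) topology" where
  "BM_topology = topology BM_open"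

lemma istopology_BM_open: "istopology BM_open"
  unfolding istopology_def
proof (intro conjI allI impI)
  fix S T :: "(complex \<Rightarrow> complex ^ 'n ^ 'n) set"
  assume S: "BM_open S" and T: "BM_open T"
  show "BM_open (S \<inter> T)"
    unfolding BM_open_def
  proof (intro conjI ballI)
    show "S \<inter> T \<subseteq> BM_alg" using S by (auto simp: BM_open_def)
  next
    fix a assume a: "a \<in> S \<inter> T"
    obtain d where d: "d > 0" "\<forall>b\<in>BM_alg. BM_norm (\<lambda>z. b z - a z) < d \<longrightarrow> b \<in> S"
      using S a unfolding BM_open_def by blast
    obtain e where e: "e > 0" "\<forall>b\<in>BM_alg. BM_norm (\<lambda>z. b z - a z) < e \<longrightarrow> b \<in> T"
      using T a unfolding BM_open_def by blast
    show "\<exists>\<epsilon>>0. \<forall>b\<in>BM_alg. BM_norm (\<lambda>z. b z - a z) < \<epsilon> \<longrightarrow> b \<in> S \<inter> T"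
      using d e by (intro exI[of _ "min d e"]) auto
  qed
next
  fix \<K> :: "(complex \<Rightarrow> complex ^ 'n ^ 'n) set set"
  assume K: "\<forall>S\<in>\<K>. BM_open S"
  show "BM_open (\<Union>\<K>)"
    unfolding BM_open_def
  proof (intro conjI ballI)
    show "\<Union>\<K> \<subseteq> BM_alg" using K unfolding BM_open_def by blast
  next
    fix a assume "a \<in> \<Union>\<K>"
    then obtain S where S: "S \<in> \<K>" "a \<in> S" by blast
    then obtain d where "d > 0" "\<forall>b\<in>BM_alg. BM_norm (\<lambda>z. b z - a z) < d \<longrightarrow> b \<in> S"
      using K unfolding BM_open_def by blast
    then show "\<exists>\<epsilon>>0. \<forall>b\<in>BM_alg. BM_norm (\<lambda>z. b z - a z) < \<epsilon> \<longrightarrow> b \<in> \<Union>\<K>"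
      using S by blast
  qed
qed

lemma openin_BM_topology: "openin BM_topology = BM_open"
  unfolding BM_topology_def by (rule topology_inverse'[OF istopology_BM_open])

definition GBM :: "(complex \<Rightarrow> complex ^ 'n ^ 'n::finite) set" where
  "GBM = {a \<in> BM_alg. \<exists>b\<in>BM_alg. AE x\<in>{0..2*pi} in lebesgue.
     a (cis x) ** b (cis x) = mat 1 \<and> b (cis x) ** a (cis x) = mat 1}"

definition G1BM :: "(complex \<Rightarrow> complex ^ 'n ^ 'n::finite) set" where
  "G1BM = connected_component_of_set (subtopology BM_topology GBM) (\<lambda>z. mat 1)"

text \<open>
  The function \<open>b\<close> is a continuous logarithm of (the continuous representative of) the
  determinant; two of them differ by a constant in \<open>2 \<pi> \<i> \<int>\<close>, so the value does
  not depend on the choice.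
\<close>

definition G_const :: "(complex \<Rightarrow> complex ^ 'n ^ 'n::finite) \<Rightarrow> complex" where
  "G_const a = (THE g. \<exists>b. continuous_on (sphere 0 1) b \<and>
     (AE x\<in>{0..2*pi} in lebesgue. exp (b (cis x)) = det (a (cis x))) \<and>
     g = exp ((LINT x:{0..2*pi}|lebesgue. b (cis x)) / (2 * pi)))"


section \<open>Operators on N copies of l2\<close>

text \<open>
  The N-fold sum of l2 is l2 over the index type \<^typ>\<open>nat \<times> 'n\<close> with N the
  cardinality of \<^typ>\<open>'n\<close>. An operator is a map on functions of which only the values on
  \<open>ell2\<close> matter.
\<close>

definition ell2 :: "('i \<Rightarrow> complex) set" where
  "ell2 = {x. (\<lambda>i. (cmod (x i))\<^sup>2) summable_on UNIV}"

definition ell2_inner :: "('i \<Rightarrow> complex) \<Rightarrow> ('i \<Rightarrow> complex) \<Rightarrow> complex" where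
  "ell2_inner x y = (\<Sum>\<^sub>\<infinity>i\<in>UNIV. x i * cnj (y i))"

definition orthonormal_seq :: "(nat \<Rightarrow> 'i \<Rightarrow> complex) \<Rightarrow> bool" where
  "orthonormal_seq u \<longleftrightarrow> (\<forall>k. u k \<in> ell2) \<and>
     (\<forall>k l. ell2_inner (u k) (u l) = (if k = l then 1 else 0))"

type_synonym 'i op = "('i \<Rightarrow> complex) \<Rightarrow> ('i \<Rightarrow> complex)"

text \<open>
  \<open>s\<close> lists the singular values of \<open>K\<close>: the operator has the Schmidt expansion
  \<open>K = \<Sum>k. s k \<langle>\<cdot>, u k\<rangle> v k\<close>. As l2 is infinite-dimensional here, operators of finite
  rank are covered by appending zeros to \<open>s\<close> (so matrices have to be regarded as operators on
  the whole space).
\<close>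

definition singular_values :: "'i op \<Rightarrow> (nat \<Rightarrow> real) \<Rightarrow> bool" where
  "singular_values K s \<longleftrightarrow> (\<forall>k. s k \<ge> 0) \<and>
     (\<exists>u v. orthonormal_seq u \<and> orthonormal_seq v \<and>
       (\<forall>x\<in>ell2. \<forall>i. (\<lambda>k. of_real (s k) * ell2_inner x (u k) * v k i) sums K x i))"

text \<open>
  The sum of the singular values. It is the same for all Schmidt expansions of \<open>K\<close>, so the
  infimum only serves to give the value infinity to an operator that has none. If the norm is
  finite, the Schmidt expansion converges in norm and \<open>K\<close> is bounded and linear on
  \<open>ell2\<close>.
\<close>

definition trace_norm :: "'i op \<Rightarrow> ennreal" where
  "trace_norm K = (INF s\<in>{s. singular_values K s}. \<Sum>k. ennreal (s k))"

definition trace_class :: "'i op \<Rightarrow> bool" where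
  "trace_class K \<longleftrightarrow> trace_norm K < \<infinity>"

definition P_op :: "nat \<Rightarrow> (nat \<times> 'n) op" where
  "P_op n x = (\<lambda>(k, \<alpha>). if k < n then x (k, \<alpha>) else 0)"

definition W_op :: "nat \<Rightarrow> (nat \<times> 'n) op" where
  "W_op n x = (\<lambda>(k, \<alpha>). if k < n then x (n - 1 - k, \<alpha>) else 0)"


section \<open>Block matrices\<close>

text \<open>
  An nN x nN block matrix is a function of two indices of which only the entries with both
  indices in \<open>block_idx n\<close> matter.
\<close>

type_synonym 'i matrix = "'i \<Rightarrow> 'i \<Rightarrow> complex"

definition block_idx :: "nat \<Rightarrow> (nat \<times> 'n) set" where
  "block_idx n = {..<n} \<times> UNIV"

definition op_matrix :: "'i op \<Rightarrow> 'i matrix" where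
  "op_matrix K i j = K (\<lambda>l. if l = j then 1 else 0) i"

definition matrix_op :: "nat \<Rightarrow> (nat \<times> 'n::finite) matrix \<Rightarrow> (nat \<times> 'n) op" where
  "matrix_op n M x i =
     (if i \<in> block_idx n then \<Sum>j\<in>block_idx n. M i j * x j else 0)"

definition block_det :: "nat \<Rightarrow> (nat \<times> 'n::finite) matrix \<Rightarrow> complex" where
  "block_det n M =
     (\<Sum>p | p permutes block_idx n. of_int (sign p) * (\<Prod>i\<in>block_idx n. M i (p i)))"

definition toeplitz :: "(complex \<Rightarrow> complex ^ 'n ^ 'n::finite) \<Rightarrow> (nat \<times> 'n) matrix" where
  "toeplitz a = (\<lambda>(j, \<alpha>) (k, \<beta>). fourier (\<lambda>z. a z $ \<alpha> $ \<beta>) (int j - int k))"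


section \<open>The Banach algebra of matrix sequences\<close>

text \<open>Sequences start at n = 1; their value at 0 does not matter.\<close>

definition N_seq :: "(nat \<Rightarrow> (nat \<times> 'n::finite) matrix) \<Rightarrow> bool" where
  "N_seq C \<longleftrightarrow> (\<lambda>n. trace_norm (matrix_op n (C n))) \<longlonglongrightarrow> 0"

definition F_decomp ::
  "(nat \<Rightarrow> (nat \<times> 'n::finite) matrix) \<Rightarrow> (complex \<Rightarrow> complex ^ 'n ^ 'n) \<Rightarrow>
   (nat \<times> 'n) op \<Rightarrow> (nat \<times> 'n) op \<Rightarrow> (nat \<Rightarrow> (nat \<times> 'n) matrix) \<Rightarrow> bool" where
  "F_decomp A a K L C \<longleftrightarrow>
     a \<in> BM_alg \<and> trace_class K \<and> trace_class L \<and> N_seq C \<and>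
     (\<forall>n\<ge>1. \<forall>i\<in>block_idx n. \<forall>j\<in>block_idx n.
        A n i j = toeplitz a i j + op_matrix (P_op n \<circ> K \<circ> P_op n) i j
                + op_matrix (W_op n \<circ> L \<circ> W_op n) i j + C n i j)"

definition F_alg :: "(nat \<Rightarrow> (nat \<times> 'n::finite) matrix) set" where
  "F_alg = {A. \<exists>a K L C. F_decomp A a K L C}"

text \<open>
  The data of a decomposition are uniquely determined by the sequence, up to the identifications
  made above, which do not affect the norms; the infimum is thus over one value, or over
  none (giving infinity) outside the algebra.
\<close>

definition F_norm :: "(nat \<Rightarrow> (nat \<times> 'n::finite) matrix) \<Rightarrow> ennreal" where
  "F_norm A = (INF (a, K, L, C)\<in>{(a, K, L, C). F_decomp A a K L C}.
     ennreal (BM_norm a) + trace_norm K + trace_norm L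
     + (SUP n\<in>{1..}. trace_norm (matrix_op n (C n))))"

text \<open>
  Complex differentiability in the norm of the algebra at every point. On open sets this is
  analyticity, as in \<^const>\<open>holomorphic_on\<close>, which is only available for scalar functions.
\<close>

definition F_analytic_on ::
  "(complex \<Rightarrow> nat \<Rightarrow> (nat \<times> 'n::finite) matrix) \<Rightarrow> complex set \<Rightarrow> bool" where
  "F_analytic_on f \<Omega> \<longleftrightarrow> (\<forall>t\<in>\<Omega>. f t \<in> F_alg \<and>
     (\<exists>D\<in>F_alg. ((\<lambda>s. F_norm (\<lambda>n i j. (f s n i j - f t n i j) / (s - t) - D n i j))
        \<longlongrightarrow> 0) (at t)))"

end

theory Submission imports Defs begin

text \<open>
  A symbol close to the identity has a Wiener--Hopf factorization.  Since the identity component is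
  connected, every symbol \<open>a\<close> in it satisfies \<open>a ** b\<^sub>1 ** \<dots> ** b\<^sub>r = 1\<close> with factors \<open>b\<^sub>i\<close> close to the
  identity that are analytic or coanalytic.  The matrices \<open>T\<^sub>n(b\<^sub>i)\<close> are block triangular, so the product
  \<open>B\<^sub>n = T\<^sub>n(b\<^sub>1) \<dots> T\<^sub>n(b\<^sub>r)\<close> has determinant exactly \<open>G(a)\<close> to the power \<open>-n\<close>, and the quotient in question is
  \<open>det (A\<^sub>n B\<^sub>n)\<close>.  By Widom's formula for products of Toeplitz matrices, \<open>A\<^sub>n B\<^sub>n = I + X\<^sub>n\<close>, where \<open>X\<^sub>n\<close>
  is approximated in the trace norm, uniformly for large \<open>n\<close>, by matrices whose only nonzero entries
  lie in the corners and do not depend on \<open>n\<close>.  For those the determinants are eventually constant, and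
  Hadamard's inequality controls \<open>det (I + X)\<close> in the trace norm; hence the determinants
  converge.  Perturbing only the first factors, one gets such factorizations for all \<open>t\<close> near a given point
  with locally bounded norms.  So the quotients are locally bounded holomorphic functions, and their
  pointwise convergence is locally uniform by Vitali's argument.
\<close>

section \<open>Determinants over finite index sets\<close>

text \<open>The trace norm of the definitions is an infimum over Schmidt expansions, for which even
  the triangle inequality takes work. Only upper bounds are needed, so finite matrices carry the
  predicate \<open>nuc_le\<close>, a bound for the pairing with all matrices of bounded operator
  norm. It is additive by construction, survives right multiplication and limits, and controls the
  diagonal and the Frobenius norm, which is all that Hadamard's inequality asks for. The limit is
  never identified with an operator determinant; a Cauchy argument suffices. Determinants are taken
  over arbitrary finite index sets because sections of growing size, single blocks and unions of
  corners all occur. Symbols are given only almost everywhere, so they are replaced by their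
  coefficient sequences, which form a Banach algebra where fixed point arguments apply.
  Differentiability in the sequence algebra concerns some decomposition of the derivative, not the
  given data; the uniqueness of the symbol links the two. It then yields three things: holomorphic
  entries, holomorphic symbol values on the circle, and bounds for the remainders that are uniform
  near a point.\<close>

definition fdet :: "'i set \<Rightarrow> ('i \<Rightarrow> 'i \<Rightarrow> complex) \<Rightarrow> complex" where
  "fdet F M = (\<Sum>p | p permutes F. of_int (sign p) * (\<Prod>i\<in>F. M i (p i)))"

definition idm :: "'i \<Rightarrow> 'i \<Rightarrow> complex" where
  "idm i j = (if i = j then 1 else 0)"

definition mmul :: "'i set \<Rightarrow> ('i \<Rightarrow> 'i \<Rightarrow> complex) \<Rightarrow> ('i \<Rightarrow> 'i \<Rightarrow> complex) \<Rightarrow> 'i \<Rightarrow> 'i \<Rightarrow> complex" where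
  "mmul F A B i j = (\<Sum>k\<in>F. A i k * B k j)"

lemma block_det_eq_fdet: "block_det n M = fdet (block_idx n) M"
  by (simp add: block_det_def fdet_def)

lemma fdet_cong:
  assumes "\<And>i j. i \<in> F \<Longrightarrow> j \<in> F \<Longrightarrow> A i j = B i j"
  shows "fdet F A = fdet F B"
  unfolding fdet_def
proof (rule sum.cong)
  fix p assume "p \<in> {p. p permutes F}"
  then have "\<And>i. i \<in> F \<Longrightarrow> p i \<in> F" by (simp add: permutes_in_image)
  then show "of_int (sign p) * (\<Prod>i\<in>F. A i (p i)) = of_int (sign p) * (\<Prod>i\<in>F. B i (p i))"
    using assms by (simp cong: prod.cong)
qed simp

text \<open>Conjugating a permutation by \<open>f\<close> keeps its sign. Outside the index set the
  conjugate is set to the identity, as \<open>permutes\<close> demands.\<close>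

lemma fdet_reindex:
  assumes f: "bij_betw f A B" and fin: "finite A"
  shows "fdet B M = fdet A (\<lambda>i j. M (f i) (f j))"
proof -
  define g where "g = inv_into A f"
  have gf: "g (f x) = x" if "x \<in> A" for x
    using f that by (auto simp: g_def bij_betw_def)
  have fg: "f (g x) = x" and gA: "g x \<in> A" if "x \<in> B" for x
    using f that by (auto simp: g_def bij_betw_def f_inv_into_f inv_into_into)
  have fB: "f x \<in> B" if "x \<in> A" for x using f that by (auto simp: bij_betw_def)
  have finB: "finite B" using f fin bij_betw_finite by blast
  have bg: "bij_betw g B A" unfolding g_def using f by (rule bij_betw_inv_into)
  let ?\<phi> = "\<lambda>p x. if x \<in> B then f (p (g x)) else x"
  let ?\<psi> = "\<lambda>q x. if x \<in> A then g (q (f x)) else x"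
  have pin: "p permutes A \<Longrightarrow> p x \<in> A \<longleftrightarrow> x \<in> A" for p x by (simp add: permutes_in_image)
  have qin: "p permutes B \<Longrightarrow> p x \<in> B \<longleftrightarrow> x \<in> B" for p x by (simp add: permutes_in_image)
  show ?thesis
    unfolding fdet_def
  proof (rule sum.reindex_bij_witness[where i = ?\<phi> and j = ?\<psi>])
    fix q assume "q \<in> {p. p permutes B}"
    then have q: "q permutes B" by simp
    interpret permutes_bij_finite q B A g f "?\<psi> q"
      by unfold_locales (use q bg fg finB in auto)
    show "?\<phi> (?\<psi> q) = q"
      using q fg gA fB by (auto simp: fun_eq_iff qin permutes_not_in)
    show "?\<psi> q \<in> {p. p permutes A}" using permutes_p' by simp
    have "(\<Prod>i\<in>A. M (f i) (f (?\<psi> q i))) = (\<Prod>i\<in>A. M (f i) (q (f i)))"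
      using q fB fg by (intro prod.cong) (auto simp: qin)
    also have "\<dots> = (\<Prod>i\<in>B. M i (q i))"
      using prod.reindex_bij_betw[OF f, of "\<lambda>i. M i (q i)"] .
    finally show "of_int (sign (?\<psi> q)) * (\<Prod>i\<in>A. M (f i) (f (?\<psi> q i))) =
        of_int (sign q) * (\<Prod>i\<in>B. M i (q i))"
      using sign_p' by simp
  next
    fix p assume "p \<in> {p. p permutes A}"
    then have p: "p permutes A" by simp
    interpret permutes_bij_finite p A B f g "?\<phi> p"
      by unfold_locales (use p f gf fin in auto)
    show "?\<psi> (?\<phi> p) = p"
      using p fB gf by (auto simp: fun_eq_iff pin permutes_not_in)
    show "?\<phi> p \<in> {p. p permutes B}" using permutes_p' by simp
  qed
qed

text \<open>A permutation that moves an index outside \<open>G\<close> meets a zero of an identity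
  row, so only permutations of \<open>G\<close> contribute. This is the device that later shrinks a
  large determinant to its corners.\<close>

lemma fdet_identity_rows:
  assumes fin: "finite F" and G: "G \<subseteq> F"
    and id: "\<And>i j. i \<in> F - G \<Longrightarrow> j \<in> F \<Longrightarrow> M i j = idm i j"
  shows "fdet F M = fdet G M"
proof -
  have "fdet F M = (\<Sum>p | p permutes G. of_int (sign p) * (\<Prod>i\<in>F. M i (p i)))"
    unfolding fdet_def
  proof (rule sum.mono_neutral_right)
    show "finite {p. p permutes F}" using fin by (rule finite_permutations)
    show "{p. p permutes G} \<subseteq> {p. p permutes F}" using G permutes_subset by blast
    show "\<forall>p\<in>{p. p permutes F} - {p. p permutes G}. of_int (sign p) * (\<Prod>i\<in>F. M i (p i)) = 0"
    proof
      fix p assume "p \<in> {p. p permutes F} - {p. p permutes G}"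
      then have p: "p permutes F" "\<not> p permutes G" by auto
      then obtain i where i: "i \<in> F - G" "p i \<noteq> i" using permutes_superset by blast
      then have "M i (p i) = 0" using id[of i "p i"] p by (simp add: idm_def permutes_in_image)
      then have "(\<Prod>i\<in>F. M i (p i)) = 0" using i fin by (meson DiffE prod_zero)
      then show "of_int (sign p) * (\<Prod>i\<in>F. M i (p i)) = 0" by simp
    qed
  qed
  also have "\<dots> = fdet G M"
    unfolding fdet_def
  proof (rule sum.cong)
    fix p assume "p \<in> {p. p permutes G}"
    then have p: "p permutes G" by simp
    have "(\<Prod>i\<in>F. M i (p i)) = (\<Prod>i\<in>G. M i (p i))"
    proof (rule prod.mono_neutral_right[OF fin G])
      show "\<forall>i\<in>F - G. M i (p i) = 1"
        using p id by (auto simp: permutes_not_in idm_def)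
    qed
    then show "of_int (sign p) * (\<Prod>i\<in>F. M i (p i)) = of_int (sign p) * (\<Prod>i\<in>G. M i (p i))"
      by simp
  qed simp
  finally show ?thesis .
qed

lemma fdet_permute_rows:
  assumes fin: "finite F" and g: "g permutes F"
  shows "fdet F (\<lambda>i j. M (g i) j) = of_int (sign g) * fdet F M"
proof -
  have "fdet F (\<lambda>i j. M (g i) j) =
      (\<Sum>p | p permutes F. of_int (sign (p \<circ> g)) * (\<Prod>i\<in>F. M (g i) ((p \<circ> g) i)))"
    unfolding fdet_def
    by (rule sum.reindex_bij_witness[where j = "\<lambda>p. p \<circ> inv g" and i = "\<lambda>p. p \<circ> g"])
       (use g in \<open>auto simp: o_assoc[symmetric] permutes_inv_o intro: permutes_compose permutes_inv\<close>)
  also have "\<dots> = (\<Sum>p | p permutes F. of_int (sign g) * (of_int (sign p) * (\<Prod>i\<in>F. M i (p i))))"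
  proof (rule sum.cong)
    fix p assume "p \<in> {p. p permutes F}"
    then have p: "p permutes F" by simp
    have "sign (p \<circ> g) = sign p * sign g"
      using p g fin by (intro sign_compose) (auto intro: permutation_permutes[THEN iffD2])
    moreover have "(\<Prod>i\<in>F. M (g i) ((p \<circ> g) i)) = (\<Prod>i\<in>F. M i (p i))"
      using prod.permute[OF g, of "\<lambda>i. M i (p i)"] by (simp add: o_def)
    ultimately show "of_int (sign (p \<circ> g)) * (\<Prod>i\<in>F. M (g i) ((p \<circ> g) i)) =
        of_int (sign g) * (of_int (sign p) * (\<Prod>i\<in>F. M i (p i)))"
      by simp
  qed simp
  finally show ?thesis by (simp add: fdet_def sum_distrib_left)
qed

lemma fdet_identical_rows:
  assumes fin: "finite F" and "a \<in> F" "b \<in> F" "a \<noteq> b" and eq: "\<And>j. j \<in> F \<Longrightarrow> M a j = M b j"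
  shows "fdet F M = 0"
proof -
  have "fdet F M = fdet F (\<lambda>i j. M (Transposition.transpose a b i) j)"
    by (rule fdet_cong) (use eq in \<open>auto simp: Transposition.transpose_def\<close>)
  also have "\<dots> = - fdet F M"
    using assms by (subst fdet_permute_rows) (auto intro: permutes_swap_id simp: sign_swap_id)
  finally show ?thesis by simp
qed

text \<open>Expanding every row of the product amounts to choosing a function from \<open>F\<close>
  to \<open>F\<close>. A choice that is not injective repeats a row of \<open>B\<close> and
  contributes zero; the injective choices are the permutations.\<close>

lemma fdet_mmul:
  assumes fin: "finite F"
  shows "fdet F (mmul F A B) = fdet F A * fdet F B"
proof -
  let ?E = "PiE F (\<lambda>_. F)"
  have finE: "finite ?E" using fin by (intro finite_PiE) auto
  have fp: "finite {p. p permutes F}" using fin by (rule finite_permutations)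
  have "fdet F (mmul F A B) =
     (\<Sum>p | p permutes F. of_int (sign p) * (\<Sum>f\<in>?E. (\<Prod>i\<in>F. A i (f i) * B (f i) (p i))))"
    unfolding fdet_def mmul_def using fin by (subst prod_sum_PiE) auto
  also have "\<dots> = (\<Sum>f\<in>?E. (\<Prod>i\<in>F. A i (f i)) * fdet F (\<lambda>i j. B (f i) j))"
    unfolding fdet_def sum_distrib_left
    by (subst sum.swap) (simp add: prod.distrib mult_ac)
  also have "\<dots> = (\<Sum>f\<in>{f\<in>?E. inj_on f F}. (\<Prod>i\<in>F. A i (f i)) * fdet F (\<lambda>i j. B (f i) j))"
  proof (rule sum.mono_neutral_right[OF finE])
    show "\<forall>f\<in>?E - {f \<in> ?E. inj_on f F}. (\<Prod>i\<in>F. A i (f i)) * fdet F (\<lambda>i j. B (f i) j) = 0"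
    proof
      fix f assume "f \<in> ?E - {f \<in> ?E. inj_on f F}"
      then have "\<not> inj_on f F" by blast
      then obtain a b where "a \<in> F" "b \<in> F" "a \<noteq> b" "f a = f b" unfolding inj_on_def by blast
      then have "fdet F (\<lambda>i j. B (f i) j) = 0"
        by (intro fdet_identical_rows[OF fin, of a b]) auto
      then show "(\<Prod>i\<in>F. A i (f i)) * fdet F (\<lambda>i j. B (f i) j) = 0" by simp
    qed
  qed auto
  \<comment> \<open>The choices are functions that are \<open>undefined\<close> outside
    \<open>F\<close>, while permutations are the identity there; the two witnesses translate between
    these conventions.\<close>
  also have "\<dots> = (\<Sum>g | g permutes F. (\<Prod>i\<in>F. A i (g i)) * fdet F (\<lambda>i j. B (g i) j))"
  proof (rule sum.reindex_bij_witness[where i = "\<lambda>g. restrict g F" and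
        j = "\<lambda>f x. if x \<in> F then f x else x"])
    fix f assume f: "f \<in> {f\<in>?E. inj_on f F}"
    show "restrict (\<lambda>x. if x \<in> F then f x else x) F = f"
      using f by (auto simp: PiE_def extensional_def fun_eq_iff restrict_def)
    have "f ` F = F" using f fin by (intro endo_inj_surj) auto
    then have "bij_betw f F F" using f by (simp add: bij_betw_def)
    then have "bij_betw (\<lambda>x. if x \<in> F then f x else x) F F"
      by (rule bij_betw_cong[THEN iffD1, rotated]) simp
    then show "(\<lambda>x. if x \<in> F then f x else x) \<in> {g. g permutes F}"
      by (simp add: bij_imp_permutes)
    show "(\<Prod>i\<in>F. A i (if i \<in> F then f i else i)) * fdet F (\<lambda>i. B (if i \<in> F then f i else i)) =
        (\<Prod>i\<in>F. A i (f i)) * fdet F (\<lambda>i. B (f i))"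
      by (intro arg_cong2[where f = "(*)"] prod.cong fdet_cong) auto
  next
    fix g assume "g \<in> {g. g permutes F}"
    then have g: "g permutes F" by simp
    show "(\<lambda>x. if x \<in> F then restrict g F x else x) = g"
      using g by (auto simp: fun_eq_iff permutes_not_in)
    show "restrict g F \<in> {f\<in>?E. inj_on f F}"
      using g by (auto simp: permutes_in_image inj_on_def dest: permutes_inj[THEN injD])
  qed
  also have "\<dots> = (\<Sum>g | g permutes F. (\<Prod>i\<in>F. A i (g i)) * (of_int (sign g) * fdet F B))"
    using fdet_permute_rows[OF fin] by (intro sum.cong) auto
  also have "\<dots> = fdet F A * fdet F B"
    unfolding fdet_def[of F A] sum_distrib_right by (intro sum.cong) (simp_all add: mult_ac)
  finally show ?thesis .
qed

text \<open>\<open>M\<close> is the product of \<open>Y\<close>, which carries the block over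
  \<open>A\<close> and is the identity elsewhere, and \<open>X\<close>, which has identity rows over
  \<open>A\<close> and the rows of \<open>M\<close> over \<open>B\<close>. The vanishing block makes
  the product correct in the rows of \<open>A\<close>. Both factors have identity rows, so each
  determinant reduces to one block.\<close>

lemma fdet_block_triangular:
  assumes fin: "finite A" "finite B" and disj: "A \<inter> B = {}"
    and zero: "\<And>i j. i \<in> A \<Longrightarrow> j \<in> B \<Longrightarrow> M i j = 0"
  shows "fdet (A \<union> B) M = fdet A M * fdet B M"
proof -
  define Y where "Y i j = (if i \<in> A \<and> j \<in> A then M i j else idm i j)" for i j
  define X where "X i j = (if i \<in> A then idm i j else M i j)" for i j
  have "mmul (A \<union> B) Y X i j = M i j" if "i \<in> A \<union> B" "j \<in> A \<union> B" for i j
  proof (cases "i \<in> A")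
    case True
    have "mmul (A \<union> B) Y X i j = (\<Sum>k\<in>A. Y i k * X k j)"
      unfolding mmul_def using fin True disj
      by (intro sum.mono_neutral_right) (auto simp: Y_def idm_def)
    also have "\<dots> = (\<Sum>k\<in>A. M i k * idm k j)"
      using True by (intro sum.cong) (auto simp: Y_def X_def)
    also have "\<dots> = M i j"
    proof (cases "j \<in> A")
      case True
      then show ?thesis using fin by (simp add: idm_def if_distrib sum.delta cong: if_cong)
    next
      case False
      then have "(\<Sum>k\<in>A. M i k * idm k j) = 0" by (intro sum.neutral) (auto simp: idm_def)
      then show ?thesis using zero[of i j] False True \<open>i \<in> A\<close> that by auto
    qed
    finally show ?thesis .
  next
    case False
    then have "mmul (A \<union> B) Y X i j = (\<Sum>k\<in>A\<union>B. idm i k * X k j)"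
      unfolding mmul_def by (intro sum.cong) (auto simp: Y_def)
    also have "\<dots> = X i j"
      using fin that by (simp add: idm_def if_distrib[of "\<lambda>c. c * _"] sum.delta cong: if_cong)
    finally show ?thesis using False by (simp add: X_def)
  qed
  then have "fdet (A \<union> B) M = fdet (A \<union> B) (mmul (A \<union> B) Y X)"
    by (intro fdet_cong) auto
  also have "\<dots> = fdet (A \<union> B) Y * fdet (A \<union> B) X"
    using fin by (intro fdet_mmul) auto
  also have "fdet (A \<union> B) Y = fdet A Y"
    using fin disj by (intro fdet_identity_rows) (auto simp: Y_def)
  also have "fdet A Y = fdet A M" by (intro fdet_cong) (auto simp: Y_def)
  also have "fdet (A \<union> B) X = fdet B X"
    using fin disj by (intro fdet_identity_rows) (auto simp: X_def)
  also have "fdet B X = fdet B M" using disj by (intro fdet_cong) (auto simp: X_def)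
  finally show ?thesis .
qed

lemma fdet_transpose:
  assumes "finite F"
  shows "fdet F (\<lambda>i j. M j i) = fdet F M"
  unfolding fdet_def
proof (rule sum.reindex_bij_witness[where i = inv and j = inv])
  fix p assume "p \<in> {p. p permutes F}"
  then have p: "p permutes F" by simp
  show "inv (inv p) = p" using p permutes_inv_inv by blast
  show "inv p \<in> {p. p permutes F}" using p permutes_inv by blast
  have "(\<Prod>i\<in>F. M (p i) i) = (\<Prod>i\<in>F. M (p i) (inv p (p i)))"
    using p by (simp add: permutes_inverses)
  also have "\<dots> = (\<Prod>i\<in>F. M i (inv p i))"
    using prod.permute[OF p, of "\<lambda>i. M i (inv p i)"] by (simp add: o_def)
  finally show "of_int (sign (inv p)) * (\<Prod>i\<in>F. M i (inv p i)) = of_int (sign p) * (\<Prod>i\<in>F. M (p i) i)"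
    using p assms by (simp add: sign_inverse permutation_permutes[THEN iffD2, OF exI, of F])
qed (auto simp: permutes_inv permutes_inv_inv)

lemma fdet_diagonal:
  assumes "finite F" and "\<And>i j. i \<in> F \<Longrightarrow> j \<in> F \<Longrightarrow> i \<noteq> j \<Longrightarrow> M i j = 0"
  shows "fdet F M = (\<Prod>i\<in>F. M i i)"
  using assms
proof (induction F rule: finite_induct)
  case empty
  then show ?case by (simp add: fdet_def)
next
  case (insert a F)
  have "fdet ({a} \<union> F) M = fdet {a} M * fdet F M"
    using insert by (intro fdet_block_triangular) auto
  moreover have "fdet {a} M = M a a" by (simp add: fdet_def)
  ultimately show ?case using insert by simp
qed

section \<open>Orthogonalization of rows and Hadamard's inequality\<close>

definition hrow :: "'i set \<Rightarrow> ('i \<Rightarrow> complex) \<Rightarrow> ('i \<Rightarrow> complex) \<Rightarrow> complex" where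
  "hrow F x y = (\<Sum>j\<in>F. x j * cnj (y j))"

text \<open>Gram--Schmidt on the rows, which neither changes the determinant nor increases the
  norms of the rows.\<close>

lemma orthogonal_rows:
  assumes fin: "finite F" and S: "finite S" "S \<subseteq> F"
  shows "\<exists>M'. fdet F M' = fdet F M \<and> (\<forall>i\<in>F - S. M' i = M i) \<and>
     (\<forall>i\<in>F. (\<Sum>j\<in>F. (cmod (M' i j))\<^sup>2) \<le> (\<Sum>j\<in>F. (cmod (M i j))\<^sup>2)) \<and>
     (\<forall>i\<in>S. \<forall>j\<in>S. i \<noteq> j \<longrightarrow> hrow F (M' i) (M' j) = 0)"
  using S
proof (induction S rule: finite_induct)
  case empty
  then show ?case by (intro exI[of _ M]) auto
next
  case (insert k S)
  then obtain M1 where M1: "fdet F M1 = fdet F M" "\<forall>i\<in>F - S. M1 i = M i"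
     "\<And>i. i \<in> F \<Longrightarrow> (\<Sum>j\<in>F. (cmod (M1 i j))\<^sup>2) \<le> (\<Sum>j\<in>F. (cmod (M i j))\<^sup>2)"
     "\<And>i j. i \<in> S \<Longrightarrow> j \<in> S \<Longrightarrow> i \<noteq> j \<Longrightarrow> hrow F (M1 i) (M1 j) = 0" by auto
  have kF: "k \<in> F" and SF: "S \<subseteq> F" and kS: "k \<notin> S" using insert by auto
  have hrow_self: "hrow F x x = of_real (\<Sum>j\<in>F. (cmod (x j))\<^sup>2)" for x :: "'a \<Rightarrow> complex"
    by (simp only: hrow_def complex_norm_square[symmetric] of_real_sum)
  have hrow_self0: "x j = 0" if "hrow F x x = 0" "j \<in> F" for x j
    using that fin unfolding hrow_self of_real_eq_0_iff by (subst (asm) sum_nonneg_eq_0_iff) auto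
  \<comment> \<open>If row \<open>l\<close> vanishes on \<open>F\<close>, division by zero gives the
    coefficient 0, which is a correct choice because such a row has nothing to project onto.\<close>
  define c where "c l = hrow F (M1 k) (M1 l) / hrow F (M1 l) (M1 l)" for l
  define y where "y j = (\<Sum>l\<in>S. c l * M1 l j)" for j
  define x where "x j = M1 k j - y j" for j
  define M2 where "M2 = (\<lambda>i. if i = k then x else M1 i)"
  \<comment> \<open>The row operation as a matrix. Its only row that differs from the identity is
    \<open>k\<close>, with diagonal entry 1, so multiplication by it keeps the determinant.\<close>
  define E where "E i j = (if i = k \<and> j \<in> S then - c j else idm i j)" for i j
  have hy: "hrow F y z = (\<Sum>l\<in>S. c l * hrow F (M1 l) z)" for z
    unfolding hrow_def y_def sum_distrib_right sum_distrib_left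
    by (subst sum.swap) (simp add: mult_ac)
  have yl: "hrow F y (M1 l) = hrow F (M1 k) (M1 l)" if l: "l \<in> S" for l
  proof -
    have "hrow F y (M1 l) = (\<Sum>m\<in>S. if m = l then c l * hrow F (M1 l) (M1 l) else 0)"
      unfolding hy using M1(4) l by (intro sum.cong) auto
    also have "\<dots> = c l * hrow F (M1 l) (M1 l)" using l insert by simp
    also have "\<dots> = hrow F (M1 k) (M1 l)"
    proof (cases "hrow F (M1 l) (M1 l) = 0")
      case True
      then have "M1 l j = 0" if "j \<in> F" for j using hrow_self0 that by blast
      then have "hrow F (M1 k) (M1 l) = 0" by (simp add: hrow_def)
      then show ?thesis using True by simp
    qed (simp add: c_def)
    finally show ?thesis .
  qed
  have xl: "hrow F x (M1 l) = 0" if "l \<in> S" for l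
    using yl[OF that] by (simp add: hrow_def x_def left_diff_distrib sum_subtractf)
  have hcnj: "hrow F u v = cnj (hrow F v u)" for u v by (simp add: hrow_def mult.commute)
  have lx: "hrow F (M1 l) x = 0" if "l \<in> S" for l
    using xl[OF that] hcnj[of "M1 l" x] by simp
  have yx: "hrow F y x = 0" unfolding hy using lx by simp
  have xy: "hrow F x y = 0" using yx hcnj[of x y] by simp
  have "hrow F (M1 k) (M1 k) = hrow F x x + hrow F y y + hrow F x y + hrow F y x"
    by (simp add: hrow_def x_def algebra_simps sum.distrib sum_subtractf)
  then have "(\<Sum>j\<in>F. (cmod (M1 k j))\<^sup>2) = (\<Sum>j\<in>F. (cmod (x j))\<^sup>2) + (\<Sum>j\<in>F. (cmod (y j))\<^sup>2)"
    unfolding hrow_self xy yx by (simp flip: of_real_add del: of_real_sum of_real_power)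
  then have nx: "(\<Sum>j\<in>F. (cmod (x j))\<^sup>2) \<le> (\<Sum>j\<in>F. (cmod (M1 k j))\<^sup>2)"
    by (simp add: sum_nonneg)
  have M2: "mmul F E M1 i j = M2 i j" if i: "i \<in> F" for i j
  proof (cases "i = k")
    case True
    have "mmul F E M1 k j = (\<Sum>l\<in>F. (if l = k then M1 k j else 0) - (if l \<in> S then c l * M1 l j else 0))"
      unfolding mmul_def using kS by (intro sum.cong) (auto simp: E_def idm_def)
    also have "\<dots> = M1 k j - y j"
      using kF fin SF by (simp add: sum_subtractf y_def sum.inter_restrict[symmetric] Int_absorb1)
    finally show ?thesis using True by (simp add: M2_def x_def)
  next
    case False
    then have "mmul F E M1 i j = (\<Sum>l\<in>F. if i = l then M1 i j else 0)"
      unfolding mmul_def by (intro sum.cong) (auto simp: E_def idm_def)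
    then show ?thesis using False i fin by (simp add: M2_def)
  qed
  have "fdet F E = fdet {k} E"
    using fin kF by (intro fdet_identity_rows) (auto simp: E_def)
  also have "\<dots> = 1" using kS by (simp add: fdet_def E_def idm_def)
  finally have "fdet F M2 = fdet F M"
    using fdet_mmul[OF fin, of E M1] M2 M1(1) fdet_cong[of F M2 "mmul F E M1"] by simp
  moreover have "\<forall>i\<in>F - insert k S. M2 i = M i" using M1(2) by (auto simp: M2_def)
  moreover have "\<forall>i\<in>F. (\<Sum>j\<in>F. (cmod (M2 i j))\<^sup>2) \<le> (\<Sum>j\<in>F. (cmod (M i j))\<^sup>2)"
    using nx M1(3) order_trans[OF nx M1(3)[OF kF]] by (auto simp: M2_def)
  moreover have "\<forall>i\<in>insert k S. \<forall>j\<in>insert k S. i \<noteq> j \<longrightarrow> hrow F (M2 i) (M2 j) = 0"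
    using xl lx M1(4) kS by (auto simp: M2_def)
  ultimately show ?case by blast
qed

text \<open>For orthogonal rows the product of \<open>M'\<close> with its adjoint is diagonal, with
  the squared row norms on the diagonal, and its determinant is the squared modulus of the
  determinant of \<open>M'\<close>.\<close>

lemma hadamard_inequality:
  assumes fin: "finite F"
  shows "(cmod (fdet F M))\<^sup>2 \<le> (\<Prod>i\<in>F. \<Sum>j\<in>F. (cmod (M i j))\<^sup>2)"
proof -
  obtain M' where M': "fdet F M' = fdet F M"
     "\<And>i. i \<in> F \<Longrightarrow> (\<Sum>j\<in>F. (cmod (M' i j))\<^sup>2) \<le> (\<Sum>j\<in>F. (cmod (M i j))\<^sup>2)"
     "\<And>i j. i \<in> F \<Longrightarrow> j \<in> F \<Longrightarrow> i \<noteq> j \<Longrightarrow> hrow F (M' i) (M' j) = 0"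
    using orthogonal_rows[OF fin fin order_refl, of M] by auto
  have cnj_fdet: "fdet F (\<lambda>i j. cnj (M' i j)) = cnj (fdet F M')"
    by (simp add: fdet_def)
  have "of_real ((cmod (fdet F M))\<^sup>2) = fdet F M' * fdet F (\<lambda>i j. cnj (M' j i))"
    unfolding fdet_transpose[OF fin, of "\<lambda>i j. cnj (M' i j)"] cnj_fdet M'(1)
    by (rule complex_norm_square)
  also have "\<dots> = fdet F (mmul F M' (\<lambda>i j. cnj (M' j i)))"
    using fin by (simp add: fdet_mmul)
  also have "\<dots> = (\<Prod>i\<in>F. mmul F M' (\<lambda>i j. cnj (M' j i)) i i)"
    using fin M'(3) by (intro fdet_diagonal) (auto simp: mmul_def hrow_def)
  also have "\<dots> = of_real (\<Prod>i\<in>F. \<Sum>j\<in>F. (cmod (M' i j))\<^sup>2)"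
    by (simp only: mmul_def complex_norm_square[symmetric] of_real_prod of_real_sum)
  finally have "(cmod (fdet F M))\<^sup>2 = (\<Prod>i\<in>F. \<Sum>j\<in>F. (cmod (M' i j))\<^sup>2)"
    by (simp only: of_real_eq_iff)
  also have "\<dots> \<le> (\<Prod>i\<in>F. \<Sum>j\<in>F. (cmod (M i j))\<^sup>2)"
    using M'(2) by (intro prod_mono) (auto intro: sum_nonneg)
  finally show ?thesis .
qed

section \<open>Operator and trace norm bounds for finite matrices\<close>

definition l2n :: "'i set \<Rightarrow> ('i \<Rightarrow> complex) \<Rightarrow> real" where
  "l2n F x = L2_set (\<lambda>i. cmod (x i)) F"

text \<open>The form is bilinear rather than sesquilinear. The bound is the same, and transposing
  the matrix just swaps the two vectors.\<close>

definition op_le :: "'i set \<Rightarrow> ('i \<Rightarrow> 'i \<Rightarrow> complex) \<Rightarrow> real \<Rightarrow> bool" where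
  "op_le F Z b \<longleftrightarrow> b \<ge> 0 \<and>
     (\<forall>x y. cmod (\<Sum>i\<in>F. \<Sum>j\<in>F. x i * Z i j * y j) \<le> b * l2n F x * l2n F y)"

text \<open>The trace norm is at most \<open>c\<close>, expressed through the duality of the trace norm with the
  operator norm.\<close>

definition nuc_le :: "'i set \<Rightarrow> ('i \<Rightarrow> 'i \<Rightarrow> complex) \<Rightarrow> real \<Rightarrow> bool" where
  "nuc_le F M c \<longleftrightarrow> (\<forall>Z b. op_le F Z b \<longrightarrow> cmod (\<Sum>i\<in>F. \<Sum>j\<in>F. M i j * Z i j) \<le> c * b)"

lemma l2n_nonneg [simp]: "l2n F x \<ge> 0"
  by (simp add: l2n_def L2_set_nonneg)

lemma l2n_sq: "(l2n F x)\<^sup>2 = (\<Sum>i\<in>F. (cmod (x i))\<^sup>2)"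
  by (simp add: l2n_def L2_set_def sum_nonneg)

lemma l2n_cauchy_schwarz: "cmod (\<Sum>i\<in>F. x i * y i) \<le> l2n F x * l2n F y"
proof -
  have "cmod (\<Sum>i\<in>F. x i * y i) \<le> (\<Sum>i\<in>F. \<bar>cmod (x i)\<bar> * \<bar>cmod (y i)\<bar>)"
    by (rule order_trans[OF norm_sum]) (simp add: norm_mult)
  also have "\<dots> \<le> l2n F x * l2n F y" unfolding l2n_def by (rule L2_set_mult_ineq)
  finally show ?thesis .
qed

lemma op_le_nonneg: "op_le F Z b \<Longrightarrow> b \<ge> 0"
  by (simp add: op_le_def)

lemma op_leD: "op_le F Z b \<Longrightarrow> cmod (\<Sum>i\<in>F. \<Sum>j\<in>F. x i * Z i j * y j) \<le> b * l2n F x * l2n F y"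
  by (simp add: op_le_def)

lemma nuc_leD: "nuc_le F M c \<Longrightarrow> op_le F Z b \<Longrightarrow> cmod (\<Sum>i\<in>F. \<Sum>j\<in>F. M i j * Z i j) \<le> c * b"
  by (simp add: nuc_le_def)

lemma op_le_0: "op_le F (\<lambda>_ _. 0) 1"
  by (simp add: op_le_def)

text \<open>Test with the zero matrix, for which 1 is also an admissible operator bound.\<close>

lemma nuc_le_nonneg: "nuc_le F M c \<Longrightarrow> c \<ge> 0"
  using nuc_leD[OF _ op_le_0, of F M c] by simp

lemma of_real_nonneg_eq_cmod: "of_real r = z \<Longrightarrow> 0 \<le> r \<Longrightarrow> r = cmod z"
  by auto

lemma mult_self_le_cancel:
  fixes a b :: real
  assumes "a * a \<le> b * a" "0 \<le> a" "0 \<le> b"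
  shows "a \<le> b"
  using assms mult_right_le_imp_le[of a a b] by (cases "a = 0") auto

text \<open>Test the form with the conjugate of the image vector; one factor of its norm then
  cancels, the case of norm zero being trivial.\<close>

lemma op_le_mult_vec:
  assumes "op_le F T b"
  shows "l2n F (\<lambda>i. \<Sum>k\<in>F. T i k * y k) \<le> b * l2n F y"
proof -
  let ?w = "\<lambda>i. \<Sum>k\<in>F. T i k * y k"
  have "of_real ((l2n F ?w)\<^sup>2) = (\<Sum>i\<in>F. ?w i * cnj (?w i))"
    by (simp only: l2n_sq of_real_sum complex_norm_square)
  also have "\<dots> = (\<Sum>i\<in>F. \<Sum>k\<in>F. cnj (?w i) * T i k * y k)"
  proof (intro sum.cong refl)
    fix i
    have "?w i * cnj (?w i) = cnj (?w i) * ?w i" by (rule mult.commute)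
    also have "\<dots> = (\<Sum>k\<in>F. cnj (?w i) * (T i k * y k))" by (rule sum_distrib_left)
    finally show "?w i * cnj (?w i) = (\<Sum>k\<in>F. cnj (?w i) * T i k * y k)" by (simp only: mult.assoc)
  qed
  finally have "(l2n F ?w)\<^sup>2 = cmod (\<Sum>i\<in>F. \<Sum>k\<in>F. cnj (?w i) * T i k * y k)"
    by (rule of_real_nonneg_eq_cmod) simp
  also have "\<dots> \<le> b * l2n F (\<lambda>i. cnj (?w i)) * l2n F y" by (rule op_leD[OF assms])
  also have "l2n F (\<lambda>i. cnj (?w i)) = l2n F ?w" by (simp add: l2n_def del: cnj_sum)
  finally have "l2n F ?w * l2n F ?w \<le> (b * l2n F y) * l2n F ?w" by (simp add: power2_eq_square mult_ac)
  then show ?thesis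
    by (rule mult_self_le_cancel) (simp_all add: op_le_nonneg[OF assms])
qed

text \<open>Formulated for the product of \<open>Z\<close> with the transpose of \<open>T\<close>,
  because a right factor moves in this shape to the test matrix in the pairing of
  \<open>nuc_le\<close>.\<close>

lemma op_le_comp:
  assumes "op_le F Z b" "op_le F T b'"
  shows "op_le F (\<lambda>i k. \<Sum>j\<in>F. Z i j * T k j) (b * b')"
proof -
  have "cmod (\<Sum>i\<in>F. \<Sum>k\<in>F. x i * (\<Sum>j\<in>F. Z i j * T k j) * y k) \<le> b * b' * l2n F x * l2n F y" for x y
  proof -
    let ?w = "\<lambda>j. \<Sum>k\<in>F. T k j * y k"
    have T: "op_le F (\<lambda>i j. T j i) b'"
      unfolding op_le_def
    proof (intro conjI allI)
      fix x y
      have "(\<Sum>i\<in>F. \<Sum>j\<in>F. x i * T j i * y j) = (\<Sum>i\<in>F. \<Sum>j\<in>F. y i * T i j * x j)"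
        by (subst sum.swap) (simp add: mult_ac)
      then show "cmod (\<Sum>i\<in>F. \<Sum>j\<in>F. x i * T j i * y j) \<le> b' * l2n F x * l2n F y"
        using op_leD[OF assms(2), of y x] by (simp add: mult_ac)
    qed (use assms op_le_nonneg in auto)
    have "(\<Sum>i\<in>F. \<Sum>k\<in>F. x i * (\<Sum>j\<in>F. Z i j * T k j) * y k) = (\<Sum>i\<in>F. \<Sum>j\<in>F. x i * Z i j * ?w j)"
      by (rule sum.cong[OF refl], simp add: sum_distrib_left sum_distrib_right, subst sum.swap)
         (simp add: mult_ac)
    also have "cmod \<dots> \<le> b * l2n F x * l2n F ?w" by (rule op_leD[OF assms(1)])
    also have "\<dots> \<le> b * l2n F x * (b' * l2n F y)"
      using op_le_nonneg[OF assms(1)] by (intro mult_left_mono op_le_mult_vec[OF T]) auto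
    finally show ?thesis by (simp add: mult_ac)
  qed
  then show ?thesis using assms by (simp add: op_le_def)
qed

lemma nuc_le_mono: "nuc_le F M c \<Longrightarrow> c \<le> d \<Longrightarrow> nuc_le F M d"
  unfolding nuc_le_def by (meson mult_right_mono op_le_nonneg order_trans)

lemma nuc_le_cong:
  assumes "\<And>i j. i \<in> F \<Longrightarrow> j \<in> F \<Longrightarrow> M i j = M' i j"
  shows "nuc_le F M c \<longleftrightarrow> nuc_le F M' c"
proof -
  have "(\<Sum>i\<in>F. \<Sum>j\<in>F. M i j * Z i j) = (\<Sum>i\<in>F. \<Sum>j\<in>F. M' i j * Z i j)" for Z
    using assms by (intro sum.cong refl) auto
  then show ?thesis by (simp add: nuc_le_def)
qed

lemma nuc_le_add:
  assumes "nuc_le F M c" "nuc_le F M' d"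
  shows "nuc_le F (\<lambda>i j. M i j + M' i j) (c + d)"
  unfolding nuc_le_def
proof (intro allI impI)
  fix Z b assume Z: "op_le F Z b"
  have "cmod (\<Sum>i\<in>F. \<Sum>j\<in>F. (M i j + M' i j) * Z i j) \<le>
      cmod (\<Sum>i\<in>F. \<Sum>j\<in>F. M i j * Z i j) + cmod (\<Sum>i\<in>F. \<Sum>j\<in>F. M' i j * Z i j)"
    by (simp add: distrib_right sum.distrib norm_triangle_ineq)
  also have "\<dots> \<le> (c + d) * b"
    using nuc_leD[OF assms(1) Z] nuc_leD[OF assms(2) Z] by (simp add: distrib_right)
  finally show "cmod (\<Sum>i\<in>F. \<Sum>j\<in>F. (M i j + M' i j) * Z i j) \<le> (c + d) * b" .
qed

lemma nuc_le_scale: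
  assumes "nuc_le F M c"
  shows "nuc_le F (\<lambda>i j. z * M i j) (cmod z * c)"
  unfolding nuc_le_def
proof (intro allI impI)
  fix Z b assume Z: "op_le F Z b"
  have "(\<Sum>i\<in>F. \<Sum>j\<in>F. z * M i j * Z i j) = z * (\<Sum>i\<in>F. \<Sum>j\<in>F. M i j * Z i j)"
    by (simp add: sum_distrib_left mult_ac)
  then show "cmod (\<Sum>i\<in>F. \<Sum>j\<in>F. z * M i j * Z i j) \<le> cmod z * c * b"
    using nuc_leD[OF assms Z] by (simp add: norm_mult mult_left_mono mult.assoc)
qed

lemma nuc_le_minus: "nuc_le F M c \<Longrightarrow> nuc_le F (\<lambda>i j. - M i j) c"
  using nuc_le_scale[of F M c "-1"] by simp

lemma nuc_le_diff:
  assumes "nuc_le F M c" "nuc_le F M' d"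
  shows "nuc_le F (\<lambda>i j. M i j - M' i j) (c + d)"
  using nuc_le_add[OF assms(1) nuc_le_minus[OF assms(2)]] by simp

text \<open>In the pairing the factor \<open>T\<close> moves over to the test matrix and multiplies
  its operator bound.\<close>

lemma nuc_le_mmul:
  assumes "nuc_le F M c" "op_le F T b"
  shows "nuc_le F (mmul F M T) (c * b)"
  unfolding nuc_le_def
proof (intro allI impI)
  fix Z d assume Z: "op_le F Z d"
  have "(\<Sum>i\<in>F. \<Sum>j\<in>F. mmul F M T i j * Z i j) = (\<Sum>i\<in>F. \<Sum>k\<in>F. M i k * (\<Sum>j\<in>F. Z i j * T k j))"
    unfolding mmul_def
    by (rule sum.cong[OF refl], simp add: sum_distrib_left sum_distrib_right, subst sum.swap)
       (simp add: mult_ac)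
  also have "cmod \<dots> \<le> c * (d * b)"
    by (rule nuc_leD[OF assms(1) op_le_comp[OF Z assms(2)]])
  finally show "cmod (\<Sum>i\<in>F. \<Sum>j\<in>F. mmul F M T i j * Z i j) \<le> c * b * d" by (simp add: mult_ac)
qed

lemma op_le_frobenius:
  assumes "finite F"
  shows "op_le F Z (sqrt (\<Sum>i\<in>F. \<Sum>j\<in>F. (cmod (Z i j))\<^sup>2))"
  unfolding op_le_def
proof (intro conjI allI)
  fix x y
  have "(\<Sum>i\<in>F. \<Sum>j\<in>F. x i * Z i j * y j) = (\<Sum>i\<in>F. x i * (\<Sum>j\<in>F. Z i j * y j))"
    by (simp add: sum_distrib_left mult_ac)
  also have "cmod \<dots> \<le> l2n F x * l2n F (\<lambda>i. \<Sum>j\<in>F. Z i j * y j)" by (rule l2n_cauchy_schwarz)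
  finally have 1: "cmod (\<Sum>i\<in>F. \<Sum>j\<in>F. x i * Z i j * y j) \<le>
      l2n F x * l2n F (\<lambda>i. \<Sum>j\<in>F. Z i j * y j)" .
  have "l2n F (\<lambda>i. \<Sum>j\<in>F. Z i j * y j) \<le> L2_set (\<lambda>i. l2n F (Z i) * l2n F y) F"
    unfolding l2n_def[of F "\<lambda>i. \<Sum>j\<in>F. Z i j * y j"] by (intro L2_set_mono l2n_cauchy_schwarz) auto
  also have "\<dots> = sqrt (\<Sum>i\<in>F. \<Sum>j\<in>F. (cmod (Z i j))\<^sup>2) * l2n F y"
    by (subst L2_set_left_distrib[symmetric]) (auto simp: L2_set_def l2n_sq)
  finally have "l2n F x * l2n F (\<lambda>i. \<Sum>j\<in>F. Z i j * y j) \<le>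
      l2n F x * (sqrt (\<Sum>i\<in>F. \<Sum>j\<in>F. (cmod (Z i j))\<^sup>2) * l2n F y)"
    by (rule mult_left_mono) simp
  then show "cmod (\<Sum>i\<in>F. \<Sum>j\<in>F. x i * Z i j * y j) \<le>
      sqrt (\<Sum>i\<in>F. \<Sum>j\<in>F. (cmod (Z i j))\<^sup>2) * l2n F x * l2n F y"
    using 1 by (simp only: mult_ac)
qed (simp add: sum_nonneg)

text \<open>Test with the conjugate of \<open>M\<close>, whose operator norm is at most its
  Frobenius norm: the sum of squares S satisfies S <= c sqrt S.\<close>

lemma nuc_le_frobenius:
  assumes fin: "finite F" and M: "nuc_le F M c"
  shows "(\<Sum>i\<in>F. \<Sum>j\<in>F. (cmod (M i j))\<^sup>2) \<le> c\<^sup>2"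
proof -
  let ?S = "\<Sum>i\<in>F. \<Sum>j\<in>F. (cmod (M i j))\<^sup>2"
  have S0: "?S \<ge> 0" by (intro sum_nonneg) auto
  have "of_real ?S = (\<Sum>i\<in>F. \<Sum>j\<in>F. M i j * cnj (M i j))"
    by (simp only: of_real_sum complex_norm_square)
  then have "?S = cmod (\<Sum>i\<in>F. \<Sum>j\<in>F. M i j * cnj (M i j))"
    by (rule of_real_nonneg_eq_cmod) (rule S0)
  also have "\<dots> \<le> c * sqrt ?S"
    using nuc_leD[OF M op_le_frobenius[OF fin, of "\<lambda>i j. cnj (M i j)"]] by simp
  finally have "sqrt ?S * sqrt ?S \<le> c * sqrt ?S" using S0 by simp
  then have "sqrt ?S \<le> c"
    by (rule mult_self_le_cancel) (simp_all add: S0 nuc_le_nonneg[OF M])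
  then show ?thesis using sqrt_le_D by blast
qed

lemma nuc_le_entry:
  assumes fin: "finite F" and M: "nuc_le F M c" and ab: "a \<in> F" "b \<in> F"
  shows "cmod (M a b) \<le> c"
proof -
  have "(cmod (M a b))\<^sup>2 \<le> (\<Sum>j\<in>F. (cmod (M a j))\<^sup>2)"
    using fin ab by (intro member_le_sum) auto
  also have "\<dots> \<le> (\<Sum>i\<in>F. \<Sum>j\<in>F. (cmod (M i j))\<^sup>2)"
    using fin ab by (intro member_le_sum[of a]) (auto intro: sum_nonneg)
  also have "\<dots> \<le> c\<^sup>2" by (rule nuc_le_frobenius[OF fin M])
  finally show ?thesis using nuc_le_nonneg[OF M] power2_le_imp_le by blast
qed

text \<open>Test with the diagonal matrix of the conjugate phases of the diagonal entries, which has
  operator bound 1.\<close>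

lemma nuc_le_diag:
  assumes fin: "finite F" and M: "nuc_le F M c"
  shows "(\<Sum>i\<in>F. cmod (M i i)) \<le> c"
proof -
  define Z where "Z i j = (if i = j then cnj (sgn (M i i)) else 0)" for i j
  have "op_le F Z 1"
    unfolding op_le_def
  proof (intro conjI allI)
    fix x y
    have "(\<Sum>i\<in>F. \<Sum>j\<in>F. x i * Z i j * y j) = (\<Sum>i\<in>F. x i * (cnj (sgn (M i i)) * y i))"
    proof (intro sum.cong refl)
      fix i assume "i \<in> F"
      have "(\<Sum>j\<in>F. x i * Z i j * y j) = (\<Sum>j\<in>F. if i = j then x i * (cnj (sgn (M i i)) * y i) else 0)"
        by (intro sum.cong) (auto simp: Z_def)
      then show "(\<Sum>j\<in>F. x i * Z i j * y j) = x i * (cnj (sgn (M i i)) * y i)"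
        using fin \<open>i \<in> F\<close> by simp
    qed
    also have "cmod \<dots> \<le> l2n F x * l2n F (\<lambda>i. cnj (sgn (M i i)) * y i)" by (rule l2n_cauchy_schwarz)
    also have "\<dots> \<le> l2n F x * l2n F y"
      unfolding l2n_def
      by (intro mult_left_mono L2_set_mono) (auto simp: norm_mult norm_sgn L2_set_nonneg)
    finally show "cmod (\<Sum>i\<in>F. \<Sum>j\<in>F. x i * Z i j * y j) \<le> 1 * l2n F x * l2n F y" by simp
  qed simp
  then have "cmod (\<Sum>i\<in>F. \<Sum>j\<in>F. M i j * Z i j) \<le> c" using nuc_leD[OF M] by fastforce
  also have "(\<Sum>i\<in>F. \<Sum>j\<in>F. M i j * Z i j) = (\<Sum>i\<in>F. of_real (cmod (M i i)))"
  proof (intro sum.cong refl)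
    fix i assume "i \<in> F"
    have "(\<Sum>j\<in>F. M i j * Z i j) = (\<Sum>j\<in>F. if i = j then M i i * cnj (sgn (M i i)) else 0)"
      by (intro sum.cong) (auto simp: Z_def)
    also have "\<dots> = M i i * cnj (sgn (M i i))" using fin \<open>i \<in> F\<close> by simp
    also have "\<dots> = (M i i * cnj (M i i)) / of_real (cmod (M i i))"
      by (simp add: sgn_eq)
    also have "\<dots> = of_real (cmod (M i i))"
      by (simp add: complex_norm_square[symmetric] power2_eq_square)
    finally show "(\<Sum>j\<in>F. M i j * Z i j) = of_real (cmod (M i i))" .
  qed
  also have "cmod \<dots> = (\<Sum>i\<in>F. cmod (M i i))"
    unfolding of_real_sum[symmetric] norm_of_real by (simp add: sum_nonneg)
  finally show ?thesis .
qed

text \<open>Hadamard's inequality, where the squared norms of the rows of \<open>I + X\<close> are at most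
  \<open>exp (2 \<bar>X i i\<bar> + \<Sum>j. \<bar>X i j\<bar>\<^sup>2)\<close>.\<close>

lemma fdet_one_plus_bound:
  assumes fin: "finite F" and X: "nuc_le F X c"
  shows "cmod (fdet F (\<lambda>i j. idm i j + X i j)) \<le> exp (c + c\<^sup>2 / 2)"
proof -
  have row: "(\<Sum>j\<in>F. (cmod (idm i j + X i j))\<^sup>2) \<le> exp (2 * cmod (X i i) + (\<Sum>j\<in>F. (cmod (X i j))\<^sup>2))"
    if i: "i \<in> F" for i
  proof -
    have "(\<Sum>j\<in>F. (cmod (idm i j + X i j))\<^sup>2) \<le>
        (\<Sum>j\<in>F. (if i = j then 1 + 2 * cmod (X i i) else 0) + (cmod (X i j))\<^sup>2)"
    proof (rule sum_mono)
      fix j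
      have "(cmod (1 + X i i))\<^sup>2 \<le> (1 + cmod (X i i))\<^sup>2"
        using norm_triangle_ineq[of 1 "X i i"] by (intro power_mono) auto
      then show "(cmod (idm i j + X i j))\<^sup>2 \<le> (if i = j then 1 + 2 * cmod (X i i) else 0) + (cmod (X i j))\<^sup>2"
        by (auto simp: idm_def power2_sum)
    qed
    also have "\<dots> = 1 + (2 * cmod (X i i) + (\<Sum>j\<in>F. (cmod (X i j))\<^sup>2))"
      using fin i by (simp add: sum.distrib)
    also have "\<dots> \<le> exp (2 * cmod (X i i) + (\<Sum>j\<in>F. (cmod (X i j))\<^sup>2))" by (rule exp_ge_add_one_self)
    finally show ?thesis .
  qed
  have "(cmod (fdet F (\<lambda>i j. idm i j + X i j)))\<^sup>2 \<le> (\<Prod>i\<in>F. \<Sum>j\<in>F. (cmod (idm i j + X i j))\<^sup>2)"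
    by (rule hadamard_inequality[OF fin])
  also have "\<dots> \<le> (\<Prod>i\<in>F. exp (2 * cmod (X i i) + (\<Sum>j\<in>F. (cmod (X i j))\<^sup>2)))"
    using row by (intro prod_mono) (auto intro: sum_nonneg)
  also have "\<dots> = exp (2 * (\<Sum>i\<in>F. cmod (X i i)) + (\<Sum>i\<in>F. \<Sum>j\<in>F. (cmod (X i j))\<^sup>2))"
    by (subst exp_sum[OF fin, symmetric]) (simp add: sum.distrib sum_distrib_left)
  also have "\<dots> \<le> exp (2 * c + c\<^sup>2)"
    using nuc_le_diag[OF fin X] nuc_le_frobenius[OF fin X] by simp
  also have "\<dots> = (exp (c + c\<^sup>2 / 2))\<^sup>2"
    by (simp add: power2_eq_square flip: exp_add)
  finally show ?thesis using power2_le_imp_le by fastforce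
qed

text \<open>The polynomial det (I + X + z R) stays below a constant for |z| <= 1/r, since z R then
  still has trace norm at most 1. Cauchy's estimate on discs of radius 1/r - 1 about the points of
  the unit disc bounds its derivative, and r <= 1/2 turns 1 / (1/r - 1) into at most 2 r.\<close>

lemma fdet_one_plus_perturb:
  assumes fin: "finite F" and X: "nuc_le F X c" and R: "nuc_le F R r" and r: "0 < r" "r \<le> 1/2"
  shows "cmod (fdet F (\<lambda>i j. idm i j + (X i j + R i j)) - fdet F (\<lambda>i j. idm i j + X i j))
     \<le> 2 * exp ((c + 1) + (c + 1)\<^sup>2 / 2) * r"
proof -
  define M where "M = exp ((c + 1) + (c + 1)\<^sup>2 / 2)"
  define \<phi> where "\<phi> z = fdet F (\<lambda>i j. idm i j + (X i j + z * R i j))" for z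
  have hol: "\<phi> holomorphic_on A" for A
    unfolding \<phi>_def fdet_def by (intro holomorphic_intros)
  have bound: "cmod (\<phi> z) \<le> M" if "cmod z \<le> 1 / r" for z
  proof -
    have "cmod z * r \<le> 1" using that r by (simp add: field_simps)
    then have "nuc_le F (\<lambda>i j. X i j + z * R i j) (c + 1)"
      using nuc_le_add[OF X nuc_le_mono[OF nuc_le_scale[OF R]]] by blast
    then show ?thesis unfolding M_def \<phi>_def by (rule fdet_one_plus_bound[OF fin])
  qed
  have der: "cmod (deriv \<phi> w) \<le> 2 * M * r" if w: "w \<in> cball 0 1" for w
  proof -
    have "cmod ((deriv ^^ 1) \<phi> w) \<le> fact 1 * M / (1 / r - 1) ^ 1"
    proof (rule Cauchy_inequality)
      show "\<phi> holomorphic_on ball w (1/r - 1)" "continuous_on (cball w (1/r - 1)) \<phi>"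
        using hol holomorphic_on_imp_continuous_on by blast+
      show "0 < 1 / r - 1" using r by (simp add: field_simps)
      fix x assume "cmod (w - x) = 1 / r - 1"
      then have "cmod x \<le> 1 / r"
        using w norm_triangle_ineq4[of w "w - x"] by simp
      then show "cmod (\<phi> x) \<le> M" by (rule bound)
    qed
    also have "\<dots> \<le> 2 * M * r"
    proof -
      have "M > 0" by (simp add: M_def)
      moreover have "1 / (1 / r - 1) \<le> 2 * r" using r by (simp add: field_simps power2_eq_square)
      ultimately have "M * (1 / (1 / r - 1)) \<le> M * (2 * r)" by (intro mult_left_mono) auto
      then show ?thesis by (simp add: mult_ac)
    qed
    finally show ?thesis by simp
  qed
  have "cmod (\<phi> 1 - \<phi> 0) \<le> 2 * M * r * cmod (1 - 0)"
  proof (rule field_differentiable_bound[of "cball 0 1"])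
    show "(\<phi> has_field_derivative deriv \<phi> z) (at z within cball 0 1)" for z
      by (rule holomorphic_derivI[OF hol open_UNIV UNIV_I])
  qed (use der in auto)
  then show ?thesis by (simp add: \<phi>_def M_def)
qed

section \<open>The algebra of symbols\<close>

text \<open>The norm of the algebra over a finite set of coefficients. The norm itself is the
  supremum of these, so that every norm inequality reduces to one about finite sums.\<close>

definition wN :: "int set \<Rightarrow> (int \<Rightarrow> complex) \<Rightarrow> real" where
  "wN F f = (\<Sum>k\<in>F. cmod (f k)) + L2_set (\<lambda>k. sqrt \<bar>real_of_int k\<bar> * cmod (f k)) F"

definition wcoef :: "(int \<Rightarrow> complex) set" where
  "wcoef = {f. \<exists>M. \<forall>F. finite F \<longrightarrow> wN F f \<le> M}"

lemma wN_nonneg [simp]: "wN F f \<ge> 0"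
  by (simp add: wN_def sum_nonneg L2_set_nonneg)

lemma wN_zero [simp]: "wN F (\<lambda>_. 0) = 0"
  by (simp add: wN_def L2_set_def)

lemma wN_add: "wN F (\<lambda>k. f k + g k) \<le> wN F f + wN F g"
proof -
  have "L2_set (\<lambda>k. sqrt \<bar>real_of_int k\<bar> * cmod (f k + g k)) F \<le>
      L2_set (\<lambda>k. sqrt \<bar>real_of_int k\<bar> * cmod (f k) + sqrt \<bar>real_of_int k\<bar> * cmod (g k)) F"
    by (intro L2_set_mono) (auto simp flip: distrib_left intro: mult_left_mono norm_triangle_ineq)
  also have "\<dots> \<le> L2_set (\<lambda>k. sqrt \<bar>real_of_int k\<bar> * cmod (f k)) F +
      L2_set (\<lambda>k. sqrt \<bar>real_of_int k\<bar> * cmod (g k)) F"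
    by (rule L2_set_triangle_ineq)
  moreover have "(\<Sum>k\<in>F. cmod (f k + g k)) \<le> (\<Sum>k\<in>F. cmod (f k)) + (\<Sum>k\<in>F. cmod (g k))"
    by (simp flip: sum.distrib add: sum_mono norm_triangle_ineq)
  ultimately show ?thesis by (simp add: wN_def)
qed

lemma wN_scale: "wN F (\<lambda>k. c * f k) = cmod c * wN F f"
proof -
  have "L2_set (\<lambda>k. sqrt \<bar>real_of_int k\<bar> * (cmod c * cmod (f k))) F =
      cmod c * L2_set (\<lambda>k. sqrt \<bar>real_of_int k\<bar> * cmod (f k)) F"
    by (subst L2_set_right_distrib) (simp_all add: mult_ac)
  then show ?thesis by (simp add: wN_def norm_mult sum_distrib_left distrib_left)
qed

lemma wN_mono:
  assumes "finite G" "F \<subseteq> G"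
  shows "wN F f \<le> wN G f"
proof -
  have "L2_set (\<lambda>k. sqrt \<bar>real_of_int k\<bar> * cmod (f k)) F \<le> L2_set (\<lambda>k. sqrt \<bar>real_of_int k\<bar> * cmod (f k)) G"
    unfolding L2_set_def using assms by (intro real_sqrt_le_mono sum_mono2) auto
  moreover have "(\<Sum>k\<in>F. cmod (f k)) \<le> (\<Sum>k\<in>G. cmod (f k))"
    using assms by (intro sum_mono2) auto
  ultimately show ?thesis by (simp add: wN_def)
qed

lemma wN_ge_entry: "finite F \<Longrightarrow> k \<in> F \<Longrightarrow> cmod (f k) \<le> wN F f"
  unfolding wN_def using member_le_sum[of k F "\<lambda>k. cmod (f k)"] L2_set_nonneg[of _ F]
  by (metis (no_types, lifting) add_increasing2 norm_ge_zero)

lemma wcoefI: "(\<And>F. finite F \<Longrightarrow> wN F f \<le> M) \<Longrightarrow> f \<in> wcoef"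
  by (auto simp: wcoef_def)

lemma wcoef_zero: "(\<lambda>_. 0) \<in> wcoef"
  by (rule wcoefI[of _ 0]) simp

lemma wcoef_add:
  assumes "f \<in> wcoef" "g \<in> wcoef"
  shows "(\<lambda>k. f k + g k) \<in> wcoef"
proof -
  obtain M M' where "\<And>F. finite F \<Longrightarrow> wN F f \<le> M" "\<And>F. finite F \<Longrightarrow> wN F g \<le> M'"
    using assms by (auto simp: wcoef_def)
  then show ?thesis by (intro wcoefI[of _ "M + M'"] order_trans[OF wN_add] add_mono)
qed

lemma wcoef_scale:
  assumes "f \<in> wcoef"
  shows "(\<lambda>k. c * f k) \<in> wcoef"
proof -
  obtain M where "\<And>F. finite F \<Longrightarrow> wN F f \<le> M" using assms by (auto simp: wcoef_def)
  then show ?thesis by (intro wcoefI[of _ "cmod c * M"]) (auto simp: wN_scale intro: mult_left_mono)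
qed

typedef wsym = wcoef
  morphisms coef Wsym
  using wcoef_zero by blast

setup_lifting type_definition_wsym

lemma wsym_eqI: "(\<And>k. coef f k = coef g k) \<Longrightarrow> f = g"
  by (simp add: coef_inject[symmetric] fun_eq_iff)

definition wnorm :: "wsym \<Rightarrow> real" where
  "wnorm f = (SUP F\<in>{F. finite F}. wN F (coef f))"

lemma wN_le_wnorm: "finite F \<Longrightarrow> wN F (coef f) \<le> wnorm f"
proof -
  obtain M where M: "\<And>F. finite F \<Longrightarrow> wN F (coef f) \<le> M" using coef[of f] by (auto simp: wcoef_def)
  then have "bdd_above ((\<lambda>F. wN F (coef f)) ` {F. finite F})" by (intro bdd_aboveI2[of _ _ M]) auto
  then show "finite F \<Longrightarrow> wN F (coef f) \<le> wnorm f" unfolding wnorm_def by (intro cSUP_upper) auto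
qed

lemma wnorm_leI: "(\<And>F. finite F \<Longrightarrow> wN F (coef f) \<le> M) \<Longrightarrow> wnorm f \<le> M"
  unfolding wnorm_def by (intro cSUP_least) auto

lemma wnorm_nonneg: "wnorm f \<ge> 0"
  using wN_le_wnorm[of "{}" f] wN_nonneg[of "{}" "coef f"] by (meson finite.emptyI order_trans)

lemma coef_le_wnorm: "cmod (coef f k) \<le> wnorm f"
  using wN_ge_entry[of "{k}" k "coef f"] wN_le_wnorm[of "{k}" f] by simp

instantiation wsym :: real_vector
begin

lift_definition zero_wsym :: wsym is "\<lambda>_. 0" by (rule wcoef_zero)
lift_definition plus_wsym :: "wsym \<Rightarrow> wsym \<Rightarrow> wsym" is "\<lambda>f g k. f k + g k" by (rule wcoef_add)
lift_definition uminus_wsym :: "wsym \<Rightarrow> wsym" is "\<lambda>f k. - f k"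
  using wcoef_scale[of _ "-1"] by simp
definition minus_wsym :: "wsym \<Rightarrow> wsym \<Rightarrow> wsym" where "minus_wsym f g = f + - g"
lift_definition scaleR_wsym :: "real \<Rightarrow> wsym \<Rightarrow> wsym" is "\<lambda>c f k. of_real c * f k"
  by (rule wcoef_scale)

instance
proof
  fix x y z :: wsym and a b :: real
  show "x + y + z = x + (y + z)" by transfer (simp add: add.assoc)
  show "x + y = y + x" by transfer (simp add: add.commute)
  show "0 + x = x" by transfer simp
  show "- x + x = 0" by transfer simp
  show "x - y = x + - y" by (simp add: minus_wsym_def)
  show "a *\<^sub>R (x + y) = a *\<^sub>R x + a *\<^sub>R y" by transfer (simp add: algebra_simps)
  show "(a + b) *\<^sub>R x = a *\<^sub>R x + b *\<^sub>R x" by transfer (simp add: algebra_simps)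
  show "a *\<^sub>R b *\<^sub>R x = (a * b) *\<^sub>R x" by transfer (simp add: algebra_simps)
  show "1 *\<^sub>R x = x" by transfer simp
qed

end

instantiation wsym :: real_normed_vector
begin

definition norm_wsym :: "wsym \<Rightarrow> real" where "norm_wsym = wnorm"
definition dist_wsym :: "wsym \<Rightarrow> wsym \<Rightarrow> real" where "dist_wsym f g = norm (f - g)"
definition sgn_wsym :: "wsym \<Rightarrow> wsym" where "sgn_wsym f = scaleR (inverse (norm f)) f"
definition uniformity_wsym :: "(wsym \<times> wsym) filter" where
  "uniformity_wsym = (INF e\<in>{0 <..}. principal {(x, y). dist x y < e})"
definition open_wsym :: "wsym set \<Rightarrow> bool" where
  "open_wsym S = (\<forall>x\<in>S. \<forall>\<^sub>F (x', y) in uniformity. x' = x \<longrightarrow> y \<in> S)"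

instance
proof
  fix x y :: wsym and a :: real
  show "dist x y = norm (x - y)" by (simp add: dist_wsym_def)
  show "sgn x = x /\<^sub>R norm x" by (simp add: sgn_wsym_def)
  show "(uniformity :: (wsym \<times> wsym) filter) = (INF e\<in>{0 <..}. principal {(x, y). dist x y < e})"
    by (simp add: uniformity_wsym_def)
  show "open U \<longleftrightarrow> (\<forall>x\<in>U. \<forall>\<^sub>F (x', y) in uniformity. x' = x \<longrightarrow> y \<in> U)" for U :: "wsym set"
    by (simp add: open_wsym_def)
  show "norm x = 0 \<longleftrightarrow> x = 0"
  proof
    assume "norm x = 0"
    then have "coef x k = 0" for k using coef_le_wnorm[of x k] by (simp add: norm_wsym_def)
    then show "x = 0" by (intro wsym_eqI) (simp add: zero_wsym.rep_eq)
  next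
    assume "x = 0"
    then have "wnorm x \<le> 0" by (intro wnorm_leI) (simp add: zero_wsym.rep_eq)
    then show "norm x = 0" using wnorm_nonneg[of x] by (simp add: norm_wsym_def)
  qed
  show "norm (x + y) \<le> norm x + norm y"
    unfolding norm_wsym_def
  proof (rule wnorm_leI)
    fix F :: "int set" assume "finite F"
    then have "wN F (coef x) + wN F (coef y) \<le> wnorm x + wnorm y" by (intro add_mono wN_le_wnorm)
    then show "wN F (coef (x + y)) \<le> wnorm x + wnorm y"
      using wN_add[of F "coef x" "coef y"] by (simp add: plus_wsym.rep_eq)
  qed
  have le: "norm (a *\<^sub>R x) \<le> \<bar>a\<bar> * norm x" for a and x :: wsym
    unfolding norm_wsym_def
    by (rule wnorm_leI) (simp add: scaleR_wsym.rep_eq wN_scale wN_le_wnorm mult_left_mono)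
  show "norm (a *\<^sub>R x) = \<bar>a\<bar> * norm x"
  proof (rule antisym[OF le])
    show "\<bar>a\<bar> * norm x \<le> norm (a *\<^sub>R x)"
    proof (cases "a = 0")
      case False
      have "inverse a *\<^sub>R a *\<^sub>R x = x" using False by transfer simp
      then have "norm x \<le> \<bar>inverse a\<bar> * norm (a *\<^sub>R x)" using le[of "inverse a" "a *\<^sub>R x"] by simp
      then show ?thesis using False by (simp add: field_simps)
    qed (simp add: norm_wsym_def wnorm_nonneg)
  qed
qed

end

lemma coef_zero [simp]: "coef 0 k = 0" by (simp add: zero_wsym.rep_eq)
lemma coef_add [simp]: "coef (f + g) k = coef f k + coef g k" by (simp add: plus_wsym.rep_eq)
lemma coef_uminus [simp]: "coef (- f) k = - coef f k" by (simp add: uminus_wsym.rep_eq)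
lemma coef_diff [simp]: "coef (f - g) k = coef f k - coef g k"
  by (simp only: minus_wsym_def coef_add coef_uminus) simp
lemma coef_scaleR [simp]: "coef (r *\<^sub>R f) k = of_real r * coef f k" by (simp add: scaleR_wsym.rep_eq)

lemma coef_sum: "coef (sum f A) k = (\<Sum>a\<in>A. coef (f a) k)"
  by (induction A rule: infinite_finite_induct) auto

lemma coef_le_norm: "cmod (coef f k) \<le> norm f"
  using coef_le_wnorm by (simp add: norm_wsym_def)

lemma wN_le_norm: "finite F \<Longrightarrow> wN F (coef f) \<le> norm f"
  using wN_le_wnorm by (simp add: norm_wsym_def)

lemma norm_wsym_leI: "(\<And>F. finite F \<Longrightarrow> wN F (coef f) \<le> M) \<Longrightarrow> norm f \<le> M"
  using wnorm_leI by (simp add: norm_wsym_def)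

lemma tendsto_wN:
  assumes "\<And>k. ((\<lambda>n. f n k) \<longlongrightarrow> g k) G"
  shows "((\<lambda>n. wN F (f n)) \<longlongrightarrow> wN F g) G"
  unfolding wN_def L2_set_def by (intro tendsto_intros assms)

text \<open>The coefficients converge one by one, and each finite section \<open>wN F\<close> is
  continuous in finitely many coefficients. Hence the Cauchy bound passes to the limit for every
  \<open>F\<close>, before the supremum is taken.\<close>

instance wsym :: banach
proof
  fix X :: "nat \<Rightarrow> wsym"
  assume X: "Cauchy X"
  have "Cauchy (\<lambda>n. coef (X n) k)" for k
  proof (rule metric_CauchyI)
    fix e :: real assume "e > 0"
    then obtain N where N: "\<And>m n. m \<ge> N \<Longrightarrow> n \<ge> N \<Longrightarrow> dist (X m) (X n) < e"
      using metric_CauchyD[OF X] by blast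
    have "dist (coef (X m) k) (coef (X n) k) < e" if "m \<ge> N" "n \<ge> N" for m n
      using N[OF that] coef_le_norm[of "X m - X n" k] by (simp add: dist_norm)
    then show "\<exists>M. \<forall>m\<ge>M. \<forall>n\<ge>M. dist (coef (X m) k) (coef (X n) k) < e" by blast
  qed
  then have "\<exists>l. (\<lambda>n. coef (X n) k) \<longlonglongrightarrow> l" for k
    using Cauchy_convergent_iff convergent_def by blast
  then obtain g where g: "\<And>k. (\<lambda>n. coef (X n) k) \<longlonglongrightarrow> g k" by metis
  have lim: "wN F (\<lambda>k. g k - coef (X n) k) \<le> e"
    if e: "\<And>m. m \<ge> N \<Longrightarrow> dist (X m) (X n) \<le> e" and fin: "finite F" for N n e F
  proof (rule tendsto_upperbound)
    show "(\<lambda>m. wN F (\<lambda>k. coef (X m) k - coef (X n) k)) \<longlonglongrightarrow> wN F (\<lambda>k. g k - coef (X n) k)"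
      by (intro tendsto_wN tendsto_intros g)
    have "wN F (\<lambda>k. coef (X m) k - coef (X n) k) \<le> e" if "m \<ge> N" for m
    proof -
      have "wN F (coef (X m - X n)) \<le> norm (X m - X n)" by (rule wN_le_norm[OF fin])
      also have "coef (X m - X n) = (\<lambda>k. coef (X m) k - coef (X n) k)" by (rule ext) simp
      finally show ?thesis using e[OF that] by (simp add: dist_norm)
    qed
    then show "\<forall>\<^sub>F m in sequentially. wN F (\<lambda>k. coef (X m) k - coef (X n) k) \<le> e"
      using eventually_sequentially by blast
  qed simp
  \<comment> \<open>Tolerance 1 is enough to see that the limit belongs to the space: it is the sum
    of \<open>X N1\<close> and a difference of finite norm.\<close>
  obtain N1 where N1: "\<And>m n. m \<ge> N1 \<Longrightarrow> n \<ge> N1 \<Longrightarrow> dist (X m) (X n) < 1"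
    using metric_CauchyD[OF X, of 1] by auto
  have "(\<lambda>k. g k - coef (X N1) k) \<in> wcoef"
    using lim[of N1 N1 1] N1 by (intro wcoefI[of _ 1]) (simp add: less_imp_le)
  from wcoef_add[OF this coef[of "X N1"]] have gW: "g \<in> wcoef" by simp
  have cg: "coef (Wsym g) = g" using gW by (simp add: Wsym_inverse)
  have "X \<longlonglongrightarrow> Wsym g"
  proof (rule metric_LIMSEQ_I)
    fix e :: real assume e: "e > 0"
    then obtain N where N: "\<And>m n. m \<ge> N \<Longrightarrow> n \<ge> N \<Longrightarrow> dist (X m) (X n) < e / 2"
      using metric_CauchyD[OF X, of "e/2"] by auto
    have "dist (X n) (Wsym g) < e" if n: "n \<ge> N" for n
    proof -
      have "norm (Wsym g - X n) \<le> e / 2"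
      proof (rule norm_wsym_leI)
        fix F :: "int set" assume "finite F"
        moreover have "coef (Wsym g - X n) = (\<lambda>k. g k - coef (X n) k)" by (rule ext) (simp add: cg)
        ultimately show "wN F (coef (Wsym g - X n)) \<le> e / 2"
          using lim[of N n "e/2" F] N n by (simp add: less_imp_le)
      qed
      then show ?thesis using e by (simp add: dist_norm norm_minus_commute)
    qed
    then show "\<exists>no. \<forall>n\<ge>no. dist (X n) (Wsym g) < e" by blast
  qed
  then show "convergent X" by (auto simp: convergent_def)
qed

lemma coef_summable: "(\<lambda>k. cmod (coef f k)) summable_on UNIV"
proof (rule nonneg_bdd_above_summable_on)
  have "(\<Sum>k\<in>F. cmod (coef f k)) \<le> norm f" if "finite F" for F
    using wN_le_norm[OF that, of f] L2_set_nonneg[of "\<lambda>k. sqrt \<bar>real_of_int k\<bar> * cmod (coef f k)" F]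
    unfolding wN_def by linarith
  then show "bdd_above (sum (\<lambda>k. cmod (coef f k)) ` {F. F \<subseteq> UNIV \<and> finite F})"
    by (intro bdd_aboveI2[of _ _ "norm f"]) auto
qed simp

lemma sum_coef_le: "finite F \<Longrightarrow> (\<Sum>k\<in>F. cmod (coef f k)) \<le> (\<Sum>\<^sub>\<infinity>k. cmod (coef f k))"
  by (rule finite_sum_le_infsum[OF coef_summable]) auto

text \<open>Both parts of \<open>wN\<close> grow with the set, so the supremum can be taken in the
  first part while the second is kept at \<open>F\<close>.\<close>

lemma norm_wsym_split:
  assumes "finite F"
  shows "(\<Sum>\<^sub>\<infinity>k. cmod (coef f k)) + L2_set (\<lambda>k. sqrt \<bar>real_of_int k\<bar> * cmod (coef f k)) F \<le> norm f"
proof -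
  have "(\<Sum>\<^sub>\<infinity>k. cmod (coef f k)) \<le> norm f - L2_set (\<lambda>k. sqrt \<bar>real_of_int k\<bar> * cmod (coef f k)) F"
  proof (rule infsum_le_finite_sums[OF coef_summable])
    fix G :: "int set" assume G: "finite G"
    have "(\<Sum>k\<in>G. cmod (coef f k)) \<le> (\<Sum>k\<in>F \<union> G. cmod (coef f k))"
      using G assms by (intro sum_mono2) auto
    moreover have "L2_set (\<lambda>k. sqrt \<bar>real_of_int k\<bar> * cmod (coef f k)) F \<le>
       L2_set (\<lambda>k. sqrt \<bar>real_of_int k\<bar> * cmod (coef f k)) (F \<union> G)"
      unfolding L2_set_def using G assms by (intro real_sqrt_le_mono sum_mono2) auto
    moreover have "wN (F \<union> G) (coef f) \<le> norm f" using G assms by (intro wN_le_norm) auto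
    ultimately show "(\<Sum>k\<in>G. cmod (coef f k)) \<le>
        norm f - L2_set (\<lambda>k. sqrt \<bar>real_of_int k\<bar> * cmod (coef f k)) F"
      by (simp add: wN_def)
  qed
  then show ?thesis by simp
qed

lemma infsum_coef_le_norm: "(\<Sum>\<^sub>\<infinity>k. cmod (coef f k)) \<le> norm f"
  using norm_wsym_split[of "{}" f] by simp

lemma coef_weighted_summable: "(\<lambda>k. \<bar>real_of_int k\<bar> * (cmod (coef f k))\<^sup>2) summable_on UNIV"
  and coef_weighted_infsum: "(\<Sum>\<^sub>\<infinity>k. \<bar>real_of_int k\<bar> * (cmod (coef f k))\<^sup>2) \<le> (norm f)\<^sup>2"
proof -
  have le: "(\<Sum>k\<in>F. \<bar>real_of_int k\<bar> * (cmod (coef f k))\<^sup>2) \<le> (norm f)\<^sup>2" if "finite F" for F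
  proof -
    have "L2_set (\<lambda>k. sqrt \<bar>real_of_int k\<bar> * cmod (coef f k)) F \<le> norm f"
      using wN_le_norm[OF that, of f] sum_nonneg[of F "\<lambda>k. cmod (coef f k)"] by (simp add: wN_def)
    then have "sqrt (\<Sum>k\<in>F. \<bar>real_of_int k\<bar> * (cmod (coef f k))\<^sup>2) \<le> norm f"
      by (simp add: L2_set_def power_mult_distrib)
    then show ?thesis by (rule sqrt_le_D)
  qed
  show s: "(\<lambda>k. \<bar>real_of_int k\<bar> * (cmod (coef f k))\<^sup>2) summable_on UNIV"
    by (rule nonneg_bdd_above_summable_on) (use le in \<open>auto intro!: bdd_aboveI2[of _ _ "(norm f)\<^sup>2"]\<close>)
  show "(\<Sum>\<^sub>\<infinity>k. \<bar>real_of_int k\<bar> * (cmod (coef f k))\<^sup>2) \<le> (norm f)\<^sup>2"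
    by (rule infsum_le_finite_sums[OF s le])
qed

text \<open>Minkowski's inequality for infinitely many summands, by passing to the limit over finite
  partial sums.\<close>

lemma L2_set_infsum_le:
  fixes h :: "'j \<Rightarrow> 'k \<Rightarrow> real"
  assumes fin: "finite F" and h0: "\<And>j k. k \<in> F \<Longrightarrow> h j k \<ge> 0"
    and hb: "\<And>j. L2_set (h j) F \<le> b j" and b: "b summable_on UNIV"
  shows "L2_set (\<lambda>k. \<Sum>\<^sub>\<infinity>j. h j k) F \<le> (\<Sum>\<^sub>\<infinity>j. b j)"
proof (rule tendsto_upperbound)
  have b0: "b j \<ge> 0" for j using hb[of j] L2_set_nonneg[of "h j" F] by linarith
  have sm: "(\<lambda>j. h j k) summable_on UNIV" if k: "k \<in> F" for k
  proof (rule summable_on_comparison_test[OF b])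
    fix j
    show "h j k \<le> b j" using member_le_L2_set[OF fin k, of "h j"] hb[of j] by linarith
  qed (use h0 k in auto)
  show "((\<lambda>J. L2_set (\<lambda>k. \<Sum>j\<in>J. h j k) F) \<longlongrightarrow> L2_set (\<lambda>k. \<Sum>\<^sub>\<infinity>j. h j k) F) (finite_subsets_at_top UNIV)"
    unfolding L2_set_def by (intro tendsto_intros infsum_tendsto sm)
  have "L2_set (\<lambda>k. \<Sum>j\<in>J. h j k) F \<le> (\<Sum>j\<in>J. b j)" if "finite J" for J
    using that
  proof induction
    case (insert j J)
    have "L2_set (\<lambda>k. \<Sum>j\<in>insert j J. h j k) F \<le> L2_set (h j) F + L2_set (\<lambda>k. \<Sum>j\<in>J. h j k) F"
      using insert L2_set_triangle_ineq[of "h j" "\<lambda>k. \<Sum>j\<in>J. h j k" F] by simp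
    then show ?case using insert hb[of j] by simp
  qed (simp add: L2_set_def)
  moreover have "(\<Sum>j\<in>J. b j) \<le> (\<Sum>\<^sub>\<infinity>j. b j)" if "finite J" for J
    using that b0 by (intro finite_sum_le_infsum[OF b]) auto
  ultimately show "\<forall>\<^sub>F J in finite_subsets_at_top UNIV. L2_set (\<lambda>k. \<Sum>j\<in>J. h j k) F \<le> (\<Sum>\<^sub>\<infinity>j. b j)"
    by (intro eventually_finite_subsets_at_top_weakI) (meson order_trans)
qed simp

lemma has_sum_finite_sum:
  fixes f :: "'a \<Rightarrow> 'b \<Rightarrow> 'c::topological_comm_monoid_add"
  assumes "\<And>k. k \<in> F \<Longrightarrow> (f k has_sum s k) A"
  shows "((\<lambda>j. \<Sum>k\<in>F. f k j) has_sum (\<Sum>k\<in>F. s k)) A"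
  using assms by (induction F rule: infinite_finite_induct) (auto intro: has_sum_add)

lemma summable_on_finite_sum:
  fixes f :: "'a \<Rightarrow> 'b \<Rightarrow> 'c::topological_comm_monoid_add"
  assumes "\<And>k. k \<in> F \<Longrightarrow> f k summable_on A"
  shows "(\<lambda>j. \<Sum>k\<in>F. f k j) summable_on A"
  using assms by (induction F rule: infinite_finite_induct) (auto intro: summable_on_add)

lemma infsum_finite_sum:
  fixes f :: "'a \<Rightarrow> 'b \<Rightarrow> 'c::{topological_comm_monoid_add,t2_space}"
  assumes "\<And>k. k \<in> F \<Longrightarrow> f k summable_on A"
  shows "(\<Sum>\<^sub>\<infinity>j\<in>A. \<Sum>k\<in>F. f k j) = (\<Sum>k\<in>F. \<Sum>\<^sub>\<infinity>j\<in>A. f k j)"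
  by (intro infsumI has_sum_finite_sum has_sum_infsum assms)

section \<open>Convolution and submultiplicativity of the norm\<close>

definition conv :: "(int \<Rightarrow> complex) \<Rightarrow> (int \<Rightarrow> complex) \<Rightarrow> int \<Rightarrow> complex" where
  "conv f g k = (\<Sum>\<^sub>\<infinity>j. f j * g (k - j))"

lemma conv_abs_summable:
  "(\<lambda>j. cmod (coef f j) * cmod (coef g (k - j))) summable_on UNIV"
  by (rule summable_on_comparison_test[OF summable_on_cmult_left[OF coef_summable[of f], of "norm g"]])
     (auto intro: mult_left_mono coef_le_norm)

lemma conv_summable: "(\<lambda>j. coef f j * coef g (k - j)) summable_on UNIV"
  by (rule abs_summable_summable) (simp add: norm_mult conv_abs_summable)

lemma conv_swap_infsum:
  fixes u v :: "int \<Rightarrow> 'a::{t2_space,comm_monoid_add,times}"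
  shows "(\<Sum>\<^sub>\<infinity>j. u j * v (k - j)) = (\<Sum>\<^sub>\<infinity>j. u (k - j) * v j)"
  by (rule infsum_reindex_bij_witness[where i = "\<lambda>j. k - j" and j = "\<lambda>j. k - j"]) auto

lemma cmod_conv_le: "cmod (conv (coef f) (coef g) k) \<le> (\<Sum>\<^sub>\<infinity>j. cmod (coef f j) * cmod (coef g (k - j)))"
  unfolding conv_def
  using norm_infsum_bound[of "\<lambda>j. coef f j * coef g (k - j)" UNIV] conv_abs_summable
  by (simp add: norm_mult)

lemma sum_shift_le: "finite F \<Longrightarrow> (\<Sum>k\<in>F. cmod (coef g (k - j))) \<le> (\<Sum>\<^sub>\<infinity>k. cmod (coef g k))"
proof -
  assume F: "finite F"
  have "(\<Sum>k\<in>F. cmod (coef g (k - j))) = (\<Sum>k\<in>(\<lambda>k. k - j) ` F. cmod (coef g k))"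
    by (subst sum.reindex) (auto simp: inj_on_def)
  also have "\<dots> \<le> (\<Sum>\<^sub>\<infinity>k. cmod (coef g k))" using F by (intro sum_coef_le) auto
  finally show ?thesis .
qed

text \<open>The weighted l2 part of the norm, written as a difference so that the norm splits into
  its two parts by definition.\<close>

definition l2part :: "wsym \<Rightarrow> real" where
  "l2part f = norm f - (\<Sum>\<^sub>\<infinity>k. cmod (coef f k))"

lemma l2part: "finite F \<Longrightarrow> L2_set (\<lambda>k. sqrt \<bar>real_of_int k\<bar> * cmod (coef f k)) F \<le> l2part f"
  using norm_wsym_split[of F f] by (simp add: l2part_def)

lemma l2part_nonneg: "l2part f \<ge> 0"
  using infsum_coef_le_norm[of f] by (simp add: l2part_def)

lemma L2_set_shift_le:
  assumes F: "finite F"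
  shows "L2_set (\<lambda>k. sqrt \<bar>real_of_int (k - j)\<bar> * cmod (coef g (k - j))) F \<le> l2part g"
proof -
  have "L2_set (\<lambda>k. sqrt \<bar>real_of_int (k - j)\<bar> * cmod (coef g (k - j))) F =
      L2_set (\<lambda>k. sqrt \<bar>real_of_int k\<bar> * cmod (coef g k)) ((\<lambda>k. k - j) ` F)"
    unfolding L2_set_def by (subst sum.reindex) (auto simp: inj_on_def)
  also have "\<dots> \<le> l2part g" using F by (intro l2part) auto
  finally show ?thesis .
qed

text \<open>The inequality sqrt |k| <= sqrt |j| + sqrt |k - j| acts as a Leibniz rule for the
  weight: it leaves two convolutions of a weighted l2 sequence with an l1 sequence, each estimated
  by Minkowski. The resulting bound is the product of the norms less the product of the two weighted
  parts.\<close>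

lemma wN_conv_le:
  assumes F: "finite F"
  shows "wN F (conv (coef f) (coef g)) \<le> norm f * norm g"
proof -
  let ?l1 = "\<lambda>f. \<Sum>\<^sub>\<infinity>k. cmod (coef f k)"
  have l10: "?l1 f \<ge> 0" for f by (intro infsum_nonneg) auto
  have "(\<Sum>k\<in>F. cmod (conv (coef f) (coef g) k)) \<le>
      (\<Sum>k\<in>F. \<Sum>\<^sub>\<infinity>j. cmod (coef f j) * cmod (coef g (k - j)))"
    by (intro sum_mono cmod_conv_le)
  also have "\<dots> = (\<Sum>\<^sub>\<infinity>j. \<Sum>k\<in>F. cmod (coef f j) * cmod (coef g (k - j)))"
    by (rule infsum_finite_sum[symmetric]) (rule conv_abs_summable)
  also have "\<dots> \<le> (\<Sum>\<^sub>\<infinity>j. cmod (coef f j) * ?l1 g)"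
  proof (rule infsum_mono)
    show "(\<lambda>j. \<Sum>k\<in>F. cmod (coef f j) * cmod (coef g (k - j))) summable_on UNIV"
      by (rule summable_on_finite_sum) (rule conv_abs_summable)
    show "(\<lambda>j. cmod (coef f j) * ?l1 g) summable_on UNIV"
      by (rule summable_on_cmult_left[OF coef_summable])
    show "(\<Sum>k\<in>F. cmod (coef f j) * cmod (coef g (k - j))) \<le> cmod (coef f j) * ?l1 g" for j
      unfolding sum_distrib_left[symmetric] by (intro mult_left_mono sum_shift_le F) auto
  qed
  also have "\<dots> = ?l1 f * ?l1 g" by (rule infsum_cmult_left') 
  finally have 1: "(\<Sum>k\<in>F. cmod (conv (coef f) (coef g) k)) \<le> ?l1 f * ?l1 g" .
  \<comment> \<open>\<open>h1\<close> carries the weight on \<open>f\<close>, after the substitution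
    of k - j for j, and \<open>h2\<close> carries it on \<open>g\<close>. As functions of
    \<open>k\<close> both are multiples of shifts of one fixed sequence.\<close>
  define h1 where "h1 j k = sqrt \<bar>real_of_int (k - j)\<bar> * cmod (coef f (k - j)) * cmod (coef g j)" for j k
  define h2 where "h2 j k = cmod (coef f j) * (sqrt \<bar>real_of_int (k - j)\<bar> * cmod (coef g (k - j)))" for j k
  have L1: "L2_set (h1 j) F \<le> l2part f * cmod (coef g j)" for j
    unfolding h1_def by (subst L2_set_left_distrib[symmetric]) (auto intro!: mult_right_mono L2_set_shift_le[OF F, simplified])
  have L2: "L2_set (h2 j) F \<le> cmod (coef f j) * l2part g" for j
    unfolding h2_def by (subst L2_set_right_distrib[symmetric]) (auto intro!: mult_left_mono L2_set_shift_le[OF F, simplified])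
  have sb1: "(\<lambda>j. l2part f * cmod (coef g j)) summable_on UNIV"
    by (rule summable_on_cmult_right[OF coef_summable])
  have sb2: "(\<lambda>j. cmod (coef f j) * l2part g) summable_on UNIV"
    by (rule summable_on_cmult_left[OF coef_summable])
  have hb: "h j k \<le> b j" if "L2_set (h j) F \<le> b j" "k \<in> F" for h b j k
    using member_le_L2_set[OF F \<open>k \<in> F\<close>, of "h j"] that by linarith
  have sh1: "(\<lambda>j. h1 j k) summable_on UNIV" if "k \<in> F" for k
    by (rule summable_on_comparison_test[OF sb1]) (use hb[of h1 _ "\<lambda>j. l2part f * cmod (coef g j)", OF L1 that] in \<open>auto simp: h1_def\<close>)
  have sh2: "(\<lambda>j. h2 j k) summable_on UNIV" if "k \<in> F" for k
    by (rule summable_on_comparison_test[OF sb2]) (use hb[of h2 _ "\<lambda>j. cmod (coef f j) * l2part g", OF L2 that] in \<open>auto simp: h2_def\<close>)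
  have pt: "sqrt \<bar>real_of_int k\<bar> * cmod (conv (coef f) (coef g) k) \<le> (\<Sum>\<^sub>\<infinity>j. h1 j k) + (\<Sum>\<^sub>\<infinity>j. h2 j k)"
    if k: "k \<in> F" for k
  proof -
    let ?u = "\<lambda>j. (sqrt \<bar>real_of_int j\<bar> * cmod (coef f j)) * cmod (coef g (k - j))"
    have su: "?u summable_on UNIV"
      using sh1[OF k] unfolding h1_def
      by (subst summable_on_reindex_bij_witness[where i = "\<lambda>j. k - j" and j = "\<lambda>j. k - j" and
         h = "\<lambda>j. sqrt \<bar>real_of_int (k - j)\<bar> * cmod (coef f (k - j)) * cmod (coef g j)" and T = UNIV]) auto
    have u: "(\<Sum>\<^sub>\<infinity>j. ?u j) = (\<Sum>\<^sub>\<infinity>j. h1 j k)"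
      unfolding h1_def by (rule conv_swap_infsum)
    have "sqrt \<bar>real_of_int k\<bar> * cmod (conv (coef f) (coef g) k) \<le>
        sqrt \<bar>real_of_int k\<bar> * (\<Sum>\<^sub>\<infinity>j. cmod (coef f j) * cmod (coef g (k - j)))"
      by (intro mult_left_mono cmod_conv_le) auto
    also have "\<dots> = (\<Sum>\<^sub>\<infinity>j. sqrt \<bar>real_of_int k\<bar> * (cmod (coef f j) * cmod (coef g (k - j))))"
      by (rule infsum_cmult_right'[symmetric])
    also have "\<dots> \<le> (\<Sum>\<^sub>\<infinity>j. ?u j + h2 j k)"
    proof (rule infsum_mono)
      show "(\<lambda>j. sqrt \<bar>real_of_int k\<bar> * (cmod (coef f j) * cmod (coef g (k - j)))) summable_on UNIV"
        by (rule summable_on_cmult_right[OF conv_abs_summable])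
      show "(\<lambda>j. ?u j + h2 j k) summable_on UNIV" by (rule summable_on_add[OF su sh2[OF k]])
      fix j
      have "sqrt \<bar>real_of_int k\<bar> \<le> sqrt (\<bar>real_of_int j\<bar> + \<bar>real_of_int (k - j)\<bar>)"
        by (intro real_sqrt_le_mono) simp
      also have "\<dots> \<le> sqrt \<bar>real_of_int j\<bar> + sqrt \<bar>real_of_int (k - j)\<bar>"
        by (rule sqrt_add_le_add_sqrt) auto
      finally have "sqrt \<bar>real_of_int k\<bar> * (cmod (coef f j) * cmod (coef g (k - j))) \<le>
        (sqrt \<bar>real_of_int j\<bar> + sqrt \<bar>real_of_int (k - j)\<bar>) * (cmod (coef f j) * cmod (coef g (k - j)))"
        by (rule mult_right_mono) simp
      then show "sqrt \<bar>real_of_int k\<bar> * (cmod (coef f j) * cmod (coef g (k - j))) \<le> ?u j + h2 j k"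
        by (simp add: h2_def algebra_simps)
    qed
    also have "\<dots> = (\<Sum>\<^sub>\<infinity>j. h1 j k) + (\<Sum>\<^sub>\<infinity>j. h2 j k)"
      using u infsum_add[OF su sh2[OF k]] by simp
    finally show ?thesis .
  qed
  have "L2_set (\<lambda>k. sqrt \<bar>real_of_int k\<bar> * cmod (conv (coef f) (coef g) k)) F \<le>
      L2_set (\<lambda>k. (\<Sum>\<^sub>\<infinity>j. h1 j k) + (\<Sum>\<^sub>\<infinity>j. h2 j k)) F"
    using pt by (intro L2_set_mono) auto
  also have "\<dots> \<le> L2_set (\<lambda>k. \<Sum>\<^sub>\<infinity>j. h1 j k) F + L2_set (\<lambda>k. \<Sum>\<^sub>\<infinity>j. h2 j k) F"
    by (rule L2_set_triangle_ineq)
  also have "\<dots> \<le> (\<Sum>\<^sub>\<infinity>j. l2part f * cmod (coef g j)) + (\<Sum>\<^sub>\<infinity>j. cmod (coef f j) * l2part g)"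
    by (intro add_mono L2_set_infsum_le F L1 L2 sb1 sb2) (auto simp: h1_def h2_def)
  also have "\<dots> = l2part f * ?l1 g + ?l1 f * l2part g"
    by (simp add: infsum_cmult_left' infsum_cmult_right')
  finally have "wN F (conv (coef f) (coef g)) \<le> ?l1 f * ?l1 g + (l2part f * ?l1 g + ?l1 f * l2part g)"
    using 1 unfolding wN_def by linarith
  also have "\<dots> \<le> (?l1 f + l2part f) * (?l1 g + l2part g)"
    using mult_nonneg_nonneg[OF l2part_nonneg l2part_nonneg, of f g] by (simp add: algebra_simps)
  also have "\<dots> = norm f * norm g" by (simp add: l2part_def)
  finally show ?thesis .
qed

lemma conv_wcoef: "conv (coef f) (coef g) \<in> wcoef"
  by (rule wcoefI) (rule wN_conv_le)

section \<open>Evaluation on the unit circle\<close>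

definition ev :: "wsym \<Rightarrow> complex \<Rightarrow> complex" where
  "ev f z = (\<Sum>\<^sub>\<infinity>k. coef f k * z powi k)"

lemma norm_powi_circle: "cmod z = 1 \<Longrightarrow> cmod (z powi k) = 1"
  by (simp add: norm_power_int)

lemma ev_summable: "cmod z = 1 \<Longrightarrow> (\<lambda>k. coef f k * z powi k) summable_on UNIV"
  by (rule abs_summable_summable) (simp add: norm_mult norm_powi_circle coef_summable)

lemma ev_uniform_limit:
  "uniform_limit (sphere 0 1) (\<lambda>F z. \<Sum>k\<in>F. coef f k * z powi k) (ev f) (finite_subsets_at_top UNIV)"
  unfolding ev_def
  by (rule Weierstrass_m_test_general[OF _ coef_summable[of f]]) (simp add: norm_mult norm_powi_circle)

lemma continuous_on_ev: "continuous_on (sphere 0 1) (ev f)"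
proof (rule uniform_limit_theorem[OF _ ev_uniform_limit])
  have "continuous_on (sphere 0 1) (\<lambda>z::complex. \<Sum>k\<in>F. coef f k * z powi k)" for F
    by (intro continuous_intros) auto
  then show "\<forall>\<^sub>F F in finite_subsets_at_top UNIV. continuous_on (sphere 0 1) (\<lambda>z. \<Sum>k\<in>F. coef f k * z powi k)"
    by simp
qed simp

lemma cmod_ev_le: "cmod z = 1 \<Longrightarrow> cmod (ev f z) \<le> norm f"
proof -
  assume z: "cmod z = 1"
  have "cmod (ev f z) \<le> (\<Sum>\<^sub>\<infinity>k. cmod (coef f k * z powi k))"
    unfolding ev_def by (rule norm_infsum_bound) (simp add: norm_mult norm_powi_circle z coef_summable)
  also have "\<dots> \<le> norm f" using infsum_coef_le_norm by (simp add: norm_mult norm_powi_circle z)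
  finally show ?thesis .
qed

lemma ev_add: "cmod z = 1 \<Longrightarrow> ev (f + g) z = ev f z + ev g z"
  by (simp add: ev_def distrib_right infsum_add ev_summable)

lemma ev_uminus: "ev (- f) z = - ev f z"
  by (simp add: ev_def infsum_uminus)

lemma ev_diff: "cmod z = 1 \<Longrightarrow> ev (f - g) z = ev f z - ev g z"
  using ev_add[of z f "- g"] by (simp add: ev_uminus)

text \<open>The double series converges absolutely because both coefficient sequences are in l1, so
  the order of summation may be exchanged.\<close>

lemma ev_conv:
  assumes z: "cmod z = 1"
  shows "(\<Sum>\<^sub>\<infinity>k. conv (coef f) (coef g) k * z powi k) = ev f z * ev g z"
proof -
  have z0: "z \<noteq> 0" using z by auto
  let ?F = "\<lambda>k j. coef f j * coef g (k - j) * z powi k"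
  have "(\<lambda>p. cmod (case p of (j, k) \<Rightarrow> ?F k j)) summable_on UNIV \<times> UNIV"
    unfolding Infinite_Sum.abs_summable_on_Sigma_iff
  proof (intro conjI ballI)
    have sh: "(\<lambda>k. cmod (coef g (k - j))) summable_on UNIV"
       and si: "(\<Sum>\<^sub>\<infinity>k. cmod (coef g (k - j))) = (\<Sum>\<^sub>\<infinity>k. cmod (coef g k))" for j
      using coef_summable[of g]
        summable_on_reindex_bij_witness[where S = UNIV and T = UNIV and i = "\<lambda>k. k + j" and j = "\<lambda>k. k - j"
          and h = "\<lambda>k. cmod (coef g k)" and g = "\<lambda>k. cmod (coef g (k - j))"]
        infsum_reindex_bij_witness[where S = UNIV and T = UNIV and i = "\<lambda>k. k + j" and j = "\<lambda>k. k - j"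
          and h = "\<lambda>k. cmod (coef g k)" and g = "\<lambda>k. cmod (coef g (k - j))"] by auto
    show "(\<lambda>k. cmod (case (j, k) of (j, k) \<Rightarrow> ?F k j)) summable_on UNIV" for j
      by (simp add: norm_mult norm_powi_circle z summable_on_cmult_right sh)
    show "(\<lambda>j. norm (\<Sum>\<^sub>\<infinity>k. cmod (case (j, k) of (j, k) \<Rightarrow> ?F k j))) summable_on UNIV"
      by (simp add: norm_mult norm_powi_circle z infsum_cmult_right' si infsum_nonneg)
         (rule summable_on_cmult_left[OF coef_summable])
  qed
  then have s: "(\<lambda>(j, k). ?F k j) summable_on UNIV \<times> UNIV" by (rule abs_summable_summable)
  have "(\<Sum>\<^sub>\<infinity>k. conv (coef f) (coef g) k * z powi k) = (\<Sum>\<^sub>\<infinity>k. \<Sum>\<^sub>\<infinity>j. ?F k j)"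
    by (simp add: conv_def infsum_cmult_left')
  also have "\<dots> = (\<Sum>\<^sub>\<infinity>j. \<Sum>\<^sub>\<infinity>k. ?F k j)"
    by (rule infsum_swap_banach[OF s, symmetric])
  also have "\<dots> = (\<Sum>\<^sub>\<infinity>j. coef f j * z powi j * ev g z)"
  proof (rule infsum_cong)
    fix j
    have "(\<Sum>\<^sub>\<infinity>k. ?F k j) = (\<Sum>\<^sub>\<infinity>k. coef f j * coef g k * z powi (k + j))"
      by (rule infsum_reindex_bij_witness[where i = "\<lambda>k. k + j" and j = "\<lambda>k. k - j"]) auto
    also have "\<dots> = (\<Sum>\<^sub>\<infinity>k. coef f j * z powi j * (coef g k * z powi k))"
      using z0 by (intro infsum_cong) (simp add: power_int_add mult_ac)
    also have "\<dots> = coef f j * z powi j * ev g z" by (simp add: ev_def infsum_cmult_right')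
    finally show "(\<Sum>\<^sub>\<infinity>k. ?F k j) = coef f j * z powi j * ev g z" .
  qed
  also have "\<dots> = ev f z * ev g z" by (simp add: ev_def infsum_cmult_left')
  finally show ?thesis .
qed

section \<open>Orthogonality of the characters and recovery of the coefficients\<close>

lemma integral_cis: "integral {0..2*pi} (\<lambda>x. cis (of_int k * x)) = (if k = 0 then 2 * pi else 0)"
proof (cases "k = 0")
  case False
  have "((\<lambda>x. cis (of_int k * x)) has_integral
      (cis (of_int k * (2 * pi)) / (\<i> * of_int k) - cis (of_int k * 0) / (\<i> * of_int k))) {0..2*pi}"
  proof (rule fundamental_theorem_of_calculus)
    fix x :: real
    have "((\<lambda>x. exp (\<i> * of_int k * of_real x) / (\<i> * of_int k)) has_vector_derivative
        exp (\<i> * of_int k * of_real x)) (at x within {0..2*pi})"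
      using False
      by (auto intro!: derivative_eq_intros has_vector_derivative_real_field simp: field_simps)
    then show "((\<lambda>x. cis (of_int k * x) / (\<i> * of_int k)) has_vector_derivative cis (of_int k * x))
       (at x within {0..2*pi})"
      by (simp add: cis_conv_exp mult_ac)
  qed simp
  moreover have "cis (of_int k * (2 * pi)) = 1" using cis_multiple_2pi[of "of_int k"] by (simp add: mult_ac)
  ultimately show ?thesis using False by (simp add: integral_unique)
qed (simp add: scaleR_conv_of_real)

lemma fourier_continuous:
  assumes "continuous_on {0..2*pi} (\<lambda>x. \<phi> (cis x))"
  shows "fourier \<phi> k = integral {0..2*pi} (\<lambda>x. \<phi> (cis x) * cis (- (of_int k * x))) / (2 * pi)"
proof -
  have "(\<lambda>x. \<phi> (cis x) * cis (- (of_int k * x))) absolutely_integrable_on {0..2*pi}"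
    by (intro absolutely_integrable_continuous_real continuous_intros assms)
  then show ?thesis by (simp add: fourier_def set_lebesgue_integral_eq_integral)
qed

lemma cis_powi: "cis x powi k = cis (of_int k * x)"
proof (cases "k \<ge> 0")
  case True
  then show ?thesis by (simp add: power_int_def Complex.DeMoivre)
next
  case False
  then show ?thesis by (simp add: power_int_def Complex.DeMoivre)
qed

lemma continuous_on_circle_cis:
  assumes "continuous_on (sphere 0 1) g"
  shows "continuous_on S (\<lambda>x. g (cis x))"
  by (rule continuous_on_compose2[OF assms, of S cis]) (auto intro!: continuous_intros)

text \<open>The partial sums converge uniformly on the circle and may be integrated; by
  orthogonality their integrals already have the final value once \<open>F\<close> contains
  \<open>k\<close>.\<close>

lemma fourier_ev: "fourier (ev f) k = coef f k"
proof -
  have "uniform_limit {0..2*pi} (\<lambda>F x. \<Sum>j\<in>F. coef f j * cis x powi j) (\<lambda>x. ev f (cis x)) (finite_subsets_at_top UNIV)"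
    using ev_uniform_limit[of f] by (rule uniform_limit_compose') auto
  then have "uniform_limit {0..2*pi} (\<lambda>F x. (\<Sum>j\<in>F. coef f j * cis x powi j) * cis (- (of_int k * x)))
     (\<lambda>x. ev f (cis x) * cis (- (of_int k * x))) (finite_subsets_at_top UNIV)"
  proof (rule uniform_lim_mult[OF _ uniform_limit_const])
    have "bounded ((ev f \<circ> cis) ` {0..2*pi})"
      by (auto intro!: boundedI[of _ "norm f"] cmod_ev_le)
    then show "bounded ((\<lambda>x. ev f (cis x)) ` {0..2*pi})" by (simp add: image_comp o_def)
    show "bounded ((\<lambda>x. cis (- (of_int k * x))) ` {0..2*pi})"
      by (auto intro!: boundedI[of _ 1])
  qed
  then obtain I J where
    I: "\<And>F. ((\<lambda>x. (\<Sum>j\<in>F. coef f j * cis x powi j) * cis (- (of_int k * x))) has_integral I F) {0..2*pi}"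
    and J: "((\<lambda>x. ev f (cis x) * cis (- (of_int k * x))) has_integral J) {0..2*pi}"
    and IJ: "(I \<longlongrightarrow> J) (finite_subsets_at_top UNIV)"
    by (rule uniform_limit_integral) (auto intro!: continuous_intros)
  have "I F = (if k \<in> F then 2 * pi * coef f k else 0)" if "finite F" for F
  proof -
    have "I F = integral {0..2*pi} (\<lambda>x. (\<Sum>j\<in>F. coef f j * cis x powi j) * cis (- (of_int k * x)))"
      using I[of F] by (simp add: integral_unique)
    also have "\<dots> = integral {0..2*pi} (\<lambda>x. \<Sum>j\<in>F. coef f j * cis (of_int (j - k) * x))"
      by (intro integral_cong) (simp add: sum_distrib_right cis_powi cis_mult left_diff_distrib mult.assoc)
    also have "\<dots> = (\<Sum>j\<in>F. integral {0..2*pi} (\<lambda>x. coef f j * cis (of_int (j - k) * x)))"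
      using that by (intro integral_sum integrable_continuous_real continuous_intros)
    also have "\<dots> = (\<Sum>j\<in>F. if j = k then 2 * pi * coef f k else 0)"
      by (intro sum.cong refl, simp only: integral_mult_right integral_cis) auto
    also have "\<dots> = (if k \<in> F then 2 * pi * coef f k else 0)" using that by simp
    finally show ?thesis .
  qed
  then have "\<forall>\<^sub>F F in finite_subsets_at_top UNIV. I F = 2 * pi * coef f k"
    unfolding eventually_finite_subsets_at_top by (intro exI[of _ "{k}"]) auto
  then have "(I \<longlongrightarrow> 2 * pi * coef f k) (finite_subsets_at_top UNIV)" by (rule tendsto_eventually)
  then have "J = 2 * pi * coef f k" using IJ tendsto_unique finite_subsets_at_top_neq_bot by blast
  then show ?thesis
    using J by (simp add: fourier_continuous continuous_on_circle_cis continuous_on_ev integral_unique)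
qed

lemma fourier_cong:
  assumes "\<And>z. cmod z = 1 \<Longrightarrow> \<phi> z = \<psi> z"
  shows "fourier \<phi> k = fourier \<psi> k"
  using assms by (simp add: fourier_def)

text \<open>Allows identities in the algebra, such as the ring axioms, to be checked pointwise on
  the circle instead of on iterated convolutions.\<close>

lemma ev_inject:
  assumes "\<And>z. cmod z = 1 \<Longrightarrow> ev f z = ev g z"
  shows "f = g"
proof (rule wsym_eqI)
  show "coef f k = coef g k" for k
    using fourier_cong[of "ev f" "ev g" k] assms by (simp add: fourier_ev)
qed

instantiation wsym :: comm_ring_1
begin

lift_definition times_wsym :: "wsym \<Rightarrow> wsym \<Rightarrow> wsym" is conv
  by (metis Wsym_inverse conv_wcoef)
lift_definition one_wsym :: wsym is "\<lambda>k. if k = 0 then 1 else 0"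
proof -
  have "wN F (\<lambda>k. if k = 0 then 1 else 0) \<le> 1" if "finite F" for F :: "int set"
  proof -
    have "L2_set (\<lambda>k. sqrt \<bar>real_of_int k\<bar> * cmod (if k = 0 then 1 else 0)) F = 0"
      by (rule L2_set_eq_0_iff[THEN iffD2, OF that]) auto
    moreover have "(\<Sum>k\<in>F. cmod (if k = 0 then 1 else 0)) = (if 0 \<in> F then 1 else 0)"
      using that by (simp add: if_distrib cong: if_cong)
    ultimately show ?thesis unfolding wN_def by simp
  qed
  then show "(\<lambda>k::int. if k = 0 then 1 else 0) \<in> wcoef" by (rule wcoefI)
qed

lemma ev_mult: "cmod z = 1 \<Longrightarrow> ev (f * g) z = ev f z * ev g z"
  using ev_conv by (simp add: ev_def[of "f * g"] times_wsym.rep_eq)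

lemma ev_one: "ev 1 z = 1"
proof -
  have "ev 1 z = (\<Sum>\<^sub>\<infinity>k\<in>{0}. coef 1 k * z powi k)"
    unfolding ev_def by (rule infsum_cong_neutral) (auto simp: one_wsym.rep_eq)
  then show ?thesis by (simp add: one_wsym.rep_eq)
qed

lemma ev_zero: "ev 0 z = 0"
  by (simp add: ev_def)

instance
proof
  fix a b c :: wsym
  show "a * b * c = a * (b * c)" by (rule ev_inject) (simp add: ev_mult)
  show "a * b = b * a" by (rule ev_inject) (simp add: ev_mult)
  show "1 * a = a" by (rule ev_inject) (simp add: ev_mult ev_one)
  show "(a + b) * c = a * c + b * c" by (rule ev_inject) (simp add: ev_mult ev_add distrib_right)
  have "coef 0 0 \<noteq> coef 1 0" by (simp add: one_wsym.rep_eq)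
  then show "(0::wsym) \<noteq> 1" by metis
qed

end

instance wsym :: real_normed_algebra
proof
  fix a :: real and x y :: wsym
  have ev_scaleR: "ev (a *\<^sub>R x) z = of_real a * ev x z" for x z
    by (simp add: ev_def mult.assoc infsum_cmult_right')
  show "a *\<^sub>R x * y = a *\<^sub>R (x * y)" "x * a *\<^sub>R y = a *\<^sub>R (x * y)"
    by (rule ev_inject; simp add: ev_mult ev_scaleR)+
  show "norm (x * y) \<le> norm x * norm y"
    by (rule norm_wsym_leI) (simp add: times_wsym.rep_eq wN_conv_le)
qed

lemma coef_one: "coef 1 k = (if k = 0 then 1 else 0)" by (simp add: one_wsym.rep_eq)

lemma coef_mult: "coef (f * g) k = (\<Sum>\<^sub>\<infinity>j. coef f j * coef g (k - j))"
  by (simp add: times_wsym.rep_eq conv_def)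

section \<open>Uniqueness of Fourier coefficients\<close>

text \<open>Since conj z = 1/z on the circle, a real-linear p equals c z + conj c / z there with c =
  (p(1) - i p(i)) / 2. Such functions lie in the algebra, and so do the constants, hence all
  polynomials in Re z and Im z.\<close>

lemma real_polynomial_eq_ev:
  assumes "real_polynomial_function (p :: complex \<Rightarrow> real)"
  shows "\<exists>w. \<forall>z. cmod z = 1 \<longrightarrow> of_real (p z) = ev w z"
  using assms
proof (induction rule: real_polynomial_function.induct)
  case (linear p)
  have fin: "finite F \<Longrightarrow> (\<lambda>k. if k \<in> F then c k else 0) \<in> wcoef" for F :: "int set" and c
  proof (rule wcoefI[of _ "wN F c"])
    fix G :: "int set" assume F: "finite F" and G: "finite G"
    let ?f = "\<lambda>k. if k \<in> F then c k else 0"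
    have "wN G ?f \<le> wN (F \<union> G) ?f" using F G by (intro wN_mono) auto
    also have "\<dots> = wN F ?f"
      unfolding wN_def L2_set_def using F G
      by (intro arg_cong2[where f = "(+)"] arg_cong[where f = sqrt] sum.mono_neutral_right) auto
    also have "\<dots> = wN F c" unfolding wN_def by (intro arg_cong2[where f = "(+)"] sum.cong L2_set_cong) auto
    finally show "wN G ?f \<le> wN F c" .
  qed
  define c :: "int \<Rightarrow> complex" where
    "c k = (if k = 1 then (p 1 - \<i> * p \<i>) / 2 else (p 1 + \<i> * p \<i>) / 2)" for k
  define w where "w = Wsym (\<lambda>k. if k \<in> {1,-1} then c k else 0)"
  have cw: "coef w k = (if k \<in> {1,-1} then c k else 0)" for k
    unfolding w_def using fin[of "{1,-1}" c] by (simp add: Wsym_inverse)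
  show ?case
  proof (intro exI[of _ w] allI impI)
    fix z :: complex assume z: "cmod z = 1"
    have "ev w z = (\<Sum>\<^sub>\<infinity>k\<in>{1,-1}. coef w k * z powi k)"
      unfolding ev_def by (rule infsum_cong_neutral) (auto simp: cw)
    also have "\<dots> = c 1 * z + c (-1) * inverse z" by (simp add: cw)
    also have "inverse z = cnj z" using z by (simp add: inverse_complex_def complex_eq_iff cmod_def)
    also have "c 1 * z + c (-1) * cnj z = of_real (Re z * p 1 + Im z * p \<i>)"
      by (simp add: c_def complex_eq_iff field_simps)
    also have "Re z * p 1 + Im z * p \<i> = p z"
    proof -
      have "p z = p (Re z *\<^sub>R 1 + Im z *\<^sub>R \<i>)"
        by (rule arg_cong[where f = p]) (simp add: complex_eq_iff)
      then show ?thesis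
        using linear by (simp add: linear_simps(1,5) bounded_linear.linear linear_add linear_scale)
    qed
    finally show "of_real (p z) = ev w z" by simp
  qed
next
  case (const c)
  have "of_real c = ev (c *\<^sub>R 1) z" if "cmod z = 1" for z
  proof -
    have "ev (c *\<^sub>R 1) z = (\<Sum>\<^sub>\<infinity>k. of_real c * (coef 1 k * z powi k))" by (simp add: ev_def mult.assoc)
    then show ?thesis using ev_one[of z] by (simp add: infsum_cmult_right' flip: ev_def)
  qed
  then show ?case by blast
next
  case (add p q)
  then obtain v w where "\<forall>z. cmod z = 1 \<longrightarrow> of_real (p z) = ev v z" "\<forall>z. cmod z = 1 \<longrightarrow> of_real (q z) = ev w z"
    by blast
  then show ?case by (intro exI[of _ "v + w"]) (simp add: ev_add)
next
  case (mult p q)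
  then obtain v w where "\<forall>z. cmod z = 1 \<longrightarrow> of_real (p z) = ev v z" "\<forall>z. cmod z = 1 \<longrightarrow> of_real (q z) = ev w z"
    by blast
  then show ?case by (intro exI[of _ "v * w"]) (simp add: ev_mult)
qed

section \<open>Integrable functions orthogonal to all characters\<close>

lemma borel_measurable_circle:
  assumes "continuous_on (sphere 0 1) h"
  shows "(\<lambda>x. h (cis x)) \<in> borel_measurable lebesgue"
proof -
  have "(\<lambda>x. h (cis x)) \<in> borel_measurable borel"
    by (intro borel_measurable_continuous_onI continuous_on_circle_cis assms)
  then show ?thesis by (simp add: measurable_completion)
qed

lemma integrable_mult_circle:
  fixes G :: "real \<Rightarrow> complex"
  assumes G: "integrable lebesgue G" and h: "continuous_on (sphere 0 1) h"
  shows "integrable lebesgue (\<lambda>x. G x * h (cis x))"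
proof -
  have "bounded (h ` sphere 0 1)" using compact_continuous_image[OF h] compact_imp_bounded by auto
  then obtain B where "\<forall>w\<in>h ` sphere 0 1. cmod w \<le> B" unfolding bounded_iff by blast
  then have B: "cmod (h z) \<le> B" if "cmod z = 1" for z using that by simp
  show ?thesis
  proof (rule Bochner_Integration.integrable_bound)
    show "integrable lebesgue (\<lambda>x. of_real B * G x)" using G by simp
    show "(\<lambda>x. G x * h (cis x)) \<in> borel_measurable lebesgue"
      using borel_measurable_circle[OF h] G by simp
    show "AE x in lebesgue. cmod (G x * h (cis x)) \<le> cmod (of_real B * G x)"
    proof (rule AE_I2)
      fix x
      have "cmod (G x) * cmod (h (cis x)) \<le> cmod (G x) * \<bar>B\<bar>"
        using B[of "cis x"] by (intro mult_left_mono) auto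
      then show "cmod (G x * h (cis x)) \<le> cmod (of_real B * G x)" by (simp add: norm_mult mult_ac)
    qed
  qed
qed

text \<open>Integration against the fixed integrable \<open>G\<close> is continuous for uniform
  convergence on the circle.\<close>

lemma integral_circle_uniform_limit:
  fixes G :: "real \<Rightarrow> complex"
  assumes G: "integrable lebesgue G" and h: "continuous_on (sphere 0 1) h"
    and approx: "\<And>e. e > 0 \<Longrightarrow> \<exists>g. continuous_on (sphere 0 1) g \<and> (LINT x|lebesgue. G x * g (cis x)) = 0 \<and>
        (\<forall>z. cmod z = 1 \<longrightarrow> cmod (h z - g z) \<le> e)"
  shows "(LINT x|lebesgue. G x * h (cis x)) = 0"
proof -
  let ?I = "LINT x|lebesgue. cmod (G x)"
  have le: "cmod (LINT x|lebesgue. G x * h (cis x)) \<le> e * ?I" if e: "e > 0" for e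
  proof -
    obtain g where g: "continuous_on (sphere 0 1) g" "(LINT x|lebesgue. G x * g (cis x)) = 0"
        "\<And>z. cmod z = 1 \<Longrightarrow> cmod (h z - g z) \<le> e" using approx[OF e] by blast
    have "(LINT x|lebesgue. G x * h (cis x)) = (LINT x|lebesgue. G x * h (cis x)) - (LINT x|lebesgue. G x * g (cis x))"
      using g by simp
    also have "\<dots> = (LINT x|lebesgue. G x * h (cis x) - G x * g (cis x))"
      by (intro Bochner_Integration.integral_diff[symmetric] integrable_mult_circle G h g)
    also have "cmod \<dots> \<le> (LINT x|lebesgue. e * cmod (G x))"
    proof (rule Bochner_Integration.integral_norm_bound_integral)
      show "integrable lebesgue (\<lambda>x. G x * h (cis x) - G x * g (cis x))"
        by (intro Bochner_Integration.integrable_diff integrable_mult_circle G h g)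
      show "integrable lebesgue (\<lambda>x. e * cmod (G x))" using G by simp
      fix x
      have "cmod (G x * (h (cis x) - g (cis x))) \<le> cmod (G x) * e"
        unfolding norm_mult using g(3)[of "cis x"] by (intro mult_left_mono) auto
      then show "cmod (G x * h (cis x) - G x * g (cis x)) \<le> e * cmod (G x)"
        by (simp add: algebra_simps)
    qed
    also have "\<dots> = e * ?I" by simp
    finally show ?thesis .
  qed
  have I0: "?I \<ge> 0" by (intro Bochner_Integration.integral_nonneg) auto
  have "cmod (LINT x|lebesgue. G x * h (cis x)) \<le> 0 + e" if "e > 0" for e
  proof -
    \<comment> \<open>Dividing by I + 1 instead of I covers the case that \<open>G\<close> has
      integral norm zero.\<close>
    have aux: "e / (I + 1) * I \<le> e" "e / (I + 1) > 0" if "0 \<le> I" "0 < e" for e I :: real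
      using that by (simp_all add: field_simps)
    show ?thesis using order_trans[OF le[OF aux(2)] aux(1)] that I0 by simp
  qed
  then have "cmod (LINT x|lebesgue. G x * h (cis x)) \<le> 0" by (rule field_le_epsilon)
  then show ?thesis by simp
qed

text \<open>Two approximations: characters give all symbols through their uniformly convergent
  series, and symbols give all continuous functions by Stone-Weierstrass, since the real and
  imaginary parts of a polynomial are symbols on the circle.\<close>

lemma integral_circle_continuous_eq_0:
  fixes G :: "real \<Rightarrow> complex"
  assumes G: "integrable lebesgue G"
    and zero: "\<And>k::int. (LINT x|lebesgue. G x * cis (of_int k * x)) = 0"
    and h: "continuous_on (sphere 0 1) h"
  shows "(LINT x|lebesgue. G x * h (cis x)) = 0"
proof (rule integral_circle_uniform_limit[OF G h])
  have ev0: "(LINT x|lebesgue. G x * ev w (cis x)) = 0" for w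
  proof (rule integral_circle_uniform_limit[OF G continuous_on_ev])
    fix e :: real assume e: "e > 0"
    have "\<exists>X. finite X \<and> X \<subseteq> UNIV \<and> (\<forall>Y. finite Y \<and> X \<subseteq> Y \<and> Y \<subseteq> UNIV \<longrightarrow>
        (\<forall>z\<in>sphere 0 1. dist (\<Sum>k\<in>Y. coef w k * z powi k) (ev w z) < e))"
      using uniform_limitD[OF ev_uniform_limit e, of w] by (simp only: eventually_finite_subsets_at_top)
    then obtain F where F: "finite F"
        "\<forall>z\<in>sphere 0 1. dist (\<Sum>k\<in>F. coef w k * z powi k) (ev w z) < e"
      by (meson subset_refl)
    have cont: "continuous_on (sphere 0 1) (\<lambda>z::complex. z powi k)" for k
      by (intro continuous_intros) auto
    have "(LINT x|lebesgue. G x * (\<Sum>k\<in>F. coef w k * cis x powi k)) =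
        (LINT x|lebesgue. (\<Sum>k\<in>F. coef w k * (G x * cis x powi k)))"
      by (simp add: sum_distrib_left mult_ac)
    also have "\<dots> = (\<Sum>k\<in>F. (LINT x|lebesgue. coef w k * (G x * cis x powi k)))"
      by (intro Bochner_Integration.integral_sum integrable_mult_right integrable_mult_circle[OF G cont])
    also have "\<dots> = 0"
      using zero by (intro sum.neutral) (simp add: cis_powi)
    finally show "\<exists>g. continuous_on (sphere 0 1) g \<and> (LINT x|lebesgue. G x * g (cis x)) = 0 \<and>
        (\<forall>z. cmod z = 1 \<longrightarrow> cmod (ev w z - g z) \<le> e)"
      using F by (intro exI[of _ "\<lambda>z. \<Sum>k\<in>F. coef w k * z powi k"])
        (auto intro!: continuous_intros less_imp_le simp: dist_norm norm_minus_commute)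
  qed
  fix e :: real assume e: "e > 0"
  obtain p where p: "polynomial_function p" "\<And>z. z \<in> sphere 0 1 \<Longrightarrow> cmod (h z - p z) < e"
    using Stone_Weierstrass_polynomial_function[OF _ h e] by auto
  have "real_polynomial_function (\<lambda>z. Re (p z))" "real_polynomial_function (\<lambda>z. Im (p z))"
    using p(1) unfolding polynomial_function_def
    by (auto simp: o_def dest: spec[of _ Re] spec[of _ Im] intro: bounded_linear_Re bounded_linear_Im)
  then obtain u v where uv: "\<And>z. cmod z = 1 \<Longrightarrow> of_real (Re (p z)) = ev u z"
      "\<And>z. cmod z = 1 \<Longrightarrow> of_real (Im (p z)) = ev v z"
    using real_polynomial_eq_ev by metis
  have pz: "p z = ev u z + \<i> * ev v z" if "cmod z = 1" for z
    using uv[OF that] complex_eq[of "p z"] by simp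
  have "(LINT x|lebesgue. G x * (ev u (cis x) + \<i> * ev v (cis x))) =
      (LINT x|lebesgue. G x * ev u (cis x) + \<i> * (G x * ev v (cis x)))"
    by (simp add: algebra_simps)
  also have "\<dots> = (LINT x|lebesgue. G x * ev u (cis x)) + (LINT x|lebesgue. \<i> * (G x * ev v (cis x)))"
    by (intro Bochner_Integration.integral_add integrable_mult_right integrable_mult_circle[OF G continuous_on_ev])
  also have "\<dots> = 0" by (simp add: ev0)
  finally show "\<exists>g. continuous_on (sphere 0 1) g \<and> (LINT x|lebesgue. G x * g (cis x)) = 0 \<and>
        (\<forall>z. cmod z = 1 \<longrightarrow> cmod (h z - g z) \<le> e)"
    using p(2) pz by (intro exI[of _ "\<lambda>z. ev u z + \<i> * ev v z"])
      (auto intro!: continuous_intros continuous_on_ev less_imp_le)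
qed

lemma Arg2pi_cis: "0 \<le> x \<Longrightarrow> x < 2 * pi \<Longrightarrow> Arg2pi (cis x) = x"
  by (rule Arg2pi_unique[of 1]) (auto simp: cis_conv_exp mult.commute)

text \<open>The conjugate sign of the function is an almost everywhere limit of continuous functions on the
  circle, with a cutoff at the point 1 where the argument jumps.\<close>

lemma fourier_unique:
  assumes int: "set_integrable lebesgue {0..2*pi} (\<lambda>x. \<phi> (cis x))"
    and zero: "\<And>k. fourier \<phi> k = 0"
  shows "AE x\<in>{0..2*pi} in lebesgue. \<phi> (cis x) = 0"
proof -
  define G where "G x = indicator {0..2*pi} x *\<^sub>R \<phi> (cis x)" for x
  have G: "integrable lebesgue G" using int by (simp add: G_def[abs_def] set_integrable_def)
  have "(LINT x|lebesgue. G x * cis (of_int k * x)) = 0" for k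
    using zero[of "- k"] unfolding fourier_def set_lebesgue_integral_def G_def by simp
  note G0 = integral_circle_continuous_eq_0[OF G this]
  define \<sigma> where "\<sigma> x = cnj (sgn (G x))" for x
  have Gm: "G \<in> borel_measurable lebesgue" using G by simp
  have "(\<lambda>x. cnj (G x / of_real (cmod (G x)))) \<in> borel_measurable lebesgue"
  proof (rule measurable_compose[where N = borel and g = cnj])
    show "(\<lambda>x. G x / of_real (cmod (G x))) \<in> borel_measurable lebesgue"
      using Gm by (intro borel_measurable_divide) auto
    show "cnj \<in> borel_measurable borel"
      by (intro borel_measurable_continuous_onI continuous_intros)
  qed
  then have "\<sigma> \<in> borel_measurable lebesgue" by (simp add: \<sigma>_def[abs_def] sgn_eq)
  then have "\<sigma> measurable_on UNIV" by (rule lebesgue_measurable_imp_measurable_on) auto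
  then obtain N c where N: "negligible N" and c: "\<And>n. continuous_on UNIV (c n :: real \<Rightarrow> complex)"
      and lim: "\<And>x. x \<notin> N \<Longrightarrow> (\<lambda>n. c n x) \<longlonglongrightarrow> \<sigma> x"
    unfolding measurable_on_def by auto
  \<comment> \<open>The radial retraction onto the closed unit disc. It leaves the limit unchanged,
    as that has modulus at most 1, and makes |G| a dominating function.\<close>
  define r :: "complex \<Rightarrow> complex" where "r w = w / of_real (max 1 (cmod w))" for w
  have r1: "cmod (r w) \<le> 1" for w by (simp add: r_def norm_divide divide_le_eq)
  have rid: "r w = w" if "cmod w \<le> 1" for w using that by (simp add: r_def max_def)
  have rc: "continuous_on A r" for A unfolding r_def by (intro continuous_intros) (auto simp: max_def)
  define h where "h n z = of_real (min 1 (real n * cmod (z - 1))) * r (c n (Arg2pi z))" for n z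
  have h1: "cmod (h n z) \<le> 1" for n z
    unfolding h_def norm_mult using r1 by (intro mult_le_one) (auto simp: min_def)
  have hn: "cmod (h n z) \<le> real n * cmod (z - 1)" for n z
  proof -
    have "cmod (h n z) \<le> (real n * cmod (z - 1)) * 1"
      unfolding h_def norm_mult using r1 by (intro mult_mono) (auto simp: min_def)
    then show ?thesis by simp
  qed
  have hc: "continuous_on (sphere 0 1) (h n)" for n
    unfolding continuous_on_eq_continuous_within
  proof
    fix z :: complex assume z: "z \<in> sphere 0 1"
    show "continuous (at z within sphere 0 1) (h n)"
    proof (cases "z = 1")
      case True
      have "((h n) \<longlongrightarrow> 0) (at 1 within sphere 0 1)"
      proof (rule Lim_null_comparison)
        show "\<forall>\<^sub>F z in at 1 within sphere 0 1. cmod (h n z) \<le> real n * cmod (z - 1)" using hn by simp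
        have "((\<lambda>z. real n * cmod (z - 1)) \<longlongrightarrow> real n * cmod (1 - 1)) (at (1::complex) within sphere 0 1)"
          by (intro tendsto_intros)
        then show "((\<lambda>z. real n * cmod (z - 1)) \<longlongrightarrow> 0) (at (1::complex) within sphere 0 1)" by simp
      qed
      moreover have "h n 1 = 0" by (simp add: h_def)
      ultimately show ?thesis using True by (simp add: continuous_within)
    next
      case False
      have "z \<notin> \<real>\<^sub>\<ge>\<^sub>0"
      proof
        assume "z \<in> \<real>\<^sub>\<ge>\<^sub>0"
        then obtain s where "z = of_real s" "s \<ge> 0" by (auto elim: nonneg_Reals_cases)
        then show False using z False by auto
      qed
      then have "isCont Arg2pi z" by (rule continuous_at_Arg2pi)
      moreover have "isCont (c n) (Arg2pi z)" using c[of n] by (simp add: continuous_on_eq_continuous_at)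
      moreover have "isCont r (c n (Arg2pi z))" using rc[of UNIV] by (simp add: continuous_on_eq_continuous_at)
      ultimately have "isCont (\<lambda>z. r (c n (Arg2pi z))) z" by (metis isCont_o2)
      then have "isCont (h n) z" unfolding h_def by (intro continuous_intros)
      then show ?thesis by (rule continuous_at_imp_continuous_within)
    qed
  qed
  have "(\<lambda>n. LINT x|lebesgue. G x * h n (cis x)) \<longlonglongrightarrow> (LINT x|lebesgue. of_real (cmod (G x)))"
  proof (rule integral_dominated_convergence)
    show "(\<lambda>x. complex_of_real (cmod (G x))) \<in> borel_measurable lebesgue" using Gm by measurable
    show "(\<lambda>x. G x * h n (cis x)) \<in> borel_measurable lebesgue" for n
      using integrable_mult_circle[OF G hc] by simp
    show "integrable lebesgue (\<lambda>x. cmod (G x))" using G by simp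
    show "AE x in lebesgue. cmod (G x * h n (cis x)) \<le> cmod (G x)" for n
      using h1[of n] by (intro AE_I2) (simp add: norm_mult mult_left_le)
    \<comment> \<open>0 and 2 pi are the two parameters of the point 1, where the cutoff vanishes;
      removing them costs a null set.\<close>
    have "AE x in lebesgue. x \<notin> N \<union> {0, 2*pi}"
      using N by (intro AE_not_in) (simp add: negligible_iff_null_sets[symmetric] negligible_Un)
    then show "AE x in lebesgue. (\<lambda>n. G x * h n (cis x)) \<longlonglongrightarrow> complex_of_real (cmod (G x))"
    proof (eventually_elim)
      case (elim x)
      show ?case
      proof (cases "x \<in> {0..2*pi}")
        case False
        then show ?thesis by (simp add: G_def)
      next
        case True
        then have x: "0 < x" "x < 2 * pi" using elim by auto
        have ne: "cis x \<noteq> 1"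
          using Arg2pi_cis[of x] Arg2pi_cis[of 0] x by auto
        have s1: "cmod (\<sigma> x) \<le> 1" by (simp add: \<sigma>_def norm_sgn)
        have "(\<lambda>n. r (c n x)) \<longlonglongrightarrow> r (\<sigma> x)"
          using rc[of UNIV] lim[of x] elim
          by (intro isCont_tendsto_compose[of _ r]) (auto simp: continuous_on_eq_continuous_at)
        then have l1: "(\<lambda>n. r (c n x)) \<longlonglongrightarrow> \<sigma> x" using rid[OF s1] by simp
        have "\<forall>\<^sub>F n in sequentially. min 1 (real n * cmod (cis x - 1)) = 1"
        proof -
          obtain m :: nat where m: "1 / cmod (cis x - 1) \<le> real m" using real_arch_simple by blast
          have "min 1 (real n * cmod (cis x - 1)) = 1" if "n \<ge> m" for n
          proof -
            have "1 \<le> real m * cmod (cis x - 1)" using m ne by (simp add: field_simps)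
            also have "\<dots> \<le> real n * cmod (cis x - 1)" using that by (intro mult_right_mono) auto
            finally show ?thesis by simp
          qed
          then show ?thesis using eventually_sequentially by blast
        qed
        then have l2: "(\<lambda>n. complex_of_real (min 1 (real n * cmod (cis x - 1)))) \<longlonglongrightarrow> of_real 1"
          by (intro tendsto_of_real tendsto_eventually)
        have "(\<lambda>n. G x * (complex_of_real (min 1 (real n * cmod (cis x - 1))) * r (c n x))) \<longlonglongrightarrow> G x * (of_real 1 * \<sigma> x)"
          by (intro tendsto_intros l1 l2)
        moreover have "G x * \<sigma> x = of_real (cmod (G x))"
        proof -
          have "G x * \<sigma> x = (G x * cnj (G x)) / of_real (cmod (G x))" by (simp add: \<sigma>_def sgn_eq)
          also have "\<dots> = of_real (cmod (G x))"
            by (simp add: complex_norm_square[symmetric] power2_eq_square)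
          finally show ?thesis .
        qed
        ultimately show ?thesis using x by (simp add: h_def Arg2pi_cis)
      qed
    qed
  qed
  then have "(LINT x|lebesgue. complex_of_real (cmod (G x))) = 0"
    using G0[OF hc] by (simp add: LIMSEQ_const_iff)
  then have "(LINT x|lebesgue. cmod (G x)) = 0" by simp
  then have "AE x in lebesgue. cmod (G x) = 0"
    using G by (subst (asm) integral_nonneg_eq_0_iff_AE) auto
  then show ?thesis by eventually_elim (auto simp: G_def indicator_def)
qed

section \<open>Functions and their symbols\<close>

definition wsym_of :: "(complex \<Rightarrow> complex) \<Rightarrow> wsym" where
  "wsym_of \<phi> = Wsym (fourier \<phi>)"

lemma fourier_wcoef:
  assumes "\<phi> \<in> B_alg"
  shows "fourier \<phi> \<in> wcoef" and "\<And>F. finite F \<Longrightarrow> wN F (fourier \<phi>) \<le> B_norm \<phi>"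
proof -
  show le: "wN F (fourier \<phi>) \<le> B_norm \<phi>" if "finite F" for F
    unfolding wN_def B_norm_def
  proof (intro add_mono)
    show "(\<Sum>k\<in>F. cmod (fourier \<phi> k)) \<le> (\<Sum>\<^sub>\<infinity>k. cmod (fourier \<phi> k))"
      using assms that by (intro finite_sum_le_infsum) (auto simp: B_alg_def)
    have "(\<Sum>k\<in>F. \<bar>real_of_int k\<bar> * (cmod (fourier \<phi> k))\<^sup>2) \<le> (\<Sum>\<^sub>\<infinity>k. \<bar>real_of_int k\<bar> * (cmod (fourier \<phi> k))\<^sup>2)"
      using assms that by (intro finite_sum_le_infsum) (auto simp: B_alg_def)
    then show "L2_set (\<lambda>k. sqrt \<bar>real_of_int k\<bar> * cmod (fourier \<phi> k)) F \<le>
       sqrt (\<Sum>\<^sub>\<infinity>k. \<bar>real_of_int k\<bar> * (cmod (fourier \<phi> k))\<^sup>2)"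
      by (simp add: L2_set_def power_mult_distrib)
  qed
  show "fourier \<phi> \<in> wcoef" by (rule wcoefI[OF le])
qed

lemma coef_sym: "\<phi> \<in> B_alg \<Longrightarrow> coef (wsym_of \<phi>) k = fourier \<phi> k"
  by (simp add: wsym_of_def Wsym_inverse fourier_wcoef)

lemma norm_le_B_norm:
  assumes "\<And>k. fourier \<phi> k = coef w k"
  shows "norm w \<le> B_norm \<phi>"
proof (rule norm_wsym_leI)
  fix F :: "int set" assume F: "finite F"
  have eq: "fourier \<phi> = coef w" using assms by blast
  have "(\<Sum>k\<in>F. cmod (coef w k)) \<le> (\<Sum>\<^sub>\<infinity>k. cmod (coef w k))" by (rule sum_coef_le[OF F])
  moreover have "(\<Sum>k\<in>F. \<bar>real_of_int k\<bar> * (cmod (coef w k))\<^sup>2) \<le> (\<Sum>\<^sub>\<infinity>k. \<bar>real_of_int k\<bar> * (cmod (coef w k))\<^sup>2)"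
    using F by (intro finite_sum_le_infsum coef_weighted_summable) auto
  then have "L2_set (\<lambda>k. sqrt \<bar>real_of_int k\<bar> * cmod (coef w k)) F \<le>
       sqrt (\<Sum>\<^sub>\<infinity>k. \<bar>real_of_int k\<bar> * (cmod (coef w k))\<^sup>2)"
    by (simp add: L2_set_def power_mult_distrib)
  ultimately show "wN F (coef w) \<le> B_norm \<phi>" by (simp add: wN_def B_norm_def eq)
qed

lemma set_integrable_circle:
  fixes g :: "complex \<Rightarrow> complex"
  assumes "continuous_on (sphere 0 1) g"
  shows "set_integrable lebesgue {0..2*pi} (\<lambda>x. g (cis x))"
  by (rule absolutely_integrable_continuous_real[OF continuous_on_circle_cis[OF assms]])

lemma ev_in_B_alg: "ev w \<in> B_alg"
proof -
  have eq: "fourier (ev w) = coef w" by (rule ext) (rule fourier_ev)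
  show ?thesis
    by (simp add: B_alg_def eq coef_summable coef_weighted_summable set_integrable_circle continuous_on_ev)
qed

lemma sym_ev [simp]: "wsym_of (ev w) = w"
  by (rule wsym_eqI) (simp add: coef_sym ev_in_B_alg fourier_ev)

lemma set_integrable_mult_cis:
  assumes "set_integrable lebesgue {0..2*pi} (\<lambda>x. \<phi> (cis x))"
  shows "set_integrable lebesgue {0..2*pi} (\<lambda>x. \<phi> (cis x) * cis (- (of_int k * x)))"
proof -
  have "integrable lebesgue (\<lambda>x. (indicator {0..2*pi} x *\<^sub>R \<phi> (cis x)) * (cis x powi (- k)))"
    using assms unfolding set_integrable_def
    by (rule integrable_mult_circle[where h = "\<lambda>z. z powi (- k)"]) (auto intro!: continuous_intros)
  then show ?thesis by (simp add: set_integrable_def cis_powi)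
qed

lemma fourier_diff:
  assumes "set_integrable lebesgue {0..2*pi} (\<lambda>x. \<phi> (cis x))"
    and "set_integrable lebesgue {0..2*pi} (\<lambda>x. \<psi> (cis x))"
  shows "fourier (\<lambda>z. \<phi> z - \<psi> z) k = fourier \<phi> k - fourier \<psi> k"
  using set_integral_diff(2)[OF assms[THEN set_integrable_mult_cis[of _ k]]]
  by (simp add: fourier_def left_diff_distrib diff_divide_distrib)

text \<open>The difference has vanishing Fourier coefficients. From here on every element of the
  algebra can be replaced by a continuous representative.\<close>

lemma sym_AE_eq:
  assumes "\<phi> \<in> B_alg"
  shows "AE x\<in>{0..2*pi} in lebesgue. \<phi> (cis x) = ev (wsym_of \<phi>) (cis x)"
proof -
  have i: "set_integrable lebesgue {0..2*pi} (\<lambda>x. \<phi> (cis x))" using assms by (simp add: B_alg_def)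
  have j: "set_integrable lebesgue {0..2*pi} (\<lambda>x. ev (wsym_of \<phi>) (cis x))"
    by (intro set_integrable_circle continuous_on_ev)
  have "AE x\<in>{0..2*pi} in lebesgue. \<phi> (cis x) - ev (wsym_of \<phi>) (cis x) = 0"
  proof (rule fourier_unique[where \<phi> = "\<lambda>z. \<phi> z - ev (wsym_of \<phi>) z"])
    show "set_integrable lebesgue {0..2*pi} (\<lambda>x. \<phi> (cis x) - ev (wsym_of \<phi>) (cis x))"
      using i j by (rule set_integral_diff(1))
    show "fourier (\<lambda>z. \<phi> z - ev (wsym_of \<phi>) z) k = 0" for k
      using fourier_diff[OF i j] by (simp add: fourier_ev coef_sym assms)
  qed
  then show ?thesis by simp
qed

text \<open>The norm of the difference is continuous and nonnegative in the parameter with integral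
  zero, so it vanishes identically. This turns the almost everywhere conditions of the definitions
  into pointwise ones.\<close>

lemma AE_circle_imp_eq:
  fixes f g :: "complex \<Rightarrow> 'a::real_normed_vector"
  assumes f: "continuous_on (sphere 0 1) f" and g: "continuous_on (sphere 0 1) g"
    and ae: "AE x\<in>{0..2*pi} in lebesgue. f (cis x) = g (cis x)" and z: "cmod z = 1"
  shows "f z = g z"
proof (rule ccontr)
  assume ne: "f z \<noteq> g z"
  define h where "h x = norm (f (cis x) - g (cis x))" for x
  have hc: "continuous_on {0..2*pi} h"
    unfolding h_def using f g by (intro continuous_intros continuous_on_circle_cis)
  have "AE x in lebesgue. indicator {0..2*pi} x *\<^sub>R h x = 0"
    using ae by eventually_elim (auto simp: h_def indicator_def)
  then have "(LINT x:{0..2*pi}|lebesgue. h x) = 0"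
    unfolding set_lebesgue_integral_def by (rule integral_eq_zero_AE)
  moreover have "h absolutely_integrable_on {0..2*pi}" by (rule absolutely_integrable_continuous_real[OF hc])
  ultimately have "integral {0..2*pi} h = 0" by (simp add: set_lebesgue_integral_eq_integral)
  moreover have "h integrable_on {0..2*pi}" using hc by (rule integrable_continuous_real)
  ultimately have "(h has_integral 0) (cbox 0 (2*pi))" by (metis integrable_integral interval_cbox)
  then have h0: "h x = 0" if "x \<in> {0..2*pi}" for x
    using has_integral_0_cbox_imp_0[of 0 "2*pi" h x] hc that pi_gt_zero by (auto simp: h_def)
  have "Arg2pi z \<in> {0..2*pi}" using Arg2pi_lt_2pi[of z] Arg2pi_ge_0[of z] by auto
  moreover have "cis (Arg2pi z) = z" using Arg2pi_eq[of z] z by (simp add: cis_conv_exp)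
  ultimately show False using h0[of "Arg2pi z"] ne by (simp add: h_def)
qed

no_notation fps_nth (infixl "$" 75)

section \<open>Matrix symbols\<close>

definition msym :: "(complex \<Rightarrow> complex ^ 'n ^ 'n::finite) \<Rightarrow> wsym ^ 'n ^ 'n" where
  "msym a = (\<chi> \<alpha> \<beta>. wsym_of (\<lambda>z. a z $ \<alpha> $ \<beta>))"

definition evm :: "wsym ^ 'n ^ 'n::finite \<Rightarrow> complex \<Rightarrow> complex ^ 'n ^ 'n" where
  "evm A z = (\<chi> \<alpha> \<beta>. ev (A $ \<alpha> $ \<beta>) z)"

lemma ev_sum: "cmod z = 1 \<Longrightarrow> ev (sum f S) z = (\<Sum>i\<in>S. ev (f i) z)"
  by (induction S rule: infinite_finite_induct) (auto simp: ev_zero ev_add)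

lemma evm_mult: "cmod z = 1 \<Longrightarrow> evm (A ** B) z = evm A z ** evm B z"
  by (simp add: evm_def matrix_matrix_mult_def vec_eq_iff ev_sum ev_mult)

lemma evm_one [simp]: "evm (mat 1) z = mat 1"
  by (simp add: evm_def mat_def vec_eq_iff ev_one ev_zero)

lemma evm_diff: "cmod z = 1 \<Longrightarrow> evm (A - B) z = evm A z - evm B z"
  by (simp add: evm_def vec_eq_iff ev_diff)

lemma evm_inject: "(\<And>z. cmod z = 1 \<Longrightarrow> evm A z = evm B z) \<Longrightarrow> A = B"
  by (simp add: evm_def vec_eq_iff) (metis ev_inject)

lemma continuous_on_evm: "continuous_on (sphere 0 1) (evm A)"
  unfolding evm_def by (intro continuous_intros continuous_on_ev)

lemma continuous_on_det:
  fixes f :: "'a::topological_space \<Rightarrow> complex ^ 'n ^ 'n"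
  assumes "continuous_on S f"
  shows "continuous_on S (\<lambda>x. det (f x))"
  unfolding det_def by (intro continuous_intros assms)

lemma cmod_evm_le: "cmod z = 1 \<Longrightarrow> cmod (evm A z $ i $ j) \<le> norm (A $ i $ j)"
  by (simp add: evm_def cmod_ev_le)

lemma msym_AE_eq:
  assumes "a \<in> BM_alg"
  shows "AE x\<in>{0..2*pi} in lebesgue. a (cis x) = evm (msym a) (cis x)"
proof -
  have "AE x in lebesgue. \<forall>\<alpha> \<beta>. x \<in> {0..2*pi} \<longrightarrow> a (cis x) $ \<alpha> $ \<beta> = ev (msym a $ \<alpha> $ \<beta>) (cis x)"
  proof (intro eventually_all_finite)
    fix \<alpha> \<beta>
    have "(\<lambda>z. a z $ \<alpha> $ \<beta>) \<in> B_alg" using assms by (simp add: BM_alg_def)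
    from sym_AE_eq[OF this]
    show "AE x in lebesgue. x \<in> {0..2*pi} \<longrightarrow> a (cis x) $ \<alpha> $ \<beta> = ev (msym a $ \<alpha> $ \<beta>) (cis x)"
      by (simp add: msym_def)
  qed
  then show ?thesis by eventually_elim (auto simp: vec_eq_iff evm_def)
qed

lemma evm_in_BM_alg: "evm A \<in> BM_alg"
  by (simp add: BM_alg_def evm_def ev_in_B_alg)

lemma msym_evm [simp]: "msym (evm A) = A"
  by (simp add: msym_def evm_def vec_eq_iff)

section \<open>Norms of matrix symbols\<close>

lemma norm_entry_le: "norm (A $ i $ j) \<le> norm (A :: 'a::real_normed_vector ^ 'n ^ 'm)"
  by (meson order_trans Finite_Cartesian_Product.norm_nth_le)

lemma norm_matrix_le_sum: "norm (A :: 'a::real_normed_vector ^ 'n ^ 'm) \<le> (\<Sum>i\<in>UNIV. \<Sum>j\<in>UNIV. norm (A $ i $ j))"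
proof -
  have "norm A \<le> (\<Sum>i\<in>UNIV. norm (A $ i))"
    unfolding norm_vec_def[of A] by (rule L2_set_le_sum) simp
  also have "\<dots> \<le> (\<Sum>i\<in>UNIV. \<Sum>j\<in>UNIV. norm (A $ i $ j))"
  proof (rule sum_mono)
    fix i show "norm (A $ i) \<le> (\<Sum>j\<in>UNIV. norm (A $ i $ j))"
      unfolding norm_vec_def[of "A $ i"] by (rule L2_set_le_sum) simp
  qed
  finally show ?thesis .
qed

text \<open>The norm is the l2 norm of the entry norms, and Cauchy-Schwarz makes it
  submultiplicative just as for the Frobenius norm. The identity may have norm larger than 1, hence
  the factors \<open>norm (mat 1)\<close> in later constants.\<close>

lemma norm_matrix_mult_le:
  fixes A B :: "wsym ^ 'n ^ 'n::finite"
  shows "norm (A ** B) \<le> norm A * norm B"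
proof -
  let ?col = "\<lambda>j. L2_set (\<lambda>k. norm (B $ k $ j)) UNIV"
  have e: "norm ((A ** B) $ i $ j) \<le> norm (A $ i) * ?col j" for i j
  proof -
    have "norm ((A ** B) $ i $ j) \<le> (\<Sum>k\<in>UNIV. \<bar>norm (A $ i $ k)\<bar> * \<bar>norm (B $ k $ j)\<bar>)"
      unfolding matrix_matrix_mult_def by (simp, rule sum_norm_le) (rule norm_mult_ineq)
    also have "\<dots> \<le> norm (A $ i) * ?col j"
      unfolding norm_vec_def[of "A $ i"] by (rule L2_set_mult_ineq)
    finally show ?thesis .
  qed
  have "norm ((A ** B) $ i) \<le> norm (A $ i) * norm B" for i
  proof -
    have "norm ((A ** B) $ i) \<le> L2_set (\<lambda>j. norm (A $ i) * ?col j) UNIV"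
      unfolding norm_vec_def[of "(A ** B) $ i"] using e by (intro L2_set_mono) auto
    also have "\<dots> = norm (A $ i) * L2_set ?col UNIV"
      by (subst L2_set_right_distrib) auto
    also have "L2_set ?col UNIV = norm B"
      unfolding norm_vec_def[of B] norm_vec_def[of "B $ k" for k] L2_set_def
      by (simp add: sum_nonneg) (subst sum.swap, simp)
    finally show ?thesis .
  qed
  then have "norm (A ** B) \<le> L2_set (\<lambda>i. norm (A $ i) * norm B) UNIV"
    unfolding norm_vec_def[of "A ** B"] by (intro L2_set_mono) auto
  also have "\<dots> = norm A * norm B"
    by (subst L2_set_left_distrib[symmetric]) (auto simp: norm_vec_def)
  finally show ?thesis .
qed

lemma norm_msym_diff_le:
  assumes "a \<in> BM_alg" "b \<in> BM_alg"
  shows "norm (msym b - msym a) \<le> BM_norm (\<lambda>z. b z - a z)"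
proof -
  have "norm (msym b - msym a) \<le> (\<Sum>i\<in>UNIV. \<Sum>j\<in>UNIV. norm ((msym b - msym a) $ i $ j))"
    by (rule norm_matrix_le_sum)
  also have "\<dots> \<le> BM_norm (\<lambda>z. b z - a z)"
    unfolding BM_norm_def
  proof (intro sum_mono norm_le_B_norm)
    fix i j k
    have "(\<lambda>z. a z $ i $ j) \<in> B_alg" "(\<lambda>z. b z $ i $ j) \<in> B_alg" using assms by (auto simp: BM_alg_def)
    then show "fourier (\<lambda>z. (b z - a z) $ i $ j) k = coef ((msym b - msym a) $ i $ j) k"
      using fourier_diff[of "\<lambda>z. b z $ i $ j" "\<lambda>z. a z $ i $ j" k]
      by (simp add: msym_def coef_sym B_alg_def)
  qed
  finally show ?thesis .
qed

subsection \<open>Wiener--Hopf factorization near the identity\<close>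

definition plusM :: "wsym ^ 'n ^ 'n::finite \<Rightarrow> bool" where
  "plusM A \<longleftrightarrow> (\<forall>i j k. k < 0 \<longrightarrow> coef (A $ i $ j) k = 0)"

definition minusM :: "wsym ^ 'n ^ 'n::finite \<Rightarrow> bool" where
  "minusM A \<longleftrightarrow> (\<forall>i j k. k > 0 \<longrightarrow> coef (A $ i $ j) k = 0)"

lift_definition negp :: "wsym \<Rightarrow> wsym" is "\<lambda>f k. if k < 0 then f k else 0"
proof -
  fix f :: "int \<Rightarrow> complex" assume "f \<in> wcoef"
  then obtain M where M: "\<And>F. finite F \<Longrightarrow> wN F f \<le> M" by (auto simp: wcoef_def)
  have "wN F (\<lambda>k. if k < 0 then f k else 0) \<le> wN F f" for F
    unfolding wN_def L2_set_def by (intro add_mono sum_mono real_sqrt_le_mono) auto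
  then show "(\<lambda>k. if k < 0 then f k else 0) \<in> wcoef" using M by (intro wcoefI[of _ M]) (rule order_trans)
qed

lemma coef_negp: "coef (negp f) k = (if k < 0 then coef f k else 0)"
  by (simp add: negp.rep_eq)

text \<open>The norm depends only on the moduli of the coefficients, so deleting some of them is a
  contraction. This is what makes the Wiener-Hopf equation solvable by iteration in this
  algebra.\<close>

lemma norm_negp: "norm (negp f) \<le> norm f"
proof (rule norm_wsym_leI)
  fix F :: "int set" assume F: "finite F"
  have "wN F (coef (negp f)) \<le> wN F (coef f)"
    unfolding wN_def L2_set_def coef_negp by (intro add_mono sum_mono real_sqrt_le_mono) auto
  then show "wN F (coef (negp f)) \<le> norm f" using wN_le_norm[OF F, of f] by linarith
qed

lemma negp_diff: "negp f - negp g = negp (f - g)"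
  by (rule wsym_eqI) (simp add: coef_negp)

definition negM :: "wsym ^ 'n ^ 'n::finite \<Rightarrow> wsym ^ 'n ^ 'n" where
  "negM A = (\<chi> i j. negp (A $ i $ j))"

lemma norm_negM: "norm (negM A) \<le> norm A"
  unfolding norm_vec_def negM_def by (intro L2_set_mono) (auto intro!: L2_set_mono norm_negp)

lemma negM_diff: "negM A - negM B = negM (A - B)"
  by (simp add: negM_def vec_eq_iff negp_diff)

lemma coef_mat1: "coef ((mat 1 :: wsym ^ 'n ^ 'n::finite) $ i $ j) k = (if i = j \<and> k = 0 then 1 else 0)"
  by (simp add: mat_def coef_one)

lemma minusM_one: "minusM (mat 1)"
  by (simp add: minusM_def coef_mat1)

lemma minusM_diff: "minusM A \<Longrightarrow> minusM B \<Longrightarrow> minusM (A - B)"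
  by (simp add: minusM_def)

lemma minusM_mult:
  assumes "minusM A" "minusM B"
  shows "minusM (A ** B)"
  unfolding minusM_def
proof (intro allI impI)
  fix i j and k :: int assume k: "k > 0"
  have "coef (A $ i $ l * B $ l $ j) k = 0" for l
    unfolding coef_mult
  proof (rule infsum_0)
    fix m :: int
    show "coef (A $ i $ l) m * coef (B $ l $ j) (k - m) = 0"
      using assms k by (cases "m > 0") (auto simp: minusM_def)
  qed
  then show "coef ((A ** B) $ i $ j) k = 0" by (simp add: matrix_matrix_mult_def coef_sum)
qed

text \<open>Single coefficients are continuous functionals. Closedness lets a fixed point argument
  run inside the coanalytic matrices.\<close>

lemma closed_minusM: "closed {A :: wsym ^ 'n ^ 'n::finite. minusM A}"
proof -
  have "bounded_linear (\<lambda>f. coef f k)" for k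
    by (rule bounded_linear_intro[of _ 1]) (auto simp: scaleR_conv_of_real coef_le_norm)
  then have "continuous_on UNIV (\<lambda>A :: wsym ^ 'n ^ 'n. coef (A $ i $ j) k)" for i j k
    by (intro bounded_linear.continuous_on[of "\<lambda>f. coef f k"] continuous_intros)
  then show ?thesis
    unfolding minusM_def by (intro closed_Collect_all closed_Collect_imp closed_Collect_eq) auto
qed

text \<open>At each point of the circle this is the fact about one-sided inverses of complex
  matrices.\<close>

lemma matrix_mult_left_right_one:
  fixes A B :: "wsym ^ 'n ^ 'n::finite"
  assumes "A ** B = mat 1"
  shows "B ** A = mat 1"
proof (rule evm_inject)
  fix z :: complex assume z: "cmod z = 1"
  have "evm A z ** evm B z = mat 1" using assms evm_mult[OF z, of A B] by simp
  then show "evm (B ** A) z = evm (mat 1) z"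
    using matrix_left_right_inverse[of "evm A z" "evm B z"] by (simp add: evm_mult z)
qed

lemma matrix_add_distrib: "(A + B) ** C = A ** C + B ** (C :: 'a::semiring_1 ^ 'n ^ 'n::finite)"
  and matrix_distrib_add: "C ** (A + B) = C ** A + C ** (B :: 'a::semiring_1 ^ 'n ^ 'n::finite)"
  by (simp_all add: matrix_matrix_mult_def vec_eq_iff sum.distrib distrib_left distrib_right)

lemma matrix_diff_distrib: "(A - B) ** C = A ** C - B ** (C :: 'a::ring_1 ^ 'n ^ 'n::finite)"
  and matrix_distrib_diff: "C ** (A - B) = C ** A - C ** (B :: 'a::ring_1 ^ 'n ^ 'n::finite)"
  by (simp_all add: matrix_matrix_mult_def vec_eq_iff sum_subtractf left_diff_distrib right_diff_distrib)

text \<open>The inverse is the fixed point of m -> 1 - v m, a contraction with constant 1/2. When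
  \<open>v\<close> is coanalytic the map preserves the closed set of coanalytic matrices, so the
  fixed point lies there. The bound comes from solving |m - 1| <= |v| |1| + |m - 1| / 2.\<close>

lemma neumann:
  fixes v :: "wsym ^ 'n ^ 'n::finite"
  assumes v: "norm v \<le> 1/2"
  obtains m where "(mat 1 + v) ** m = mat 1" "norm (m - mat 1) \<le> 2 * norm (mat 1 :: wsym ^ 'n ^ 'n) * norm v"
    "minusM v \<Longrightarrow> minusM m"
proof -
  define S where "S = (if minusM v then {A :: wsym ^ 'n ^ 'n. minusM A} else UNIV)"
  have "\<exists>!m\<in>S. mat 1 - v ** m = m"
  proof (rule Banach_fix)
    show "complete S" using closed_minusM[where 'n='n] by (simp add: S_def complete_eq_closed)
    show "S \<noteq> {}" using minusM_one by (auto simp: S_def)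
    show "(\<lambda>m. mat 1 - v ** m) ` S \<subseteq> S"
      by (auto simp: S_def intro: minusM_diff minusM_one minusM_mult)
    fix x y :: "wsym ^ 'n ^ 'n"
    have "dist (mat 1 - v ** x) (mat 1 - v ** y) = norm (v ** (y - x))"
      by (simp add: dist_norm matrix_distrib_diff)
    also have "\<dots> \<le> norm v * norm (y - x)" by (rule norm_matrix_mult_le)
    also have "\<dots> \<le> 1/2 * dist x y"
      using mult_right_mono[OF v norm_ge_zero[of "x - y"]] by (simp add: dist_norm norm_minus_commute)
    finally show "dist (mat 1 - v ** x) (mat 1 - v ** y) \<le> 1/2 * dist x y" .
  qed auto
  then obtain m where mS: "m \<in> S" and m: "mat 1 - v ** m = m" by blast
  have 1: "(mat 1 + v) ** m = mat 1"
    using m by (simp add: matrix_add_distrib) (metis diff_add_cancel)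
  have "m - mat 1 = - (v ** (mat 1 + (m - mat 1)))" using m by (simp add: algebra_simps)
  then have "norm (m - mat 1) = norm (v ** (mat 1 + (m - mat 1)))" by (metis norm_minus_cancel)
  also have "\<dots> \<le> norm v * (norm (mat 1 :: wsym ^ 'n ^ 'n) + norm (m - mat 1))"
    by (rule order_trans[OF norm_matrix_mult_le]) (intro mult_left_mono norm_triangle_ineq norm_ge_zero)
  also have "\<dots> \<le> norm v * norm (mat 1 :: wsym ^ 'n ^ 'n) + 1/2 * norm (m - mat 1)"
    using mult_right_mono[OF v norm_ge_zero[of "m - mat 1"]] by (simp add: distrib_left)
  finally have 2: "norm (m - mat 1) \<le> 2 * norm (mat 1 :: wsym ^ 'n ^ 'n) * norm v" by (simp add: mult_ac)
  show ?thesis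
  proof (rule that[OF 1 2])
    assume "minusM v"
    then show "minusM m" using mS by (simp add: S_def)
  qed
qed

text \<open>Seek the inverse of the coanalytic factor as 1 + v, with \<open>v\<close> containing
  strictly negative powers only. With x = c - 1, the product p = c (1 + v) is analytic exactly when
  v is minus the negative part of x (1 + v), and the right side is a contraction in v for small x.
  Then \<open>m\<close> is the inverse of 1 + v.\<close>

lemma wiener_hopf_near_one:
  fixes e :: real
  assumes e: "e > 0"
  obtains d where "d > 0" "\<And>c :: wsym ^ 'n ^ 'n::finite. norm (c - mat 1) < d \<Longrightarrow>
     \<exists>p m. c = p ** m \<and> plusM p \<and> minusM m \<and> norm (p - mat 1) < e \<and> norm (m - mat 1) < e"
proof -
  define \<kappa> where "\<kappa> = 1 + norm (mat 1 :: wsym ^ 'n ^ 'n)"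
  have \<kappa>: "\<kappa> \<ge> 1" "norm (mat 1 :: wsym ^ 'n ^ 'n) \<le> \<kappa>" by (auto simp: \<kappa>_def)
  \<comment> \<open>The first term bounds v by 1/2, as \<open>neumann\<close> requires, and makes
    the map contract. The second leaves room for both factors, whose distance from 1 turns out to be
    at most 4 d \<kappa>^2.\<close>
  define d where "d = min (1 / (4 * \<kappa>)) (e / (8 * \<kappa> * \<kappa>))"
  have d0: "d > 0" using e \<kappa> by (simp add: d_def)
  have d1: "d * \<kappa> \<le> 1/4"
  proof -
    have "d * \<kappa> \<le> 1 / (4 * \<kappa>) * \<kappa>" using \<kappa> by (intro mult_right_mono) (auto simp: d_def)
    then show ?thesis using \<kappa> by simp
  qed
  have d2: "d * \<kappa> * \<kappa> \<le> e / 8"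
  proof -
    have "d * (\<kappa> * \<kappa>) \<le> e / (8 * \<kappa> * \<kappa>) * (\<kappa> * \<kappa>)" using \<kappa> by (intro mult_right_mono) (auto simp: d_def)
    then show ?thesis using \<kappa> by (simp add: field_simps)
  qed
  have d3: "d \<le> 1/4"
  proof -
    have "d * 1 \<le> d * \<kappa>" using d0 \<kappa> by (intro mult_left_mono) auto
    then show ?thesis using d1 by linarith
  qed
  have "\<exists>p m. c = p ** m \<and> plusM p \<and> minusM m \<and> norm (p - mat 1) < e \<and> norm (m - mat 1) < e"
    if c: "norm (c - mat 1) < d" for c :: "wsym ^ 'n ^ 'n"
  proof -
    define x where "x = c - mat 1"
    have xd: "norm x \<le> d" using c by (simp add: x_def)
    have "\<exists>!v. - negM (x ** (mat 1 + v)) = v"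
    proof (rule banach_fix_type)
      show "\<forall>v w. dist (- negM (x ** (mat 1 + v))) (- negM (x ** (mat 1 + w))) \<le> 1/2 * dist v w"
      proof (intro allI)
        fix v w
        have "dist (- negM (x ** (mat 1 + v))) (- negM (x ** (mat 1 + w))) =
           norm (negM (x ** (mat 1 + w) - x ** (mat 1 + v)))"
          by (simp add: dist_norm flip: negM_diff)
        also have "\<dots> \<le> norm (x ** (w - v))"
          by (rule order_trans[OF norm_negM]) (simp add: matrix_distrib_add matrix_distrib_diff)
        also have "\<dots> \<le> norm x * norm (w - v)" by (rule norm_matrix_mult_le)
        also have "\<dots> \<le> 1/2 * dist v w"
          using mult_right_mono[of "norm x" "1/2" "norm (v - w)"] xd d3
          by (simp add: dist_norm norm_minus_commute)
        finally show "dist (- negM (x ** (mat 1 + v))) (- negM (x ** (mat 1 + w))) \<le> 1/2 * dist v w" .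
      qed
    qed auto
    then obtain v where v: "- negM (x ** (mat 1 + v)) = v" by blast
    have "norm v \<le> norm (x ** (mat 1 + v))" using v norm_negM by (metis norm_minus_cancel)
    also have "\<dots> \<le> norm x * (norm (mat 1 :: wsym ^ 'n ^ 'n) + norm v)"
      by (rule order_trans[OF norm_matrix_mult_le]) (intro mult_left_mono norm_triangle_ineq norm_ge_zero)
    also have "\<dots> \<le> d * (\<kappa> + norm v)"
      using xd \<kappa> d0 by (intro mult_mono) auto
    also have "\<dots> \<le> d * \<kappa> + 1/2 * norm v"
      using mult_right_mono[of d "1/2" "norm v"] d3 by (simp add: distrib_left)
    finally have v1: "norm v \<le> 2 * (d * \<kappa>)" by simp
    then have v2: "norm v \<le> 1/2" using d1 by simp
    have cv: "coef (v $ i $ j) k = (if k < 0 then - coef ((x ** (mat 1 + v)) $ i $ j) k else 0)" for i j k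
      using arg_cong[OF v, of "\<lambda>v. coef (v $ i $ j) k"] by (auto simp: negM_def coef_negp)
    have vm: "minusM v" by (simp add: minusM_def cv)
    obtain m where m: "(mat 1 + v) ** m = mat 1"
        "norm (m - mat 1) \<le> 2 * norm (mat 1 :: wsym ^ 'n ^ 'n) * norm v" "minusM m"
      using neumann[OF v2] vm by metis
    define p where "p = c ** (mat 1 + v)"
    have pm: "c = p ** m" by (simp add: p_def m(1) flip: matrix_mul_assoc)
    have p_eq: "p = mat 1 + (v + x ** (mat 1 + v))"
      by (simp add: p_def x_def matrix_add_distrib matrix_diff_distrib)
    have "plusM p"
      by (simp add: plusM_def p_eq coef_mat1 cv)
    moreover have "norm (p - mat 1) < e"
    proof -
      have "norm (p - mat 1) \<le> norm v + norm (x ** (mat 1 + v))" by (simp add: p_eq norm_triangle_ineq)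
      also have "norm (x ** (mat 1 + v)) \<le> norm x * (norm (mat 1 :: wsym ^ 'n ^ 'n) + norm v)"
        by (rule order_trans[OF norm_matrix_mult_le]) (intro mult_left_mono norm_triangle_ineq norm_ge_zero)
      also have "\<dots> \<le> d * (\<kappa> + \<kappa>)"
        using xd \<kappa> v2 d0 by (intro mult_mono add_mono) auto
      finally have "norm (p - mat 1) \<le> 4 * (d * \<kappa>)" using v1 by simp
      also have "\<dots> \<le> 4 * (d * \<kappa> * \<kappa>)"
        using mult_left_mono[of 1 \<kappa> "d * \<kappa>"] d0 \<kappa> by simp
      also have "\<dots> < e" using d2 e by simp
      finally show ?thesis .
    qed
    moreover have "norm (m - mat 1) < e"
    proof -
      have "norm (m - mat 1) \<le> 2 * \<kappa> * (2 * (d * \<kappa>))"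
        using \<kappa> v1 by (intro order_trans[OF m(2)] mult_mono) auto
      also have "\<dots> = 4 * (d * \<kappa> * \<kappa>)" by simp
      also have "\<dots> < e" using d2 e by simp
      finally show ?thesis .
    qed
    ultimately show ?thesis using pm m(3) by blast
  qed
  then show ?thesis using that d0 by blast
qed

subsection \<open>Mean values of logarithms\<close>

definition pser :: "(nat \<Rightarrow> complex) \<Rightarrow> complex \<Rightarrow> complex" where
  "pser u z = (\<Sum>\<^sub>\<infinity>n. u n * z ^ n)"

lemma pser_0: "pser u 0 = u 0"
proof -
  have "pser u 0 = (\<Sum>\<^sub>\<infinity>n\<in>{0}. u n * 0 ^ n)"
    unfolding pser_def by (rule infsum_cong_neutral) auto
  then show ?thesis by simp
qed

lemma
  assumes u: "(\<lambda>n. cmod (u n)) summable_on UNIV"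
  shows pser_continuous: "continuous_on (cball 0 1) (pser u)"
    and pser_holomorphic: "pser u holomorphic_on ball 0 1"
proof -
  have "uniform_limit (cball 0 1) (\<lambda>F z. \<Sum>n\<in>F. u n * z ^ n) (pser u) (finite_subsets_at_top UNIV)"
    unfolding pser_def
  proof (rule Weierstrass_m_test_general[OF _ u])
    fix n :: nat and z :: complex assume "z \<in> cball 0 1"
    then show "cmod (u n * z ^ n) \<le> cmod (u n)"
      by (simp add: norm_mult norm_power mult_left_le power_le_one)
  qed
  then obtain "continuous_on (cball 0 1) (pser u)" "pser u holomorphic_on ball 0 1"
    by (rule holomorphic_uniform_limit[rotated])
      (auto intro!: continuous_intros holomorphic_intros always_eventually)
  then show "continuous_on (cball 0 1) (pser u)" "pser u holomorphic_on ball 0 1" by auto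
qed

lemma cmod_pser_le:
  assumes u: "(\<lambda>n. cmod (u n)) summable_on UNIV" and z: "cmod z \<le> 1"
  shows "cmod (pser u z) \<le> (\<Sum>\<^sub>\<infinity>n. cmod (u n))"
proof -
  have le: "cmod (u n * z ^ n) \<le> cmod (u n)" for n
    using z by (simp add: norm_mult norm_power mult_left_le power_le_one)
  have s: "(\<lambda>n. cmod (u n * z ^ n)) summable_on UNIV"
    by (rule summable_on_comparison_test[OF u]) (use le in auto)
  have "cmod (pser u z) \<le> (\<Sum>\<^sub>\<infinity>n. cmod (u n * z ^ n))" unfolding pser_def by (rule norm_infsum_bound[OF s])
  also have "\<dots> \<le> (\<Sum>\<^sub>\<infinity>n. cmod (u n))" by (rule infsum_mono[OF s u le])
  finally show ?thesis .
qed

text \<open>The sign \<epsilon> treats analytic and coanalytic symbols at once: the former are power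
  series in z, the latter in 1/z.\<close>

lemma
  fixes f :: wsym and \<epsilon> :: int
  assumes \<epsilon>: "\<epsilon> = 1 \<or> \<epsilon> = -1"
  shows half_summable: "(\<lambda>n. cmod (coef f (\<epsilon> * int n))) summable_on UNIV"
    and half_infsum_le: "(\<Sum>\<^sub>\<infinity>n. cmod (coef f (\<epsilon> * int n))) \<le> norm f"
    and half_pser: "(\<And>k. \<epsilon> * k < 0 \<Longrightarrow> coef f k = 0) \<Longrightarrow> cmod z = 1 \<Longrightarrow>
        ev f z = pser (\<lambda>n. coef f (\<epsilon> * int n)) (z powi \<epsilon>)"
proof -
  have inj: "inj (\<lambda>n. \<epsilon> * int n)" using \<epsilon> by (auto simp: inj_on_def)
  let ?R = "range (\<lambda>n. \<epsilon> * int n)"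
  have sR: "(\<lambda>k. cmod (coef f k)) summable_on ?R"
    by (rule summable_on_subset_banach[OF coef_summable]) simp
  then show "(\<lambda>n. cmod (coef f (\<epsilon> * int n))) summable_on UNIV"
    by (subst (asm) summable_on_reindex[OF inj]) (simp add: o_def)
  have "(\<Sum>\<^sub>\<infinity>n. cmod (coef f (\<epsilon> * int n))) = (\<Sum>\<^sub>\<infinity>k\<in>?R. cmod (coef f k))"
    by (subst infsum_reindex[OF inj]) (simp add: o_def)
  also have "\<dots> \<le> (\<Sum>\<^sub>\<infinity>k. cmod (coef f k))"
    by (rule infsum_mono2[OF sR coef_summable]) auto
  also have "\<dots> \<le> norm f" by (rule infsum_coef_le_norm)
  finally show "(\<Sum>\<^sub>\<infinity>n. cmod (coef f (\<epsilon> * int n))) \<le> norm f" .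
  assume zero: "\<And>k. \<epsilon> * k < 0 \<Longrightarrow> coef f k = 0" and z: "cmod z = 1"
  have z0: "z \<noteq> 0" using z by auto
  have "k \<in> ?R" if "\<not> \<epsilon> * k < 0" for k
  proof -
    have "k = \<epsilon> * int (nat (\<epsilon> * k))" using that \<epsilon> by auto
    then show ?thesis by blast
  qed
  then have "ev f z = (\<Sum>\<^sub>\<infinity>k\<in>?R. coef f k * z powi k)"
    unfolding ev_def using zero by (intro infsum_cong_neutral) auto
  also have "\<dots> = (\<Sum>\<^sub>\<infinity>n. coef f (\<epsilon> * int n) * z powi (\<epsilon> * int n))"
    by (subst infsum_reindex[OF inj]) (simp add: o_def)
  also have "\<dots> = pser (\<lambda>n. coef f (\<epsilon> * int n)) (z powi \<epsilon>)"
    unfolding pser_def by (simp add: power_int_mult)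
  finally show "ev f z = pser (\<lambda>n. coef f (\<epsilon> * int n)) (z powi \<epsilon>)" .
qed

text \<open>Cauchy's formula at the centre of the disc; the case of 1/z follows by the reflection x
  -> 2 pi - x of the interval.\<close>

lemma mean_value:
  fixes h :: "complex \<Rightarrow> complex"
  assumes c: "continuous_on (cball 0 1) h" and h: "h holomorphic_on ball 0 1" and \<epsilon>: "\<epsilon> = 1 \<or> \<epsilon> = (-1::int)"
  shows "((\<lambda>x. h (cis x powi \<epsilon>)) has_integral (2 * pi * h 0)) {0..2*pi}"
proof -
  have "((\<lambda>u. h u / (u - 0)) has_contour_integral (2 * of_real pi * \<i> * h 0)) (circlepath 0 1)"
    using c h by (intro Cauchy_integral_circlepath) auto
  then have "((\<lambda>t. h (0 + of_real 1 * cis t) / (0 + of_real 1 * cis t - 0) * of_real 1 * \<i> * cis t) has_integral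
      (2 * of_real pi * \<i> * h 0)) {0..2*pi}"
    unfolding circlepath_def by (subst (asm) has_contour_integral_part_circlepath_iff) auto
  then have "((\<lambda>t. \<i> * h (cis t)) has_integral (\<i> * (2 * pi * h 0))) {0..2*pi}"
    by (simp add: mult_ac)
  from has_integral_mult_right[OF this, of "- \<i>"]
  have "((\<lambda>t. (- \<i> * \<i>) * h (cis t)) has_integral ((- \<i> * \<i>) * (2 * pi * h 0))) {0..2*pi}"
    by (simp only: mult.assoc)
  then have 1: "((\<lambda>t. h (cis t)) has_integral (2 * pi * h 0)) {0..2*pi}" by simp
  have "((\<lambda>t. h (cis ((-1) *\<^sub>R t + 2 * pi))) has_integral ((1 / \<bar>- 1\<bar> ^ DIM(real)) *\<^sub>R (2 * pi * h 0)))
     ((\<lambda>x. (1 / -1) *\<^sub>R x + - ((1 / -1) *\<^sub>R (2 * pi))) ` cbox 0 (2*pi))"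
    by (rule has_integral_affinity) (use 1 in auto)
  moreover have "(\<lambda>x. (1 / -1) *\<^sub>R x + - ((1 / -1) *\<^sub>R (2 * pi))) ` cbox 0 (2*pi) = {0..2*pi}"
  proof -
    have "x \<in> (\<lambda>x. 2 * pi - x) ` {0..2*pi}" if "x \<in> {0..2*pi}" for x
      using that by (intro image_eqI[of _ _ "2 * pi - x"]) auto
    then show ?thesis by auto
  qed
  moreover have "cis ((-1) *\<^sub>R t + 2 * pi) = cis t powi (-1)" for t
    by (simp add: cis_powi complex_eq_iff)
  ultimately have 2: "((\<lambda>t. h (cis t powi (-1))) has_integral (2 * pi * h 0)) {0..2*pi}" by simp
  show ?thesis using 1 2 \<epsilon> by auto
qed

definition mean :: "(complex \<Rightarrow> complex) \<Rightarrow> complex" where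
  "mean g = (LINT x:{0..2*pi}|lebesgue. g (cis x)) / (2 * pi)"

lemma mean_integral:
  assumes "continuous_on (sphere 0 1) g"
  shows "mean g = integral {0..2*pi} (\<lambda>x. g (cis x)) / (2 * pi)"
  using set_integrable_circle[OF assms] by (simp add: mean_def set_lebesgue_integral_eq_integral)

lemma mean_add:
  assumes "continuous_on (sphere 0 1) f" "continuous_on (sphere 0 1) g"
  shows "mean (\<lambda>z. f z + g z) = mean f + mean g"
  using set_integral_add(2)[OF assms[THEN set_integrable_circle]]
  by (simp add: mean_def add_divide_distrib)

lemma mean_uminus: "mean (\<lambda>z. - f z) = - mean f"
  by (simp add: mean_def set_lebesgue_integral_def)

lemma mean_const: "mean (\<lambda>z. c) = c"
  by (simp add: mean_integral scaleR_conv_of_real)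

text \<open>Ranges over all complex matrices entrywise as close to 1 as \<open>b\<close> is, not
  only over the values of \<open>b\<close> on the circle: the same condition must cover the values
  of the analytic extension inside the disc. The bound 1/2 keeps the determinant well inside the
  domain of the principal logarithm.\<close>

definition near1 :: "wsym ^ 'n ^ 'n::finite \<Rightarrow> bool" where
  "near1 b \<longleftrightarrow> (\<forall>M :: complex ^ 'n ^ 'n. (\<forall>i j. cmod (M $ i $ j - mat 1 $ i $ j) \<le> norm (b - mat 1)) \<longrightarrow>
     cmod (det M - 1) < 1/2)"

lemma near1_radius:
  obtains \<eta> where "\<eta> > 0" "\<And>b :: wsym ^ 'n ^ 'n::finite. norm (b - mat 1) < \<eta> \<Longrightarrow> near1 b"
proof -
  have "continuous_on UNIV (\<lambda>M :: complex ^ 'n ^ 'n. det M)" by (intro continuous_on_det continuous_intros)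
  then have "isCont (\<lambda>M :: complex ^ 'n ^ 'n. det M) (mat 1)" by (simp add: continuous_on_eq_continuous_at)
  then obtain d where d: "d > 0"
      "\<And>M :: complex ^ 'n ^ 'n. norm (M - mat 1) < d \<Longrightarrow> cmod (det M - 1) < 1/2"
    unfolding continuous_at_eps_delta by (metis det_I dist_norm half_gt_zero zero_less_one)
  define C where "C = (\<Sum>i\<in>(UNIV::'n set). \<Sum>j\<in>(UNIV::'n set). 1 :: real)"
  have C: "C > 0" by (simp add: C_def)
  have "near1 b" if b: "norm (b - mat 1) < d / C" for b :: "wsym ^ 'n ^ 'n"
    unfolding near1_def
  proof (intro allI impI d(2))
    fix M :: "complex ^ 'n ^ 'n"
    assume M: "\<forall>i j. cmod (M $ i $ j - mat 1 $ i $ j) \<le> norm (b - mat 1)"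
    have "norm (M - mat 1) \<le> (\<Sum>i\<in>(UNIV::'n set). \<Sum>j\<in>(UNIV::'n set). cmod ((M - mat 1) $ i $ j))"
      by (rule norm_matrix_le_sum)
    also have "\<dots> \<le> (\<Sum>i\<in>(UNIV::'n set). \<Sum>j\<in>(UNIV::'n set). norm (b - mat 1))"
      using M by (intro sum_mono) auto
    also have "\<dots> = C * norm (b - mat 1)" by (simp add: C_def)
    also have "\<dots> < d" using b C by (simp add: field_simps)
    finally show "norm (M - mat 1) < d" .
  qed
  then show ?thesis using that[of "d / C"] d C by simp
qed

lemma near1_det: "near1 b \<Longrightarrow> cmod z = 1 \<Longrightarrow> cmod (det (evm b z) - 1) < 1/2"
proof -
  assume n: "near1 b" and z: "cmod z = 1"
  have "cmod (evm b z $ i $ j - mat 1 $ i $ j) \<le> norm (b - mat 1)" for i j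
  proof -
    have "evm b z $ i $ j - mat 1 $ i $ j = evm (b - mat 1) z $ i $ j" by (simp add: evm_diff z)
    then show ?thesis using cmod_evm_le[OF z, of "b - mat 1" i j] norm_entry_le[of "b - mat 1" i j] by simp
  qed
  then show ?thesis using n by (simp add: near1_def)
qed

lemma not_nonpos_near1: "cmod (w - 1) < 1 \<Longrightarrow> w \<notin> \<real>\<^sub>\<le>\<^sub>0"
proof
  assume "cmod (w - 1) < 1" "w \<in> \<real>\<^sub>\<le>\<^sub>0"
  then obtain s where s: "w = of_real s" "s \<le> 0" by (auto elim: nonpos_Reals_cases)
  have "cmod (w - 1) = \<bar>s - 1\<bar>" unfolding s(1) by (metis norm_of_real of_real_1 of_real_diff)
  then show False using \<open>cmod (w - 1) < 1\<close> s(2) by simp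
qed

lemma continuous_on_Ln_det:
  assumes "\<And>z. cmod z = 1 \<Longrightarrow> cmod (det (evm b z) - 1) < 1/2"
  shows "continuous_on (sphere 0 1) (\<lambda>z. Ln (det (evm b z)))"
proof (intro continuous_on_Ln' continuous_on_det continuous_on_evm)
  fix z :: complex assume "z \<in> sphere 0 1"
  then have "cmod (det (evm b z) - 1) < 1" using assms[of z] by simp
  then show "det (evm b z) \<notin> \<real>\<^sub>\<le>\<^sub>0" by (rule not_nonpos_near1)
qed

lemma near1_ne0: "cmod (w - 1) < 1/2 \<Longrightarrow> w \<noteq> 0"
  by auto

text \<open>The diagonal block of the Toeplitz matrix of \<open>b\<close>; for an analytic or
  coanalytic \<open>b\<close> also the value of its extension at the centre of the disc.\<close>

definition const_block :: "wsym ^ 'n ^ 'n::finite \<Rightarrow> complex ^ 'n ^ 'n" where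
  "const_block b = (\<chi> i j. coef (b $ i $ j) 0)"

definition triangular1 :: "wsym ^ 'n ^ 'n::finite \<Rightarrow> bool" where
  "triangular1 b \<longleftrightarrow> (plusM b \<or> minusM b) \<and> near1 b"

text \<open>The logarithm of the determinant extends analytically to the unit disc, in \<open>z\<close> or
  in \<open>1/z\<close>.\<close>

lemma triangular1_mean:
  assumes "triangular1 b"
  shows "exp (mean (\<lambda>z. Ln (det (evm b z)))) = det (const_block b)" and "det (const_block b) \<noteq> 0"
proof -
  have n: "near1 b" and pm: "plusM b \<or> minusM b" using assms by (auto simp: triangular1_def)
  define \<epsilon> :: int where "\<epsilon> = (if plusM b then 1 else -1)"
  have \<epsilon>: "\<epsilon> = 1 \<or> \<epsilon> = -1" by (simp add: \<epsilon>_def)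
  define u where "u i j n = coef (b $ i $ j) (\<epsilon> * int n)" for i j n
  define M where "M z = (\<chi> i j. pser (u i j) z)" for z
  have us: "(\<lambda>n. cmod (u i j n)) summable_on UNIV" for i j
    unfolding u_def by (rule half_summable[OF \<epsilon>])
  have Mc: "continuous_on (cball 0 1) M"
    unfolding M_def by (intro continuous_intros pser_continuous us)
  have M0: "M 0 = const_block b" by (simp add: M_def const_block_def pser_0 u_def)
  have zero: "coef (b $ i $ j) k = 0" if "\<epsilon> * k < 0" for i j k
  proof (cases "plusM b")
    case True
    then have "k < 0" using that by (simp add: \<epsilon>_def)
    then show ?thesis using True by (simp add: plusM_def)
  next
    case False
    then have "k > 0" "minusM b" using that pm by (auto simp: \<epsilon>_def)
    then show ?thesis by (simp add: minusM_def)
  qed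
  have Mev: "evm b z = M (z powi \<epsilon>)" if "cmod z = 1" for z
    unfolding evm_def M_def u_def using half_pser[OF \<epsilon> zero that] by (simp add: vec_eq_iff)
  have near: "cmod (det (M z) - 1) < 1/2" if z: "cmod z \<le> 1" for z
  proof -
    have "cmod (M z $ i $ j - mat 1 $ i $ j) \<le> norm (b - mat 1)" for i j
    proof -
      define w where "w = (b - mat 1) $ i $ j"
      have ws: "(\<lambda>n. cmod (coef w (\<epsilon> * int n))) summable_on UNIV" by (rule half_summable[OF \<epsilon>])
      have s1: "(\<lambda>n. coef w (\<epsilon> * int n) * z ^ n) summable_on UNIV"
      proof (rule abs_summable_summable, rule summable_on_comparison_test[OF ws])
        show "cmod (coef w (\<epsilon> * int n) * z ^ n) \<le> cmod (coef w (\<epsilon> * int n))" for n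
          using z by (simp add: norm_mult norm_power mult_left_le power_le_one)
      qed auto
      have cw: "u i j n = coef w (\<epsilon> * int n) + (if n = 0 then mat 1 $ i $ j else 0)" for n
        using \<epsilon> by (auto simp: w_def u_def mat_def coef_one)
      have s2: "((\<lambda>n. (if n = 0 then e else 0) * z ^ n) has_sum e) UNIV" for e :: complex
      proof -
        have "((\<lambda>n. (if n = 0 then e else 0) * z ^ n) has_sum e) {0}"
          using has_sum_finite[of "{0::nat}" "\<lambda>n. (if n = 0 then e else 0) * z ^ n"] by simp
        then show ?thesis by (rule has_sum_cong_neutral[THEN iffD1, rotated -1]) auto
      qed
      have "pser (u i j) z = pser (\<lambda>n. coef w (\<epsilon> * int n)) z + mat 1 $ i $ j"
        unfolding pser_def cw distrib_right
        using infsum_add[OF s1 has_sum_imp_summable[OF s2]] infsumI[OF s2] by simp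
      then have "M z $ i $ j - mat 1 $ i $ j = pser (\<lambda>n. coef w (\<epsilon> * int n)) z" by (simp add: M_def)
      then have "cmod (M z $ i $ j - mat 1 $ i $ j) \<le> norm w"
        using cmod_pser_le[OF ws z] half_infsum_le[OF \<epsilon>, of w] by simp
      then show ?thesis using norm_entry_le[of "b - mat 1" i j] by (simp add: w_def)
    qed
    then show ?thesis using n by (simp add: near1_def)
  qed
  have nonpos: "det (M z) \<notin> \<real>\<^sub>\<le>\<^sub>0" if "cmod z \<le> 1" for z
    using near[OF that] by (intro not_nonpos_near1) simp
  define h where "h z = Ln (det (M z))" for z
  have hc: "continuous_on (cball 0 1) h"
    unfolding h_def using nonpos by (intro continuous_on_Ln' continuous_on_det Mc) auto
  have hh: "h holomorphic_on ball 0 1"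
    unfolding h_def
  proof (rule holomorphic_on_Ln')
    show "(\<lambda>z. det (M z)) holomorphic_on ball 0 1"
      unfolding det_def M_def by (auto intro!: holomorphic_intros pser_holomorphic us)
  qed (use nonpos in auto)
  have "((\<lambda>x. h (cis x powi \<epsilon>)) has_integral (2 * pi * h 0)) {0..2*pi}"
    by (rule mean_value[OF hc hh \<epsilon>])
  moreover have "h (cis x powi \<epsilon>) = Ln (det (evm b (cis x)))" for x by (simp add: h_def Mev)
  ultimately have "integral {0..2*pi} (\<lambda>x. Ln (det (evm b (cis x)))) = 2 * pi * h 0"
    by (simp add: integral_unique)
  then have "mean (\<lambda>z. Ln (det (evm b z))) = h 0"
    using continuous_on_Ln_det[of b] near1_det[OF n] by (simp add: mean_integral)
  moreover show "det (const_block b) \<noteq> 0" using near[of 0] M0 by (intro near1_ne0) simp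
  ultimately show "exp (mean (\<lambda>z. Ln (det (evm b z)))) = det (const_block b)"
    by (simp add: h_def M0)
qed

text \<open>Another continuous logarithm has, by continuity, the same exponential everywhere on the
  circle. The difference divided by 2 pi i is a continuous integer-valued function on a connected
  set, hence constant, and the exponential of the mean does not see it.\<close>

lemma G_const_eqI:
  assumes a: "a \<in> BM_alg" and b: "continuous_on (sphere 0 1) b"
    and eb: "\<And>z. cmod z = 1 \<Longrightarrow> exp (b z) = det (evm (msym a) z)"
  shows "G_const a = exp (mean b)"
  unfolding G_const_def
proof (rule the_equality)
  have ae: "AE x\<in>{0..2*pi} in lebesgue. exp (b (cis x)) = det (a (cis x))"
    using msym_AE_eq[OF a] by eventually_elim (simp add: eb)
  then show "\<exists>b'. continuous_on (sphere 0 1) b' \<and>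
     (AE x\<in>{0..2*pi} in lebesgue. exp (b' (cis x)) = det (a (cis x))) \<and>
     exp (mean b) = exp ((LINT x:{0..2*pi}|lebesgue. b' (cis x)) / (2 * pi))"
    using b by (intro exI[of _ b]) (simp add: mean_def)
  fix g
  assume "\<exists>b. continuous_on (sphere 0 1) b \<and>
     (AE x\<in>{0..2*pi} in lebesgue. exp (b (cis x)) = det (a (cis x))) \<and>
     g = exp ((LINT x:{0..2*pi}|lebesgue. b (cis x)) / (2 * pi))"
  then obtain b' where b': "continuous_on (sphere 0 1) b'"
     "AE x\<in>{0..2*pi} in lebesgue. exp (b' (cis x)) = det (a (cis x))" "g = exp (mean b')"
    by (auto simp: mean_def)
  define \<delta> where "\<delta> z = (b' z - b z) / (2 * pi * \<i>)" for z
  have ex: "exp (b' z) = exp (b z)" if z: "cmod z = 1" for z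
  proof (rule AE_circle_imp_eq[of "\<lambda>z. exp (b' z)" "\<lambda>z. exp (b z)", OF _ _ _ z])
    show "AE x\<in>{0..2*pi} in lebesgue. exp (b' (cis x)) = exp (b (cis x))"
      using ae b'(2) by eventually_elim auto
  qed (intro continuous_intros b b')+
  have int: "\<exists>n::int. \<delta> z = of_int n" if z: "cmod z = 1" for z
  proof -
    obtain n where "b' z = b z + (of_int (2 * n) * pi) * \<i>" using ex[OF z] exp_eq by blast
    then show ?thesis by (intro exI[of _ n]) (simp add: \<delta>_def)
  qed
  have "\<delta> constant_on sphere 0 1"
  proof (rule continuous_discrete_range_constant)
    show "connected (sphere (0::complex) 1)" by (rule connected_sphere) simp
    show "continuous_on (sphere 0 1) \<delta>" unfolding \<delta>_def by (intro continuous_intros b b') auto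
    fix x :: complex assume x: "x \<in> sphere 0 1"
    show "\<exists>e>0. \<forall>y. y \<in> sphere 0 1 \<and> \<delta> y \<noteq> \<delta> x \<longrightarrow> e \<le> cmod (\<delta> y - \<delta> x)"
    proof (intro exI[of _ 1] conjI allI impI)
      fix y assume y: "y \<in> sphere 0 1 \<and> \<delta> y \<noteq> \<delta> x"
      obtain m n :: int where "\<delta> x = of_int m" "\<delta> y = of_int n" using int x y by fastforce
      then have "m \<noteq> n" "cmod (\<delta> y - \<delta> x) = \<bar>real_of_int (n - m)\<bar>"
        using y by (auto simp flip: of_int_diff simp del: of_int_diff)
      then show "1 \<le> cmod (\<delta> y - \<delta> x)" by linarith
    qed simp
  qed
  then obtain c where c: "\<And>z. cmod z = 1 \<Longrightarrow> \<delta> z = c" by (auto simp: constant_on_def)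
  obtain n :: int where n: "c = of_int n" using int[of 1] c[of 1] by auto
  have b'eq: "b' z = b z + 2 * pi * \<i> * of_int n" if "cmod z = 1" for z
    using c[OF that] n by (simp add: \<delta>_def field_simps)
  have "mean b' = mean (\<lambda>z. b z + 2 * pi * \<i> * of_int n)"
    unfolding mean_def by (simp add: b'eq)
  also have "\<dots> = mean b + 2 * pi * \<i> * of_int n" by (subst mean_add) (auto simp: b mean_const)
  finally show "g = exp (mean b)" using b'(3) exp_eq[of "mean b'" "mean b"] by (auto simp: mult_ac intro!: exI[of _ n])
qed

section \<open>Products of triangular factors and their logarithms\<close>

definition lprod :: "(wsym ^ 'n ^ 'n::finite) list \<Rightarrow> wsym ^ 'n ^ 'n" where
  "lprod bs = foldr (**) bs (mat 1)"

lemma lprod_simps [simp]: "lprod [] = mat 1" "lprod (b # bs) = b ** lprod bs"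
  by (simp_all add: lprod_def)

lemma lprod_log:
  assumes "\<forall>b\<in>set bs. triangular1 b"
  shows "\<exists>l. continuous_on (sphere 0 1) l \<and> (\<forall>z. cmod z = 1 \<longrightarrow> exp (l z) = det (evm (lprod bs) z)) \<and>
    exp (mean l) = prod_list (map (\<lambda>b. det (const_block b)) bs)"
  using assms
proof (induction bs)
  case Nil
  then show ?case by (intro exI[of _ "\<lambda>_. 0"]) (simp add: mean_const)
next
  case (Cons b bs)
  then obtain l where l: "continuous_on (sphere 0 1) l" "\<And>z. cmod z = 1 \<Longrightarrow> exp (l z) = det (evm (lprod bs) z)"
    "exp (mean l) = prod_list (map (\<lambda>b. det (const_block b)) bs)" by auto
  have t: "triangular1 b" using Cons by simp
  then have n: "cmod (det (evm b z) - 1) < 1/2" if "cmod z = 1" for z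
    using near1_det that by (auto simp: triangular1_def)
  have c: "continuous_on (sphere 0 1) (\<lambda>z. Ln (det (evm b z)))" by (rule continuous_on_Ln_det[OF n])
  show ?case
  proof (intro exI[of _ "\<lambda>z. Ln (det (evm b z)) + l z"] conjI allI impI)
    show "continuous_on (sphere 0 1) (\<lambda>z. Ln (det (evm b z)) + l z)" by (intro continuous_intros c l)
    show "exp (mean (\<lambda>z. Ln (det (evm b z)) + l z)) = prod_list (map (\<lambda>b. det (const_block b)) (b # bs))"
      by (simp add: mean_add[OF c l(1)] exp_add triangular1_mean[OF t] l(3))
    fix z :: complex assume z: "cmod z = 1"
    then show "exp (Ln (det (evm b z)) + l z) = det (evm (lprod (b # bs)) z)"
      using near1_ne0[OF n[OF z]] by (simp add: exp_add l(2) evm_mult det_mul)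
  qed
qed

text \<open>The list factorizes the inverse of \<open>S\<close>, so that multiplying the Toeplitz
  matrix of \<open>S\<close> from the right by those of the factors leads to the identity up to
  corrections.\<close>

definition factors :: "wsym ^ 'n ^ 'n::finite \<Rightarrow> (wsym ^ 'n ^ 'n) list \<Rightarrow> bool" where
  "factors S bs \<longleftrightarrow> (\<forall>b\<in>set bs. triangular1 b) \<and> S ** lprod bs = mat 1"

lemma factors_log:
  assumes "factors S bs"
  shows "\<exists>l. continuous_on (sphere 0 1) l \<and> (\<forall>z. cmod z = 1 \<longrightarrow> exp (l z) = det (evm S z)) \<and>
    exp (mean l) * prod_list (map (\<lambda>b. det (const_block b)) bs) = 1"
proof -
  obtain l where l: "continuous_on (sphere 0 1) l" "\<And>z. cmod z = 1 \<Longrightarrow> exp (l z) = det (evm (lprod bs) z)"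
    "exp (mean l) = prod_list (map (\<lambda>b. det (const_block b)) bs)"
    using lprod_log assms unfolding factors_def by blast
  show ?thesis
  proof (intro exI[of _ "\<lambda>z. - l z"] conjI allI impI)
    show "continuous_on (sphere 0 1) (\<lambda>z. - l z)" by (intro continuous_intros l)
    show "exp (mean (\<lambda>z. - l z)) * prod_list (map (\<lambda>b. det (const_block b)) bs) = 1"
      by (simp add: mean_uminus exp_minus flip: l(3))
    fix z :: complex assume z: "cmod z = 1"
    have "evm S z ** evm (lprod bs) z = mat 1"
      using assms evm_mult[OF z, of S "lprod bs"] by (simp add: factors_def)
    then have "det (evm S z) * det (evm (lprod bs) z) = 1" by (metis det_I det_mul)
    then have "det (evm S z) * exp (l z) = 1" by (simp add: l(2) z)
    then show "exp (- l z) = det (evm S z)" by (simp add: exp_minus field_simps)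
  qed
qed

lemma factors_G_const:
  assumes "factors (msym a) bs" "a \<in> BM_alg"
  shows "G_const a * prod_list (map (\<lambda>b. det (const_block b)) bs) = 1"
proof -
  obtain l where l: "continuous_on (sphere 0 1) l" "\<And>z. cmod z = 1 \<Longrightarrow> exp (l z) = det (evm (msym a) z)"
    "exp (mean l) * prod_list (map (\<lambda>b. det (const_block b)) bs) = 1"
    using factors_log[OF assms(1)] by blast
  then show ?thesis using G_const_eqI[OF assms(2) l(1,2)] by simp
qed

text \<open>The definition by description shows no dependence on the symbol, so a formula is needed
  near a fixed \<open>a0\<close>: the quotient \<open>R ** msym a\<close> has determinant close to
  1, and its principal logarithm is added to a fixed logarithm of det a0.\<close>

lemma G_const_perturb:
  assumes a0: "a0 \<in> BM_alg" "factors (msym a0) bs" and a: "a \<in> BM_alg"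
    and R: "msym a0 ** R = mat 1"
    and near: "\<And>z. cmod z = 1 \<Longrightarrow> cmod (det (evm (R ** msym a) z) - 1) < 1/2"
  shows "G_const a = G_const a0 * exp (mean (\<lambda>z. Ln (det (evm (R ** msym a) z))))"
proof -
  obtain l where l: "continuous_on (sphere 0 1) l" "\<And>z. cmod z = 1 \<Longrightarrow> exp (l z) = det (evm (msym a0) z)"
    using factors_log[OF a0(2)] by blast
  have c: "continuous_on (sphere 0 1) (\<lambda>z. Ln (det (evm (R ** msym a) z)))"
    by (rule continuous_on_Ln_det[OF near])
  have "G_const a = exp (mean (\<lambda>z. l z + Ln (det (evm (R ** msym a) z))))"
  proof (rule G_const_eqI[OF a])
    show "continuous_on (sphere 0 1) (\<lambda>z. l z + Ln (det (evm (R ** msym a) z)))"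
      by (intro continuous_intros l c)
    fix z :: complex assume z: "cmod z = 1"
    have "msym a = msym a0 ** (R ** msym a)" by (simp add: matrix_mul_assoc R)
    then have "det (evm (msym a) z) = det (evm (msym a0) z) * det (evm (R ** msym a) z)"
      by (metis z evm_mult det_mul)
    then show "exp (l z + Ln (det (evm (R ** msym a) z))) = det (evm (msym a) z)"
      using near1_ne0[OF near[OF z]] by (simp add: exp_add l(2) z)
  qed
  then show ?thesis using G_const_eqI[OF a0(1) l] by (simp add: mean_add[OF l(1) c] exp_add)
qed

subsection \<open>The identity component\<close>

text \<open>The inverse c' of R S is close to 1 and satisfies S c' = S0, so its factorization p m
  can be put in front of any list for \<open>S0\<close>. Conversely, factorizing R S itself turns a
  list for \<open>S\<close> into one for \<open>S0\<close>. The radius depends on \<open>S0\<close>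
  and \<open>R\<close> only, and just two factors close to 1 are added whatever \<open>S\<close> is;
  this later gives bounds uniform in the parameter.\<close>

lemma factors_local:
  fixes S0 :: "wsym ^ 'n ^ 'n::finite"
  assumes R: "S0 ** R = mat 1"
  obtains d where "d > 0"
    "\<And>S. norm (S - S0) < d \<Longrightarrow> norm (R ** S - mat 1) < 1/2 \<and> near1 (R ** S) \<and> (\<exists>R'. S ** R' = mat 1)"
    "\<And>S bs. norm (S - S0) < d \<Longrightarrow> factors S0 bs \<Longrightarrow>
        \<exists>p m. factors S (p # m # bs) \<and> norm (p - mat 1) < 1 \<and> norm (m - mat 1) < 1"
    "\<And>S bs. norm (S - S0) < d \<Longrightarrow> factors S bs \<Longrightarrow> \<exists>bs'. factors S0 bs'"
proof -
  have R': "R ** S0 = mat 1" by (rule matrix_mult_left_right_one[OF R])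
  obtain \<eta> where \<eta>: "\<eta> > 0" "\<And>b :: wsym ^ 'n ^ 'n. norm (b - mat 1) < \<eta> \<Longrightarrow> near1 b"
    by (rule near1_radius) blast
  obtain \<delta> where \<delta>: "\<delta> > 0" "\<And>c :: wsym ^ 'n ^ 'n. norm (c - mat 1) < \<delta> \<Longrightarrow>
     \<exists>p m. c = p ** m \<and> plusM p \<and> minusM m \<and> norm (p - mat 1) < min \<eta> 1 \<and> norm (m - mat 1) < min \<eta> 1"
    using wiener_hopf_near_one[of "min \<eta> 1"] \<eta> by (metis min_less_iff_conj zero_less_one)
  define \<kappa> where "\<kappa> = 1 + 2 * norm (mat 1 :: wsym ^ 'n ^ 'n)"
  have \<kappa>: "\<kappa> \<ge> 1" by (simp add: \<kappa>_def)
  \<comment> \<open>The term \<delta> / \<kappa> is for the inverse of R S, whose distance from 1 is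
    larger than that of R S by at most the factor \<kappa>.\<close>
  define r where "r = min (1/2) (min \<eta> (\<delta> / \<kappa>))"
  have r: "r > 0" "r \<le> 1/2" "r \<le> \<eta>" "r * \<kappa> \<le> \<delta>" "r \<le> \<delta>"
  proof -
    show "r > 0" using \<eta> \<delta> \<kappa> by (simp add: r_def)
    show "r \<le> 1/2" "r \<le> \<eta>" unfolding r_def by (meson min.cobounded1 min.cobounded2 order_trans)+
    have "r * \<kappa> \<le> \<delta> / \<kappa> * \<kappa>" using \<kappa> by (intro mult_right_mono) (auto simp: r_def)
    then show k: "r * \<kappa> \<le> \<delta>" using \<kappa> by simp
    have "r * 1 \<le> r * \<kappa>" using \<kappa> \<open>r > 0\<close> by (intro mult_left_mono) auto
    then show "r \<le> \<delta>" using k by linarith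
  qed
  define d where "d = r / (1 + norm R)"
  have d: "d > 0" using r(1) by (simp add: d_def add_pos_nonneg)
  have c: "norm (R ** S - mat 1) < r" if S: "norm (S - S0) < d" for S
  proof -
    have "R ** S - mat 1 = R ** (S - S0)" by (simp add: matrix_distrib_diff R')
    then have "norm (R ** S - mat 1) \<le> norm R * norm (S - S0)" using norm_matrix_mult_le by metis
    also have "\<dots> \<le> (1 + norm R) * norm (S - S0)" by (intro mult_right_mono) auto
    also have "\<dots> < (1 + norm R) * d" using S by (intro mult_strict_left_mono) (auto simp: add_pos_nonneg)
    also have "\<dots> = r" using norm_ge_zero[of R] by (simp add: d_def add_nonneg_eq_0_iff)
    finally show ?thesis .
  qed
  have SS0: "S = S0 ** (R ** S)" for S by (simp add: matrix_mul_assoc R)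
  have inv: "\<exists>c'. (R ** S) ** c' = mat 1 \<and> norm (c' - mat 1) < \<delta>" if S: "norm (S - S0) < d" for S
  proof -
    define v where "v = R ** S - mat 1"
    have v: "norm v < r" using c[OF S] by (simp add: v_def)
    have "norm v \<le> 1/2" using v r by linarith
    then obtain m where m: "(mat 1 + v) ** m = mat 1" "norm (m - mat 1) \<le> 2 * norm (mat 1 :: wsym ^ 'n ^ 'n) * norm v"
      by (rule neumann) blast
    have "norm (m - mat 1) \<le> \<kappa> * norm v"
      using m(2) by (rule order_trans) (intro mult_right_mono, auto simp: \<kappa>_def)
    also have "\<dots> < \<kappa> * r" using v \<kappa> by (intro mult_strict_left_mono) auto
    also have "\<dots> \<le> \<delta>" using r by (simp add: mult.commute)
    finally show ?thesis using m(1) by (intro exI[of _ m]) (simp add: v_def)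
  qed
  have 1: "norm (R ** S - mat 1) < 1/2 \<and> near1 (R ** S) \<and> (\<exists>R'. S ** R' = mat 1)" if S: "norm (S - S0) < d" for S
  proof (intro conjI)
    show "norm (R ** S - mat 1) < 1/2" using c[OF S] r by simp
    show "near1 (R ** S)" using c[OF S] r by (intro \<eta>) simp
    obtain c' where c': "(R ** S) ** c' = mat 1" using inv[OF S] by blast
    have "S ** (c' ** R) = S0 ** ((R ** S) ** c') ** R"
      by (subst SS0) (simp add: matrix_mul_assoc)
    then show "\<exists>R'. S ** R' = mat 1" using c' R by auto
  qed
  have tri: "triangular1 p" if "plusM p \<or> minusM p" "norm (p - mat 1) < min \<eta> 1" for p :: "wsym ^ 'n ^ 'n"
    using that \<eta>(2) by (simp add: triangular1_def)
  have 2: "\<exists>p m. factors S (p # m # bs) \<and> norm (p - mat 1) < 1 \<and> norm (m - mat 1) < 1"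
    if S: "norm (S - S0) < d" and bs: "factors S0 bs" for S bs
  proof -
    obtain c' where c': "(R ** S) ** c' = mat 1" "norm (c' - mat 1) < \<delta>" using inv[OF S] by blast
    obtain p m where pm: "c' = p ** m" "plusM p" "minusM m" "norm (p - mat 1) < min \<eta> 1" "norm (m - mat 1) < min \<eta> 1"
      using \<delta>(2)[OF c'(2)] by blast
    have "S ** c' = S0 ** ((R ** S) ** c')" by (subst SS0) (simp add: matrix_mul_assoc)
    then have "S ** c' = S0" by (simp add: c')
    then have "S ** lprod (p # m # bs) = S0 ** lprod bs" by (simp add: matrix_mul_assoc pm(1))
    then have "factors S (p # m # bs)" using bs pm tri by (auto simp: factors_def)
    then show ?thesis using pm by auto
  qed
  have 3: "\<exists>bs'. factors S0 bs'" if S: "norm (S - S0) < d" and bs: "factors S bs" for S bs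
  proof -
    have "norm (R ** S - mat 1) < \<delta>" using c[OF S] r by linarith
    from \<delta>(2)[OF this] obtain p m where pm: "R ** S = p ** m" "plusM p" "minusM m"
        "norm (p - mat 1) < min \<eta> 1" "norm (m - mat 1) < min \<eta> 1"
      by blast
    have "S0 ** lprod (p # m # bs) = S0 ** (p ** m) ** lprod bs" by (simp add: matrix_mul_assoc)
    also have "\<dots> = S ** lprod bs" using SS0[of S] pm(1) by simp
    finally have "factors S0 (p # m # bs)" using bs pm tri by (auto simp: factors_def)
    then show ?thesis by blast
  qed
  show ?thesis by (rule that[OF d 1 2 3])
qed

text \<open>Identities valid almost everywhere hold everywhere for the continuous representatives,
  so invertibility can be read off from the coefficients.\<close>

lemma GBM_iff:
  "a \<in> GBM \<longleftrightarrow> a \<in> BM_alg \<and> (\<exists>R. msym a ** R = mat 1)"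
proof
  assume "a \<in> GBM"
  then obtain b where a: "a \<in> BM_alg" and b: "b \<in> BM_alg"
    and ab: "AE x\<in>{0..2*pi} in lebesgue. a (cis x) ** b (cis x) = mat 1 \<and> b (cis x) ** a (cis x) = mat 1"
    by (auto simp: GBM_def)
  have "msym a ** msym b = mat 1"
  proof (rule evm_inject, rule AE_circle_imp_eq[of "evm (msym a ** msym b)" "evm (mat 1)"])
    show "AE x\<in>{0..2*pi} in lebesgue. evm (msym a ** msym b) (cis x) = evm (mat 1) (cis x)"
      using ab msym_AE_eq[OF a] msym_AE_eq[OF b] by eventually_elim (auto simp: evm_mult)
  qed (auto intro: continuous_on_evm)
  then show "a \<in> BM_alg \<and> (\<exists>R. msym a ** R = mat 1)" using a by blast
next
  assume "a \<in> BM_alg \<and> (\<exists>R. msym a ** R = mat 1)"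
  then obtain R where a: "a \<in> BM_alg" and R: "msym a ** R = mat 1" by blast
  have R': "R ** msym a = mat 1" by (rule matrix_mult_left_right_one[OF R])
  have "AE x\<in>{0..2*pi} in lebesgue. a (cis x) ** evm R (cis x) = mat 1 \<and> evm R (cis x) ** a (cis x) = mat 1"
    using msym_AE_eq[OF a]
  proof eventually_elim
    case (elim x)
    have "evm (msym a) (cis x) ** evm R (cis x) = mat 1" "evm R (cis x) ** evm (msym a) (cis x) = mat 1"
      using evm_mult[of "cis x" "msym a" R] evm_mult[of "cis x" R "msym a"] by (simp_all add: R R')
    then show ?case using elim by auto
  qed
  then show "a \<in> GBM" using a evm_in_BM_alg unfolding GBM_def by blast
qed

text \<open>By \<open>factors_local\<close>, having a factorization does not change under small
  perturbations of an invertible symbol. So the invertible symbols with one and those without one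
  form two open sets, and a connected set meeting the first, which contains the identity by the
  empty list, misses the second.\<close>

lemma G1BM_imp_factors:
  fixes a :: "complex \<Rightarrow> complex ^ 'n ^ 'n::finite"
  assumes "a \<in> G1BM"
  shows "a \<in> BM_alg" "\<exists>bs. factors (msym a) bs"
proof -
  let ?P = "\<lambda>a :: complex \<Rightarrow> complex ^ 'n ^ 'n. \<exists>bs. factors (msym a) bs"
  obtain T where T: "connectedin (subtopology BM_topology GBM) T" "(\<lambda>z. mat 1) \<in> T" "a \<in> T"
    using assms unfolding G1BM_def connected_component_of_def by auto
  then have TG: "T \<subseteq> GBM" and Tc: "connectedin BM_topology T" by (auto simp: connectedin_subtopology)
  then show "a \<in> BM_alg" using T by (auto simp: GBM_def)
  define E1 :: "(complex \<Rightarrow> complex ^ 'n ^ 'n) set" where "E1 = {a \<in> GBM. ?P a}"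
  define E2 :: "(complex \<Rightarrow> complex ^ 'n ^ 'n) set" where "E2 = {a \<in> GBM. \<not> ?P a}"
  have loc: "\<exists>\<epsilon>>0. \<forall>b\<in>BM_alg. BM_norm (\<lambda>z. b z - c z) < \<epsilon> \<longrightarrow> b \<in> GBM \<and> (?P b \<longleftrightarrow> ?P c)"
    if c: "c \<in> GBM" for c :: "complex \<Rightarrow> complex ^ 'n ^ 'n"
  proof -
    obtain R where R: "msym c ** R = mat 1" and cB: "c \<in> BM_alg" using c GBM_iff by blast
    show ?thesis
    proof (rule factors_local[OF R])
      fix d :: real
      assume d: "d > 0"
        and d2: "\<And>S. norm (S - msym c) < d \<Longrightarrow>
            norm (R ** S - mat 1) < 1/2 \<and> near1 (R ** S) \<and> (\<exists>R'. S ** R' = mat 1)"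
        and d3: "\<And>S bs. norm (S - msym c) < d \<Longrightarrow> factors (msym c) bs \<Longrightarrow>
            \<exists>p m. factors S (p # m # bs) \<and> norm (p - mat 1) < 1 \<and> norm (m - mat 1) < 1"
        and d4: "\<And>S bs. norm (S - msym c) < d \<Longrightarrow> factors S bs \<Longrightarrow> \<exists>bs'. factors (msym c) bs'"
      show "\<exists>\<epsilon>>0. \<forall>b\<in>BM_alg. BM_norm (\<lambda>z. b z - c z) < \<epsilon> \<longrightarrow> b \<in> GBM \<and> (?P b \<longleftrightarrow> ?P c)"
      proof (intro exI[of _ d] conjI ballI impI)
        fix b :: "complex \<Rightarrow> complex ^ 'n ^ 'n"
        assume b: "b \<in> BM_alg" and "BM_norm (\<lambda>z. b z - c z) < d"
        then have n: "norm (msym b - msym c) < d" using norm_msym_diff_le[OF cB b] by linarith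
        show "b \<in> GBM" using d2[OF n] b by (simp add: GBM_iff)
        show "?P b \<longleftrightarrow> ?P c"
        proof
          assume "?P b"
          then obtain bs where "factors (msym b) bs" ..
          then show "?P c" by (rule d4[OF n])
        next
          assume "?P c"
          then obtain bs where "factors (msym c) bs" ..
          from d3[OF n this] show "?P b" by (elim exE conjE) (rule exI)
        qed
      qed (rule d)
    qed
  qed
  have "openin BM_topology E1"
    unfolding openin_BM_topology BM_open_def
  proof (intro conjI ballI)
    fix c assume "c \<in> E1"
    then have c: "c \<in> GBM" "?P c" by (auto simp: E1_def)
    obtain \<epsilon> where "\<epsilon> > 0" and
      "\<forall>b\<in>BM_alg. BM_norm (\<lambda>z. b z - c z) < \<epsilon> \<longrightarrow> b \<in> GBM \<and> (?P b \<longleftrightarrow> ?P c)"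
      using loc[OF c(1)] by (elim exE conjE)
    then show "\<exists>\<epsilon>>0. \<forall>b\<in>BM_alg. BM_norm (\<lambda>z. b z - c z) < \<epsilon> \<longrightarrow> b \<in> E1"
      using c(2) unfolding E1_def by (intro exI[of _ \<epsilon>]) simp
  qed (use GBM_iff in \<open>force simp: E1_def\<close>)
  moreover have "openin BM_topology E2"
    unfolding openin_BM_topology BM_open_def
  proof (intro conjI ballI)
    fix c assume "c \<in> E2"
    then have c: "c \<in> GBM" "\<not> ?P c" by (auto simp: E2_def)
    obtain \<epsilon> where "\<epsilon> > 0" and
      "\<forall>b\<in>BM_alg. BM_norm (\<lambda>z. b z - c z) < \<epsilon> \<longrightarrow> b \<in> GBM \<and> (?P b \<longleftrightarrow> ?P c)"
      using loc[OF c(1)] by (elim exE conjE)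
    then show "\<exists>\<epsilon>>0. \<forall>b\<in>BM_alg. BM_norm (\<lambda>z. b z - c z) < \<epsilon> \<longrightarrow> b \<in> E2"
      using c(2) unfolding E2_def by (intro exI[of _ \<epsilon>]) simp
  qed (use GBM_iff in \<open>force simp: E2_def\<close>)
  moreover have "T \<subseteq> E1 \<union> E2" using TG by (auto simp: E1_def E2_def)
  moreover have "E1 \<inter> E2 \<inter> T = {}" by (auto simp: E1_def E2_def)
  moreover have "(\<lambda>z. mat 1) \<in> E1"
  proof -
    have "(\<lambda>z. mat 1) = evm (mat 1)" by (simp add: fun_eq_iff)
    then have "msym (\<lambda>z. mat 1 :: complex ^ 'n ^ 'n) = mat 1" by (metis msym_evm)
    then have "factors (msym (\<lambda>z. mat 1 :: complex ^ 'n ^ 'n)) []" by (simp add: factors_def)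
    then show ?thesis using T TG by (auto simp: E1_def)
  qed
  moreover have "\<not> (\<exists>E1 E2. openin BM_topology E1 \<and> openin BM_topology E2 \<and> T \<subseteq> E1 \<union> E2 \<and>
      E1 \<inter> E2 \<inter> T = {} \<and> E1 \<inter> T \<noteq> {} \<and> E2 \<inter> T \<noteq> {})"
    using Tc unfolding connectedin by (rule conjunct2)
  ultimately have "E1 \<inter> T = {} \<or> E2 \<inter> T = {}" by meson
  then have "a \<notin> E2" using \<open>(\<lambda>z. mat 1) \<in> E1\<close> T by auto
  then show "?P a" using T TG by (auto simp: E2_def)
qed

section \<open>Sequences of matrices concentrated in the corners\<close>

lemma finite_block_idx [simp]: "finite (block_idx n :: (nat \<times> 'n::finite) set)"
  by (simp add: block_idx_def)

lemma mem_block_idx [simp]: "(k, \<alpha>) \<in> block_idx n \<longleftrightarrow> k < n"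
  by (simp add: block_idx_def)

lemma mem_block_idx': "i \<in> block_idx n \<longleftrightarrow> fst i < n"
  by (cases i) simp

text \<open>Counts the block position from the beginning or, if \<open>s\<close> is true, from the
  end; the latter is the reflection behind \<open>W_op\<close>.\<close>

definition side :: "nat \<Rightarrow> bool \<Rightarrow> nat \<times> 'n \<Rightarrow> nat \<times> 'n" where
  "side n s i = (if s then n - 1 - fst i else fst i, snd i)"

lemma side_in [simp]: "i \<in> block_idx n \<Longrightarrow> side n s i \<in> block_idx n"
  by (auto simp: side_def mem_block_idx')

lemma side_side [simp]: "i \<in> block_idx n \<Longrightarrow> side n s (side n s i) = i"
  by (cases i) (auto simp: side_def)

lemma bij_side: "bij_betw (side n s) (block_idx n) (block_idx n)"
  by (rule bij_betwI[of _ _ _ "side n s"]) auto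

lemma inj_on_side: "inj_on (side n s) (block_idx n)"
  using bij_side bij_betw_def by blast

type_synonym 'n corners = "bool \<Rightarrow> bool \<Rightarrow> nat \<times> 'n \<Rightarrow> nat \<times> 'n \<Rightarrow> complex"

definition corner :: "'n corners \<Rightarrow> nat \<Rightarrow> (nat \<times> 'n) matrix" where
  "corner y n i j = (\<Sum>s\<in>UNIV. \<Sum>s'\<in>UNIV. y s s' (side n s i) (side n s' j))"

definition fsupp :: "nat \<Rightarrow> 'n corners \<Rightarrow> bool" where
  "fsupp m y \<longleftrightarrow> (\<forall>s s' i j. y s s' i j \<noteq> 0 \<longrightarrow> fst i < m \<and> fst j < m)"

text \<open>The trace norm closure of the sequences of matrices that have a fixed finite set of entries
  in the four corners.\<close>

definition cornered :: "(nat \<Rightarrow> (nat \<times> 'n::finite) matrix) \<Rightarrow> bool" where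
  "cornered X \<longleftrightarrow> (\<forall>\<epsilon>>0. \<exists>m y. fsupp m y \<and>
     (\<forall>\<^sub>F n in sequentially. nuc_le (block_idx n) (\<lambda>i j. X n i j - corner y n i j) \<epsilon>))"

lemma cornered_closure:
  assumes "\<And>\<epsilon>. \<epsilon> > 0 \<Longrightarrow> \<exists>X'. cornered X' \<and>
     (\<forall>\<^sub>F n in sequentially. nuc_le (block_idx n) (\<lambda>i j. X n i j - X' n i j) \<epsilon>)"
  shows "cornered X"
  unfolding cornered_def
proof (intro allI impI)
  fix \<epsilon> :: real assume e: "\<epsilon> > 0"
  obtain X' where X': "cornered X'"
    and 1: "\<forall>\<^sub>F n in sequentially. nuc_le (block_idx n) (\<lambda>i j. X n i j - X' n i j) (\<epsilon>/2)"
    using assms[of "\<epsilon>/2"] e by auto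
  obtain m y where y: "fsupp m y"
    and 2: "\<forall>\<^sub>F n in sequentially. nuc_le (block_idx n) (\<lambda>i j. X' n i j - corner y n i j) (\<epsilon>/2)"
    using X' e unfolding cornered_def by (meson half_gt_zero)
  have "\<forall>\<^sub>F n in sequentially. nuc_le (block_idx n) (\<lambda>i j. X n i j - corner y n i j) \<epsilon>"
    using 1 2
  proof eventually_elim
    case (elim n)
    from nuc_le_add[OF elim] show ?case by simp
  qed
  then show "\<exists>m y. fsupp m y \<and> (\<forall>\<^sub>F n in sequentially. nuc_le (block_idx n) (\<lambda>i j. X n i j - corner y n i j) \<epsilon>)"
    using y by blast
qed

lemma cornered_add:
  assumes "cornered X" "cornered X'"
  shows "cornered (\<lambda>n i j. X n i j + X' n i j)"
  unfolding cornered_def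
proof (intro allI impI)
  fix \<epsilon> :: real assume e: "\<epsilon> > 0"
  obtain m y where y: "fsupp m y"
    and 1: "\<forall>\<^sub>F n in sequentially. nuc_le (block_idx n) (\<lambda>i j. X n i j - corner y n i j) (\<epsilon>/2)"
    using assms(1) e unfolding cornered_def by (meson half_gt_zero)
  obtain m' y' where y': "fsupp m' y'"
    and 2: "\<forall>\<^sub>F n in sequentially. nuc_le (block_idx n) (\<lambda>i j. X' n i j - corner y' n i j) (\<epsilon>/2)"
    using assms(2) e unfolding cornered_def by (meson half_gt_zero)
  let ?y = "\<lambda>s s' i j. y s s' i j + y' s s' i j"
  have "fsupp (max m m') ?y"
    unfolding fsupp_def
  proof (intro allI impI)
    fix s s' i j assume "?y s s' i j \<noteq> 0"
    then have "y s s' i j \<noteq> 0 \<or> y' s s' i j \<noteq> 0" by auto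
    then show "fst i < max m m' \<and> fst j < max m m'"
      using y y' unfolding fsupp_def by (meson less_max_iff_disj)
  qed
  moreover have "\<forall>\<^sub>F n in sequentially. nuc_le (block_idx n) (\<lambda>i j. X n i j + X' n i j - corner ?y n i j) \<epsilon>"
    using 1 2
  proof eventually_elim
    case (elim n)
    from nuc_le_add[OF elim] show ?case by (simp add: corner_def sum.distrib algebra_simps)
  qed
  ultimately show "\<exists>m y. fsupp m y \<and> (\<forall>\<^sub>F n in sequentially.
      nuc_le (block_idx n) (\<lambda>i j. X n i j + X' n i j - corner y n i j) \<epsilon>)" by blast
qed

lemma div_add_one_le_one: "0 \<le> x \<Longrightarrow> x / (x + 1) \<le> (1::real)"
  by (simp add: divide_le_eq)

lemma cornered_scale:
  assumes "cornered X"
  shows "cornered (\<lambda>n i j. c * X n i j)"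
  unfolding cornered_def
proof (intro allI impI)
  fix \<epsilon> :: real assume e: "\<epsilon> > 0"
  have "\<epsilon> / (cmod c + 1) > 0" using e by (simp add: add_nonneg_pos)
  then obtain m y where y: "fsupp m y"
    and 1: "\<forall>\<^sub>F n in sequentially. nuc_le (block_idx n) (\<lambda>i j. X n i j - corner y n i j) (\<epsilon> / (cmod c + 1))"
    using assms unfolding cornered_def by meson
  let ?y = "\<lambda>s s' i j. c * y s s' i j"
  have "fsupp m ?y" using y unfolding fsupp_def mult_eq_0_iff by blast
  moreover have "\<forall>\<^sub>F n in sequentially. nuc_le (block_idx n) (\<lambda>i j. c * X n i j - corner ?y n i j) \<epsilon>"
    using 1
  proof eventually_elim
    case (elim n)
    have "cmod c * (\<epsilon> / (cmod c + 1)) = \<epsilon> * (cmod c / (cmod c + 1))" by simp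
    also have "\<dots> \<le> \<epsilon> * 1" using e by (intro mult_left_mono div_add_one_le_one) auto
    finally have "cmod c * (\<epsilon> / (cmod c + 1)) \<le> \<epsilon>" by simp
    from nuc_le_mono[OF nuc_le_scale[OF elim, of c] this]
    show ?case by (simp add: corner_def sum_distrib_left right_diff_distrib)
  qed
  ultimately show "\<exists>m y. fsupp m y \<and> (\<forall>\<^sub>F n in sequentially.
      nuc_le (block_idx n) (\<lambda>i j. c * X n i j - corner y n i j) \<epsilon>)" by blast
qed

lemma cornered_minus: "cornered X \<Longrightarrow> cornered (\<lambda>n i j. - X n i j)"
  using cornered_scale[of X "-1"] by simp

lemma cornered_diff: "cornered X \<Longrightarrow> cornered X' \<Longrightarrow> cornered (\<lambda>n i j. X n i j - X' n i j)"
  using cornered_add[OF _ cornered_minus, of X X'] by simp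

lemma cornered_zero: "cornered (\<lambda>n i j. 0)"
proof -
  have "nuc_le F (\<lambda>i j. 0) 0" for F :: "(nat \<times> 'a) set" by (simp add: nuc_le_def)
  then have "nuc_le F (\<lambda>i j. 0) \<epsilon>" if "\<epsilon> > 0" for F :: "(nat \<times> 'a) set" and \<epsilon>
    using nuc_le_mono that by (metis less_imp_le)
  then show ?thesis
    unfolding cornered_def by (auto intro!: exI[of _ 0] exI[of _ "\<lambda>_ _ _ _. 0"] simp: fsupp_def corner_def)
qed

lemma cornered_sum:
  assumes "\<And>k. k \<in> S \<Longrightarrow> cornered (X k)"
  shows "cornered (\<lambda>n i j. \<Sum>k\<in>S. X k n i j)"
  using assms by (induction S rule: infinite_finite_induct) (auto intro: cornered_zero cornered_add)

lemma cornered_cong: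
  assumes X: "cornered X" and eq: "\<forall>\<^sub>F n in sequentially. \<forall>i\<in>block_idx n. \<forall>j\<in>block_idx n. X n i j = X' n i j"
  shows "cornered X'"
proof (rule cornered_closure)
  fix \<epsilon> :: real assume e: "\<epsilon> > 0"
  have "\<forall>\<^sub>F n in sequentially. nuc_le (block_idx n) (\<lambda>i j. X' n i j - X n i j) \<epsilon>"
    using eq
  proof eventually_elim
    case (elim n)
    have "nuc_le (block_idx n) (\<lambda>i j. 0) 0" by (simp add: nuc_le_def)
    then have "nuc_le (block_idx n) (\<lambda>i j. X' n i j - X n i j) 0"
      by (rule nuc_le_cong[THEN iffD1, rotated]) (use elim in auto)
    then show ?case using e nuc_le_mono less_imp_le by blast
  qed
  then show "\<exists>Y. cornered Y \<and> (\<forall>\<^sub>F n in sequentially. nuc_le (block_idx n) (\<lambda>i j. X' n i j - Y n i j) \<epsilon>)"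
    using X by blast
qed

lemma cornered_small:
  assumes "\<And>\<epsilon>. \<epsilon> > 0 \<Longrightarrow> \<forall>\<^sub>F n in sequentially. nuc_le (block_idx n) (C n) \<epsilon>"
  shows "cornered C"
proof (rule cornered_closure)
  fix \<epsilon> :: real assume "\<epsilon> > 0"
  then show "\<exists>Y. cornered Y \<and> (\<forall>\<^sub>F n in sequentially. nuc_le (block_idx n) (\<lambda>i j. C n i j - Y n i j) \<epsilon>)"
    using assms by (intro exI[of _ "\<lambda>n i j. 0"]) (auto intro: cornered_zero)
qed

text \<open>Once n >= 2 m the two ends do not overlap and all rows away from them are identity rows.
  The determinant therefore equals one over the fixed index set of pairs of an end and a position
  counted from it.\<close>

lemma fdet_corner_const:
  fixes y :: "'n::finite corners"
  assumes y: "fsupp m y"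
  shows "\<exists>K. \<forall>n\<ge>2 * m. fdet (block_idx n :: (nat \<times> 'n::finite) set) (\<lambda>i j. idm i j + corner y n i j) = K"
proof -
  define Q :: "(bool \<times> nat \<times> 'n) set" where "Q = UNIV \<times> block_idx m"
  have "fdet (block_idx n) (\<lambda>i j. idm i j + corner y n i j) =
      fdet Q (\<lambda>p q. idm p q + y (fst p) (fst q) (snd p) (snd q))" if n: "n \<ge> 2 * m" for n
  proof -
    define \<iota> where "\<iota> = (\<lambda>p. side n (fst p) (snd p :: nat \<times> 'n))"
    have \<iota>n: "\<iota> p \<in> block_idx n" if "p \<in> Q" for p
      using that n by (cases p) (auto simp: \<iota>_def Q_def mem_block_idx' intro!: side_in[unfolded mem_block_idx'])
    have ss: "side n t (side n s i) = i \<longleftrightarrow> t = s" "t \<noteq> s \<Longrightarrow> \<not> fst (side n t (side n s i)) < m"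
      if "i \<in> block_idx m" for i :: "nat \<times> 'n" and s t
      using that n by (cases i; auto simp: side_def)+
    have inj: "inj_on \<iota> Q"
    proof (rule inj_onI)
      fix p q assume pq: "p \<in> Q" "q \<in> Q" "\<iota> p = \<iota> q"
      obtain s i t j where p: "p = (s, i)" and q: "q = (t, j)" by (cases p; cases q) auto
      have i: "i \<in> block_idx m" "j \<in> block_idx m" "side n s i = side n t j"
        using pq by (auto simp: p q Q_def \<iota>_def)
      then show "p = q" using n by (cases i; cases j) (auto simp: p q side_def split: if_splits)
    qed
    have fin: "finite Q" by (simp add: Q_def)
    have "fdet (block_idx n) (\<lambda>i j. idm i j + corner y n i j) = fdet (\<iota> ` Q) (\<lambda>i j. idm i j + corner y n i j)"
    proof (rule fdet_identity_rows)
      show "\<iota> ` Q \<subseteq> block_idx n" using \<iota>n by auto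
      fix i j :: "nat \<times> 'n" assume i: "i \<in> block_idx n - \<iota> ` Q" and "j \<in> block_idx n"
      have "y s s' (side n s i) k = 0" for s s' k
      proof (rule ccontr)
        assume "y s s' (side n s i) k \<noteq> 0"
        then have "fst (side n s i) < m" using y unfolding fsupp_def by blast
        then have "(s, side n s i) \<in> Q" by (simp add: Q_def mem_block_idx')
        then have "\<iota> (s, side n s i) \<in> \<iota> ` Q" by (rule imageI)
        then show False using i by (auto simp: \<iota>_def)
      qed
      then show "idm i j + corner y n i j = idm i j" by (simp add: corner_def)
    qed simp
    also have "\<dots> = fdet Q (\<lambda>p q. idm (\<iota> p) (\<iota> q) + corner y n (\<iota> p) (\<iota> q))"
      using inj fin by (intro fdet_reindex) (auto simp: bij_betw_def)
    also have "\<dots> = fdet Q (\<lambda>p q. idm p q + y (fst p) (fst q) (snd p) (snd q))"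
    proof (rule fdet_cong)
      fix p q assume pq: "p \<in> Q" "q \<in> Q"
      obtain s i t j where p: "p = (s, i)" and q: "q = (t, j)" by (cases p; cases q) auto
      have i: "i \<in> block_idx m" "j \<in> block_idx m" using pq by (auto simp: p q Q_def)
      have "y s' t' (side n s' (side n s i)) (side n t' (side n t j)) =
          (if s' = s \<and> t' = t then y s t i j else 0)" for s' t'
      proof (cases "s' = s \<and> t' = t")
        case True
        moreover have "side n s (side n s i) = i" "side n t (side n t j) = j"
          using ss(1)[OF i(1), of s s] ss(1)[OF i(2), of t t] by simp_all
        ultimately show ?thesis by simp
      next
        case False
        then have "\<not> (fst (side n s' (side n s i)) < m \<and> fst (side n t' (side n t j)) < m)"
          using ss(2)[OF i(1)] ss(2)[OF i(2)] by auto
        then have "y s' t' (side n s' (side n s i)) (side n t' (side n t j)) = 0"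
          using y unfolding fsupp_def by blast
        then show ?thesis using False by auto
      qed
      then have "corner y n (\<iota> p) (\<iota> q) = y s t i j"
        unfolding corner_def \<iota>_def p q fst_conv snd_conv
        by (cases s; cases t) (simp_all add: UNIV_bool)
      moreover have "idm (\<iota> p) (\<iota> q) = idm p q"
        using inj_onD[OF inj _ pq] by (auto simp: idm_def)
      ultimately show "idm (\<iota> p) (\<iota> q) + corner y n (\<iota> p) (\<iota> q) = idm p q + y (fst p) (fst q) (snd p) (snd q)"
        by (simp add: p q)
    qed
    finally show ?thesis .
  qed
  then show ?thesis by blast
qed

text \<open>For every \<epsilon> the determinants eventually stay within B \<epsilon> of a constant,
  the determinant for the approximating corners. As \<open>B\<close> depends on the trace norm bound
  alone, the sequence is Cauchy.\<close>

lemma fdet_cornered_convergent: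
  assumes X: "cornered X" and b: "\<forall>\<^sub>F n in sequentially. nuc_le (block_idx n) (X n) c"
  shows "convergent (\<lambda>n. fdet (block_idx n) (\<lambda>i j. idm i j + X n i j))"
proof -
  let ?d = "\<lambda>n. fdet (block_idx n) (\<lambda>i j. idm i j + X n i j)"
  have c0: "c \<ge> 0" using b nuc_le_nonneg eventually_happens[OF b] by auto
  \<comment> \<open>One of the two added units pays for passing from \<open>X n\<close> to its
    corner approximation, the other stems from \<open>fdet_one_plus_perturb\<close>.\<close>
  define B where "B = 2 * exp ((c + 1 + 1) + (c + 1 + 1)\<^sup>2 / 2)"
  have B: "B > 0" by (simp add: B_def)
  have near: "\<exists>K. \<forall>\<^sub>F n in sequentially. cmod (?d n - K) \<le> B * \<epsilon>" if e: "0 < \<epsilon>" "\<epsilon> \<le> 1/2" for \<epsilon>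
  proof -
    obtain m y where y: "fsupp m y"
      and 1: "\<forall>\<^sub>F n in sequentially. nuc_le (block_idx n) (\<lambda>i j. X n i j - corner y n i j) \<epsilon>"
      using X e unfolding cornered_def by blast
    obtain K where K: "\<And>n. n \<ge> 2 * m \<Longrightarrow> fdet (block_idx n) (\<lambda>i j. idm i j + corner y n i j) = K"
      using fdet_corner_const[OF y] by blast
    have "\<forall>\<^sub>F n in sequentially. cmod (?d n - K) \<le> B * \<epsilon>"
      using b 1 eventually_ge_at_top[of "2 * m"]
    proof eventually_elim
      case (elim n)
      have "nuc_le (block_idx n) (\<lambda>i j. corner y n i j) (c + 1)"
        using nuc_le_mono[OF nuc_le_diff[OF elim(1,2)], of "c + 1"] e by simp
      from fdet_one_plus_perturb[OF _ this elim(2) e]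
      have "cmod (?d n - fdet (block_idx n) (\<lambda>i j. idm i j + corner y n i j)) \<le> B * \<epsilon>"
        by (simp add: B_def)
      then show ?case using K[OF elim(3)] by simp
    qed
    then show ?thesis by blast
  qed
  have "Cauchy ?d"
  proof (rule metric_CauchyI)
    fix e :: real assume e: "e > 0"
    define \<epsilon> where "\<epsilon> = min (1/2) (e / (4 * B))"
    have \<epsilon>: "0 < \<epsilon>" "\<epsilon> \<le> 1/2" "B * \<epsilon> \<le> e / 4"
    proof -
      show "0 < \<epsilon>" using e B by (simp add: \<epsilon>_def)
      show "\<epsilon> \<le> 1/2" unfolding \<epsilon>_def by (rule min.cobounded1)
      have "B * \<epsilon> \<le> B * (e / (4 * B))" unfolding \<epsilon>_def using B by (intro mult_left_mono) auto
      then show "B * \<epsilon> \<le> e / 4" using B by simp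
    qed
    obtain K N where KN: "\<And>n. n \<ge> N \<Longrightarrow> cmod (?d n - K) \<le> B * \<epsilon>"
      using near[OF \<epsilon>(1,2)] unfolding eventually_sequentially by blast
    have "dist (?d m) (?d n) < e" if "m \<ge> N" "n \<ge> N" for m n
      using norm_triangle_ineq4[of "?d m - K" "?d n - K"] KN[OF that(1)] KN[OF that(2)] \<epsilon>(3) e
      by (simp add: dist_norm)
    then show "\<exists>M. \<forall>m\<ge>M. \<forall>n\<ge>M. dist (?d m) (?d n) < e" by blast
  qed
  then show ?thesis by (simp add: Cauchy_convergent_iff)
qed

subsection \<open>Products of Hilbert--Schmidt operators\<close>

text \<open>A Hilbert-Schmidt bound tested on finite sets of entries. The type of the first index is
  free because it is the inner summation index: positions for Hankel operators, numbers of singular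
  values for trace class operators, corner indices for corner matrices.\<close>

definition hs_le :: "('k \<Rightarrow> 'i \<Rightarrow> complex) \<Rightarrow> real \<Rightarrow> bool" where
  "hs_le H a \<longleftrightarrow> a \<ge> 0 \<and> (\<forall>D. finite D \<longrightarrow> (\<Sum>(k, i)\<in>D. (cmod (H k i))\<^sup>2) \<le> a\<^sup>2)"

definition hs_prod :: "('k \<Rightarrow> 'i \<Rightarrow> complex) \<Rightarrow> ('k \<Rightarrow> 'i \<Rightarrow> complex) \<Rightarrow> 'i \<Rightarrow> 'i \<Rightarrow> complex" where
  "hs_prod H G i j = (\<Sum>\<^sub>\<infinity>k. H k i * G k j)"

lemma hs_leD: "hs_le H a \<Longrightarrow> finite D \<Longrightarrow> (\<Sum>(k, i)\<in>D. (cmod (H k i))\<^sup>2) \<le> a\<^sup>2"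
  by (simp add: hs_le_def)

lemma hs_le_nonneg: "hs_le H a \<Longrightarrow> a \<ge> 0"
  by (simp add: hs_le_def)

lemma hs_le_sub:
  assumes "hs_le H a" and "\<And>k i. cmod (H' k i) \<le> cmod (H k i)"
  shows "hs_le H' a"
  unfolding hs_le_def
proof (intro conjI allI impI)
  fix D :: "('a \<times> 'b) set" assume D: "finite D"
  have "(\<Sum>(k, i)\<in>D. (cmod (H' k i))\<^sup>2) \<le> (\<Sum>(k, i)\<in>D. (cmod (H k i))\<^sup>2)"
    using assms(2) by (intro sum_mono) (auto intro: power_mono)
  then show "(\<Sum>(k, i)\<in>D. (cmod (H' k i))\<^sup>2) \<le> a\<^sup>2" using hs_leD[OF assms(1) D] by linarith
qed (use assms hs_le_nonneg in auto)

lemma hs_summable: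
  assumes "hs_le H a"
  shows "(\<lambda>k. (cmod (H k i))\<^sup>2) summable_on UNIV"
proof (rule nonneg_bdd_above_summable_on)
  have "(\<Sum>k\<in>F. (cmod (H k i))\<^sup>2) \<le> a\<^sup>2" if "finite F" for F
  proof -
    have "(\<Sum>k\<in>F. (cmod (H k i))\<^sup>2) = (\<Sum>(k, i)\<in>F \<times> {i}. (cmod (H k i))\<^sup>2)"
      by (simp add: sum.cartesian_product[symmetric])
    also have "\<dots> \<le> a\<^sup>2" using that by (intro hs_leD[OF assms]) auto
    finally show ?thesis .
  qed
  then show "bdd_above (sum (\<lambda>k. (cmod (H k i))\<^sup>2) ` {F. F \<subseteq> UNIV \<and> finite F})"
    by (intro bdd_aboveI2[of _ _ "a\<^sup>2"]) auto
qed simp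

lemma hs_prod_summable:
  assumes "hs_le H a" "hs_le G b"
  shows "(\<lambda>k. H k i * G k j) summable_on UNIV"
proof (rule abs_summable_summable)
  have "(\<lambda>k. cmod (H k i * H k i)) summable_on UNIV" "(\<lambda>k. cmod (G k j * G k j)) summable_on UNIV"
    using hs_summable[OF assms(1), of i] hs_summable[OF assms(2), of j]
    by (simp_all add: norm_mult power2_eq_square)
  then show "(\<lambda>k. cmod (H k i * G k j)) summable_on UNIV" by (rule abs_summable_product)
qed

lemma nuc_le_limit:
  assumes lim: "\<And>i j. i \<in> F \<Longrightarrow> j \<in> F \<Longrightarrow> ((\<lambda>K. M K i j) \<longlongrightarrow> M' i j) A" and A: "A \<noteq> bot"
    and le: "\<forall>\<^sub>F K in A. nuc_le F (M K) c"
  shows "nuc_le F M' c"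
  unfolding nuc_le_def
proof (intro allI impI)
  fix Z b assume Z: "op_le F Z b"
  show "cmod (\<Sum>i\<in>F. \<Sum>j\<in>F. M' i j * Z i j) \<le> c * b"
  proof (rule tendsto_upperbound[OF _ _ A])
    show "((\<lambda>K. cmod (\<Sum>i\<in>F. \<Sum>j\<in>F. M K i j * Z i j)) \<longlongrightarrow> cmod (\<Sum>i\<in>F. \<Sum>j\<in>F. M' i j * Z i j)) A"
      by (intro tendsto_intros lim)
    show "\<forall>\<^sub>F K in A. cmod (\<Sum>i\<in>F. \<Sum>j\<in>F. M K i j * Z i j) \<le> c * b"
      using le by eventually_elim (rule nuc_leD[OF _ Z])
  qed
qed

text \<open>For fixed k the test matrix is bounded by the norms of the k-th rows of \<open>H\<close>
  and \<open>G\<close>, and Cauchy-Schwarz in k gives the product of the Hilbert-Schmidt norms. This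
  is done for finite sets of k, followed by a limit. The injections stand for restriction to a
  section and reflection.\<close>

lemma hs_prod_nuc_le:
  assumes H: "hs_le H a" and G: "hs_le G b" and F: "finite F"
    and \<sigma>: "inj_on \<sigma> F" and \<tau>: "inj_on \<tau> F"
  shows "nuc_le F (\<lambda>i j. hs_prod H G (\<sigma> i) (\<tau> j)) (a * b)"
proof (rule nuc_le_limit)
  show "((\<lambda>K. \<Sum>k\<in>K. H k (\<sigma> i) * G k (\<tau> j)) \<longlongrightarrow> hs_prod H G (\<sigma> i) (\<tau> j)) (finite_subsets_at_top UNIV)" for i j
    unfolding hs_prod_def by (intro infsum_tendsto hs_prod_summable[OF H G])
  have l2: "L2_set (\<lambda>k. l2n F (\<lambda>i. H k (\<sigma> i))) K \<le> a"
    if H: "hs_le H a" and K: "finite K" and \<sigma>: "inj_on \<sigma> F" for K a and H :: "'k \<Rightarrow> 'i \<Rightarrow> complex" and \<sigma>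
  proof -
    have "(\<Sum>k\<in>K. (l2n F (\<lambda>i. H k (\<sigma> i)))\<^sup>2) = (\<Sum>(k, i)\<in>K \<times> \<sigma> ` F. (cmod (H k i))\<^sup>2)"
      unfolding l2n_sq sum.cartesian_product[symmetric] using \<sigma> by (simp add: sum.reindex)
    also have "\<dots> \<le> a\<^sup>2" using K F by (intro hs_leD[OF H]) auto
    finally show ?thesis using hs_le_nonneg[OF H] unfolding L2_set_def by (simp add: real_le_lsqrt sum_nonneg)
  qed
  have "nuc_le F (\<lambda>i j. \<Sum>k\<in>K. H k (\<sigma> i) * G k (\<tau> j)) (a * b)" if K: "finite K" for K
    unfolding nuc_le_def
  proof (intro allI impI)
    fix Z d assume Z: "op_le F Z d"
    have "(\<Sum>i\<in>F. \<Sum>j\<in>F. (\<Sum>k\<in>K. H k (\<sigma> i) * G k (\<tau> j)) * Z i j) =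
        (\<Sum>k\<in>K. \<Sum>i\<in>F. \<Sum>j\<in>F. H k (\<sigma> i) * Z i j * G k (\<tau> j))"
    proof -
      have "(\<Sum>i\<in>F. \<Sum>j\<in>F. (\<Sum>k\<in>K. H k (\<sigma> i) * G k (\<tau> j)) * Z i j) =
         (\<Sum>i\<in>F. \<Sum>j\<in>F. \<Sum>k\<in>K. H k (\<sigma> i) * Z i j * G k (\<tau> j))"
        by (simp add: sum_distrib_left sum_distrib_right mult_ac)
      also have "\<dots> = (\<Sum>i\<in>F. \<Sum>k\<in>K. \<Sum>j\<in>F. H k (\<sigma> i) * Z i j * G k (\<tau> j))"
        by (intro sum.cong refl sum.swap)
      also have "\<dots> = (\<Sum>k\<in>K. \<Sum>i\<in>F. \<Sum>j\<in>F. H k (\<sigma> i) * Z i j * G k (\<tau> j))" by (rule sum.swap)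
      finally show ?thesis .
    qed
    also have "cmod \<dots> \<le> (\<Sum>k\<in>K. d * l2n F (\<lambda>i. H k (\<sigma> i)) * l2n F (\<lambda>j. G k (\<tau> j)))"
      by (rule order_trans[OF norm_sum]) (intro sum_mono op_leD[OF Z])
    also have "\<dots> = d * (\<Sum>k\<in>K. \<bar>l2n F (\<lambda>i. H k (\<sigma> i))\<bar> * \<bar>l2n F (\<lambda>j. G k (\<tau> j))\<bar>)"
      by (simp add: sum_distrib_left mult.assoc)
    also have "\<dots> \<le> d * (L2_set (\<lambda>k. l2n F (\<lambda>i. H k (\<sigma> i))) K * L2_set (\<lambda>k. l2n F (\<lambda>j. G k (\<tau> j))) K)"
      using op_le_nonneg[OF Z] by (intro mult_left_mono L2_set_mult_ineq)
    also have "\<dots> \<le> d * (a * b)"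
      using op_le_nonneg[OF Z] hs_le_nonneg[OF H]
      by (intro mult_left_mono mult_mono l2 H G K \<sigma> \<tau>) (auto simp: L2_set_nonneg)
    finally show "cmod (\<Sum>i\<in>F. \<Sum>j\<in>F. (\<Sum>k\<in>K. H k (\<sigma> i) * G k (\<tau> j)) * Z i j) \<le> a * b * d"
      by (simp add: mult_ac)
  qed
  then show "\<forall>\<^sub>F K in finite_subsets_at_top UNIV. nuc_le F (\<lambda>i j. \<Sum>k\<in>K. H k (\<sigma> i) * G k (\<tau> j)) (a * b)"
    by (intro eventually_finite_subsets_at_top_weakI)
qed simp

text \<open>Take a finite set whose squared sum is within \<epsilon>^2 of the supremum; any finite
  set disjoint from it then has squared sum at most \<epsilon>^2.\<close>

lemma hs_truncate:
  assumes H: "hs_le H a" and e: "\<epsilon> > 0"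
  obtains D where "finite D" "hs_le (\<lambda>k i. if (k, i) \<in> D then 0 else H k i) \<epsilon>"
proof -
  let ?S = "\<lambda>D. \<Sum>(k, i)\<in>D. (cmod (H k i))\<^sup>2"
  define s where "s = (SUP D\<in>{D. finite D}. ?S D)"
  have bdd: "bdd_above (?S ` {D. finite D})"
    using hs_leD[OF H] by (intro bdd_aboveI2[of _ _ "a\<^sup>2"]) auto
  have lt: "s - \<epsilon>\<^sup>2 < s" using e by simp
  have ne: "{D :: ('a \<times> 'b) set. finite D} \<noteq> {}" by auto
  have "\<exists>D\<in>{D. finite D}. s - \<epsilon>\<^sup>2 < ?S D"
    using less_cSUP_iff[OF ne bdd, of "s - \<epsilon>\<^sup>2"] lt unfolding s_def[symmetric] by simp
  then obtain D where D: "finite D" "s - \<epsilon>\<^sup>2 < ?S D" by blast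
  have "(\<Sum>(k, i)\<in>K. (cmod (if (k, i) \<in> D then 0 else H k i))\<^sup>2) \<le> \<epsilon>\<^sup>2" if K: "finite K" for K
  proof -
    have "(\<Sum>(k, i)\<in>K. (cmod (if (k, i) \<in> D then 0 else H k i))\<^sup>2) =
        (\<Sum>(k, i)\<in>K - D. (cmod (if (k, i) \<in> D then 0 else H k i))\<^sup>2)"
      using K by (intro sum.mono_neutral_right) auto
    also have "\<dots> = ?S (K - D)" by (intro sum.cong) auto
    also have "?S (K - D) + ?S D = ?S ((K - D) \<union> D)"
      using K D by (intro sum.union_disjoint[symmetric]) auto
    then have "?S (K - D) = ?S ((K - D) \<union> D) - ?S D" by simp
    also have "?S ((K - D) \<union> D) \<le> s"
      unfolding s_def using K D by (intro cSUP_upper[OF _ bdd]) auto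
    then have "?S ((K - D) \<union> D) - ?S D \<le> \<epsilon>\<^sup>2" using D(2) by linarith
    finally show ?thesis .
  qed
  then have "hs_le (\<lambda>k i. if (k, i) \<in> D then 0 else H k i) \<epsilon>" using e by (simp add: hs_le_def)
  then show ?thesis using that D(1) by blast
qed

text \<open>Cut each factor into finitely many entries (\<open>H1\<close>, \<open>G1\<close>) and a
  rest that is small in the Hilbert-Schmidt norm (\<open>H0\<close>, \<open>G0\<close>). The product
  of the finite parts lives in a fixed corner; the remaining two terms are small in the trace norm,
  uniformly in n.\<close>

lemma cornered_hs_prod:
  fixes H G :: "'k \<Rightarrow> nat \<times> 'n::finite \<Rightarrow> complex"
  assumes H: "hs_le H a" and G: "hs_le G b"
  shows "cornered (\<lambda>n i j. hs_prod H G (side n s i) (side n s' j))"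
  unfolding cornered_def
proof (intro allI impI)
  fix \<epsilon> :: real assume e: "\<epsilon> > 0"
  have ab: "a \<ge> 0" "b \<ge> 0" using H G hs_le_nonneg by auto
  define \<delta> where "\<delta> = \<epsilon> / (a + b + 1)"
  have \<delta>: "\<delta> > 0" "\<delta> * b + a * \<delta> \<le> \<epsilon>"
  proof -
    show "\<delta> > 0" using e ab by (simp add: \<delta>_def)
    then have "\<delta> * b + a * \<delta> \<le> \<delta> * (a + b + 1)" by (simp add: algebra_simps)
    also have "\<dots> = \<epsilon>" using ab by (simp add: \<delta>_def)
    finally show "\<delta> * b + a * \<delta> \<le> \<epsilon>" .
  qed
  obtain D where D: "finite D" "hs_le (\<lambda>k i. if (k, i) \<in> D then 0 else H k i) \<delta>"
    by (rule hs_truncate[OF H \<delta>(1)])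
  obtain D' where D': "finite D'" "hs_le (\<lambda>k i. if (k, i) \<in> D' then 0 else G k i) \<delta>"
    by (rule hs_truncate[OF G \<delta>(1)])
  define H0 where "H0 = (\<lambda>k i. if (k, i) \<in> D then 0 else H k i)"
  define H1 where "H1 = (\<lambda>k i. if (k, i) \<in> D then H k i else 0)"
  define G0 where "G0 = (\<lambda>k i. if (k, i) \<in> D' then 0 else G k i)"
  define G1 where "G1 = (\<lambda>k i. if (k, i) \<in> D' then G k i else 0)"
  have h0: "hs_le H0 \<delta>" and g0: "hs_le G0 \<delta>" using D D' by (simp_all add: H0_def G0_def)
  have h1: "hs_le H1 a" by (rule hs_le_sub[OF H]) (simp add: H1_def)
  have g1: "hs_le G1 b" by (rule hs_le_sub[OF G]) (simp add: G1_def)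
  have split: "hs_prod H G i j = hs_prod H0 G i j + hs_prod H1 G0 i j + hs_prod H1 G1 i j" for i j
  proof -
    have "(\<lambda>k. H k i * G k j) = (\<lambda>k. (H0 k i * G k j + H1 k i * G0 k j) + H1 k i * G1 k j)"
      by (auto simp: fun_eq_iff H0_def H1_def G0_def G1_def)
    then show ?thesis
      unfolding hs_prod_def
      by (simp add: infsum_add summable_on_add hs_prod_summable[OF h0 G] hs_prod_summable[OF h1 g0]
          hs_prod_summable[OF h1 g1])
  qed
  define y where "y t t' i j = (if t = s \<and> t' = s' then hs_prod H1 G1 i j else 0)" for t t' i j
  have cy: "corner y n i j = hs_prod H1 G1 (side n s i) (side n s' j)" for n i j
    unfolding corner_def y_def by (cases s; cases s') (simp_all add: UNIV_bool)
  define m where "m = Suc (Max (insert 0 (fst ` snd ` (D \<union> D'))))"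
  have m: "fst i < m" if "(k, i) \<in> D \<union> D'" for k i
  proof -
    have "fst i \<in> fst ` snd ` (D \<union> D')" using that by force
    then have "fst i \<le> Max (insert 0 (fst ` snd ` (D \<union> D')))" using D D' by (intro Max_ge) auto
    then show ?thesis by (simp add: m_def)
  qed
  have "fsupp m y"
    unfolding fsupp_def
  proof (intro allI impI)
    fix t t' i j assume "y t t' i j \<noteq> 0"
    then have "hs_prod H1 G1 i j \<noteq> 0" by (auto simp: y_def split: if_splits)
    then obtain k where "H1 k i * G1 k j \<noteq> 0"
      unfolding hs_prod_def by (metis (mono_tags, lifting) infsum_0)
    then have "(k, i) \<in> D" "(k, j) \<in> D'" by (auto simp: H1_def G1_def split: if_splits)
    then show "fst i < m \<and> fst j < m" using m by blast
  qed
  moreover have "nuc_le (block_idx n) (\<lambda>i j. hs_prod H G (side n s i) (side n s' j) - corner y n i j) \<epsilon>" for n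
  proof -
    have "nuc_le (block_idx n) (\<lambda>i j. hs_prod H0 G (side n s i) (side n s' j) +
        hs_prod H1 G0 (side n s i) (side n s' j)) (\<delta> * b + a * \<delta>)"
      by (intro nuc_le_add hs_prod_nuc_le h0 G h1 g0 inj_on_side) auto
    then show ?thesis using nuc_le_mono[OF _ \<delta>(2)] by (simp add: split cy)
  qed
  ultimately show "\<exists>m y. fsupp m y \<and> (\<forall>\<^sub>F n in sequentially.
      nuc_le (block_idx n) (\<lambda>i j. hs_prod H G (side n s i) (side n s' j) - corner y n i j) \<epsilon>)"
    by (intro exI[of _ m] exI[of _ y]) simp
qed

section \<open>Toeplitz matrices\<close>

definition toep :: "wsym ^ 'n ^ 'n::finite \<Rightarrow> (nat \<times> 'n) matrix" where
  "toep S = (\<lambda>(j, \<alpha>) (k, \<beta>). coef (S $ \<alpha> $ \<beta>) (int j - int k))"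

lemma toeplitz_eq_toep:
  assumes "a \<in> BM_alg"
  shows "toeplitz a = toep (msym a)"
  using assms by (auto simp: toeplitz_def toep_def msym_def coef_sym BM_alg_def fun_eq_iff)

lemma toep_one: "toep (mat 1) = idm"
  by (auto simp: toep_def idm_def coef_mat1 fun_eq_iff)

lemma toep_diff: "toep (S - S') i j = toep S i j - toep S' i j"
  by (cases i; cases j) (simp add: toep_def)

lemma sum_entries_le:
  "(\<Sum>\<beta>\<in>UNIV. norm (S $ \<alpha> $ \<beta>)) \<le> real CARD('n) * norm (S :: 'a::real_normed_vector ^ 'n ^ 'n)"
  "(\<Sum>\<beta>\<in>UNIV. norm (S $ \<beta> $ \<alpha>)) \<le> real CARD('n) * norm (S :: 'a::real_normed_vector ^ 'n ^ 'n)"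
  using sum_bounded_above[of UNIV "\<lambda>\<beta>. norm (S $ \<alpha> $ \<beta>)" "norm S"]
    sum_bounded_above[of UNIV "\<lambda>\<beta>. norm (S $ \<beta> $ \<alpha>)" "norm S"] norm_entry_le[of S]
  by auto

lemma sum_block_idx:
  "(\<Sum>i\<in>block_idx n. f i) = (\<Sum>\<alpha>\<in>(UNIV::'n::finite set). \<Sum>k<n. f (k, \<alpha>))"
proof -
  have "(\<Sum>i\<in>block_idx n. f i) = (\<Sum>k<n. \<Sum>\<alpha>\<in>UNIV. f (k, \<alpha>))"
    by (simp add: block_idx_def sum.cartesian_product')
  also have "\<dots> = (\<Sum>\<alpha>\<in>UNIV. \<Sum>k<n. f (k, \<alpha>))" by (rule sum.swap)
  finally show ?thesis .
qed

lemma toep_row_sums: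
  fixes S :: "wsym ^ 'n ^ 'n::finite"
  shows "(\<Sum>j\<in>block_idx n. cmod (toep S i j)) \<le> real CARD('n) * norm S"
    and "(\<Sum>j\<in>block_idx n. cmod (toep S j i)) \<le> real CARD('n) * norm S"
proof -
  have le: "(\<Sum>k<n. cmod (coef w (g k))) \<le> norm w" if "inj_on g {..<n}" for w and g :: "nat \<Rightarrow> int"
  proof -
    have "(\<Sum>k<n. cmod (coef w (g k))) = (\<Sum>k\<in>g ` {..<n}. cmod (coef w k))"
      using that by (simp add: sum.reindex)
    also have "\<dots> \<le> (\<Sum>\<^sub>\<infinity>k. cmod (coef w k))" by (intro sum_coef_le) auto
    finally show ?thesis using infsum_coef_le_norm[of w] by linarith
  qed
  obtain p \<alpha> where i: "i = (p, \<alpha>)" by (cases i)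
  have "(\<Sum>j\<in>block_idx n. cmod (toep S i j)) = (\<Sum>\<beta>\<in>UNIV. \<Sum>k<n. cmod (coef (S $ \<alpha> $ \<beta>) (int p - int k)))"
    by (simp add: sum_block_idx toep_def i)
  also have "\<dots> \<le> (\<Sum>\<beta>\<in>UNIV. norm (S $ \<alpha> $ \<beta>))"
    by (intro sum_mono le) (auto simp: inj_on_def)
  also have "\<dots> \<le> real CARD('n) * norm S" by (rule sum_entries_le)
  finally show "(\<Sum>j\<in>block_idx n. cmod (toep S i j)) \<le> real CARD('n) * norm S" .
  have "(\<Sum>j\<in>block_idx n. cmod (toep S j i)) = (\<Sum>\<beta>\<in>UNIV. \<Sum>k<n. cmod (coef (S $ \<beta> $ \<alpha>) (int k - int p)))"
    by (simp add: sum_block_idx toep_def i)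
  also have "\<dots> \<le> (\<Sum>\<beta>\<in>UNIV. norm (S $ \<beta> $ \<alpha>))"
    by (intro sum_mono le) (auto simp: inj_on_def)
  also have "\<dots> \<le> real CARD('n) * norm S" by (rule sum_entries_le)
  finally show "(\<Sum>j\<in>block_idx n. cmod (toep S j i)) \<le> real CARD('n) * norm S" .
qed

text \<open>Schur's test: give one square root of each entry to either vector and apply
  Cauchy-Schwarz over pairs of indices. For Toeplitz matrices the row and column sums are controlled
  by the l1 part of the norm, independently of n.\<close>

lemma op_le_schur:
  assumes b: "b \<ge> 0" and row: "\<And>i. i \<in> F \<Longrightarrow> (\<Sum>j\<in>F. cmod (Z i j)) \<le> b"
    and col: "\<And>j. j \<in> F \<Longrightarrow> (\<Sum>i\<in>F. cmod (Z i j)) \<le> b"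
  shows "op_le F Z b"
  unfolding op_le_def
proof (intro conjI allI)
  fix x y
  let ?u = "\<lambda>(i, j). sqrt (cmod (Z i j)) * cmod (x i)"
  let ?v = "\<lambda>(i, j). sqrt (cmod (Z i j)) * cmod (y j)"
  have u: "L2_set ?u (F \<times> F) \<le> sqrt b * l2n F x"
  proof -
    have "(\<Sum>p\<in>F \<times> F. (?u p)\<^sup>2) = (\<Sum>i\<in>F. (\<Sum>j\<in>F. cmod (Z i j)) * (cmod (x i))\<^sup>2)"
      by (simp add: sum.cartesian_product[symmetric] case_prod_unfold power_mult_distrib sum_distrib_right
          sum.cartesian_product')
    also have "\<dots> \<le> (\<Sum>i\<in>F. b * (cmod (x i))\<^sup>2)"
      using row by (intro sum_mono mult_right_mono) auto
    also have "\<dots> = b * (l2n F x)\<^sup>2" by (simp add: l2n_sq sum_distrib_left)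
    finally have "sqrt (\<Sum>p\<in>F \<times> F. (?u p)\<^sup>2) \<le> sqrt (b * (l2n F x)\<^sup>2)" by (rule real_sqrt_le_mono)
    then show ?thesis by (simp add: L2_set_def real_sqrt_mult)
  qed
  have v: "L2_set ?v (F \<times> F) \<le> sqrt b * l2n F y"
  proof -
    have "(\<Sum>p\<in>F \<times> F. (?v p)\<^sup>2) = (\<Sum>j\<in>F. (\<Sum>i\<in>F. cmod (Z i j)) * (cmod (y j))\<^sup>2)"
      by (simp add: sum.cartesian_product[symmetric] case_prod_unfold power_mult_distrib sum_distrib_right
          sum.cartesian_product') (rule sum.swap)
    also have "\<dots> \<le> (\<Sum>j\<in>F. b * (cmod (y j))\<^sup>2)"
      using col by (intro sum_mono mult_right_mono) auto
    also have "\<dots> = b * (l2n F y)\<^sup>2" by (simp add: l2n_sq sum_distrib_left)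
    finally have "sqrt (\<Sum>p\<in>F \<times> F. (?v p)\<^sup>2) \<le> sqrt (b * (l2n F y)\<^sup>2)" by (rule real_sqrt_le_mono)
    then show ?thesis by (simp add: L2_set_def real_sqrt_mult)
  qed
  have "cmod (\<Sum>i\<in>F. \<Sum>j\<in>F. x i * Z i j * y j) \<le> (\<Sum>i\<in>F. \<Sum>j\<in>F. cmod (x i * Z i j * y j))"
    by (intro order_trans[OF norm_sum] sum_mono norm_sum)
  also have "\<dots> = (\<Sum>p\<in>F \<times> F. \<bar>?u p\<bar> * \<bar>?v p\<bar>)"
  proof -
    have "cmod (x i * Z i j * y j) = \<bar>?u (i, j)\<bar> * \<bar>?v (i, j)\<bar>" for i j
    proof -
      have "cmod (Z i j) = sqrt (cmod (Z i j)) * sqrt (cmod (Z i j))" by simp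
      then show ?thesis by (simp add: norm_mult abs_mult mult_ac)
    qed
    then show ?thesis by (simp add: sum.cartesian_product')
  qed
  also have "\<dots> \<le> L2_set ?u (F \<times> F) * L2_set ?v (F \<times> F)" by (rule L2_set_mult_ineq)
  also have "\<dots> \<le> (sqrt b * l2n F x) * (sqrt b * l2n F y)"
    using b by (intro mult_mono u v) (auto simp: L2_set_nonneg)
  also have "\<dots> = b * l2n F x * l2n F y" using b by (simp add: mult_ac)
  finally show "cmod (\<Sum>i\<in>F. \<Sum>j\<in>F. x i * Z i j * y j) \<le> b * l2n F x * l2n F y" .
qed (rule b)

lemma op_le_toep: "op_le (block_idx n) (toep S) (real CARD('n) * norm (S :: wsym ^ 'n ^ 'n::finite))"
  by (intro op_le_schur toep_row_sums) auto

lemma hs_le_finite: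
  assumes "finite {(k, i). H k i \<noteq> 0}"
  shows "\<exists>a. hs_le H a"
proof -
  let ?E = "{(k, i). H k i \<noteq> 0}"
  let ?s = "\<Sum>(k, i)\<in>?E. (cmod (H k i))\<^sup>2"
  have s0: "?s \<ge> 0" by (intro sum_nonneg) auto
  have "(\<Sum>(k, i)\<in>D. (cmod (H k i))\<^sup>2) \<le> (sqrt ?s)\<^sup>2" if D: "finite D" for D
  proof -
    have "(\<Sum>(k, i)\<in>D. (cmod (H k i))\<^sup>2) = (\<Sum>(k, i)\<in>D \<inter> ?E. (cmod (H k i))\<^sup>2)"
      using D by (intro sum.mono_neutral_right) auto
    also have "\<dots> \<le> ?s" using assms by (intro sum_mono2) auto
    finally show ?thesis using s0 by simp
  qed
  then show ?thesis using s0 by (intro exI[of _ "sqrt ?s"]) (simp add: hs_le_def)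
qed

text \<open>On each of the finitely many nonzero rows the l2 norm is at most the l1 norm.\<close>

lemma hs_le_finite_rows:
  fixes G :: "nat \<times> 'n::finite \<Rightarrow> nat \<times> 'n \<Rightarrow> complex"
  assumes zero: "\<And>k i. k \<notin> block_idx m \<Longrightarrow> G k i = 0"
    and row: "\<And>k n. (\<Sum>i\<in>block_idx n. cmod (G k i)) \<le> b"
  shows "\<exists>a. hs_le G a"
proof -
  have b: "b \<ge> 0" using row[where n = 0] by (simp add: block_idx_def)
  let ?B = "block_idx m :: (nat \<times> 'n) set"
  let ?s = "real (card ?B) * b\<^sup>2"
  have "(\<Sum>(k, i)\<in>D. (cmod (G k i))\<^sup>2) \<le> (sqrt ?s)\<^sup>2" if D: "finite D" for D
  proof -
    define n where "n = Suc (Max (insert 0 (fst ` snd ` D)))"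
    have n: "snd p \<in> block_idx n" if "p \<in> D" for p
    proof -
      have "fst (snd p) \<le> Max (insert 0 (fst ` snd ` D))" using that D by (intro Max_ge) auto
      then show ?thesis by (simp add: n_def mem_block_idx')
    qed
    have "(\<Sum>(k, i)\<in>D. (cmod (G k i))\<^sup>2) = (\<Sum>(k, i)\<in>D \<inter> (?B \<times> block_idx n). (cmod (G k i))\<^sup>2)"
      using D n zero by (intro sum.mono_neutral_right) force+
    also have "\<dots> \<le> (\<Sum>(k, i)\<in>?B \<times> block_idx n. (cmod (G k i))\<^sup>2)"
      by (intro sum_mono2) auto
    also have "\<dots> = (\<Sum>k\<in>?B. \<Sum>i\<in>block_idx n. (cmod (G k i))\<^sup>2)" by (simp add: sum.cartesian_product')
    also have "\<dots> \<le> (\<Sum>k\<in>?B. b\<^sup>2)"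
    proof (rule sum_mono)
      fix k
      have "(\<Sum>i\<in>block_idx n. (cmod (G k i))\<^sup>2) \<le> (\<Sum>i\<in>block_idx n. cmod (G k i))\<^sup>2"
        using L2_set_le_sum[of "block_idx n" "\<lambda>i. cmod (G k i)"]
        by (simp add: L2_set_def sqrt_le_D)
      also have "\<dots> \<le> b\<^sup>2" using row by (intro power_mono) (auto intro: sum_nonneg)
      finally show "(\<Sum>i\<in>block_idx n. (cmod (G k i))\<^sup>2) \<le> b\<^sup>2" .
    qed
    also have "\<dots> = (sqrt ?s)\<^sup>2" by simp
    finally show ?thesis .
  qed
  then show ?thesis by (intro exI[of _ "sqrt ?s"]) (simp add: hs_le_def)
qed

text \<open>The product is no longer finitely supported, but it is again a Hilbert-Schmidt product:
  the inner index runs through the finite corner, and the finitely many Toeplitz rows that are met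
  are square summable.\<close>

lemma cornered_corner_mmul_toep:
  fixes b :: "wsym ^ 'n ^ 'n::finite"
  assumes y: "fsupp m y"
  shows "cornered (\<lambda>n. mmul (block_idx n) (corner y n) (toep b))"
proof -
  \<comment> \<open>The Toeplitz rows seen from the end \<open>s\<close>: reflecting both indices
    reverses the sign of their difference. Rows outside the corner are cut off to obtain a
    Hilbert-Schmidt factor.\<close>
  define G :: "bool \<Rightarrow> nat \<times> 'n \<Rightarrow> nat \<times> 'n \<Rightarrow> complex" where
    "G s l k = (if l \<in> block_idx m
       then coef (b $ snd l $ snd k) (if s then int (fst k) - int (fst l) else int (fst l) - int (fst k)) else 0)" for s l k
  have hs_ex: "\<exists>a. hs_le (\<lambda>l i. y s s' i l) a" for s s'
  proof (rule hs_le_finite)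
    have "fst l < m \<and> fst i < m" if "y s s' i l \<noteq> 0" for l i
      using y that unfolding fsupp_def by blast
    then have "{(l, i). y s s' i l \<noteq> 0} \<subseteq> block_idx m \<times> block_idx m"
      by (auto simp: mem_block_idx')
    then show "finite {(l, i). y s s' i l \<noteq> 0}" by (rule finite_subset) simp
  qed
  have G: "\<exists>a. hs_le (G s) a" for s
  proof (rule hs_le_finite_rows)
    show "G s k i = 0" if "k \<notin> block_idx m" for k i using that by (simp add: G_def)
    have "(\<Sum>i\<in>block_idx n. cmod (G s k i)) \<le> real CARD('n) * norm b" for k n
    proof (cases "k \<in> block_idx m")
      case True
      obtain p \<gamma> where k: "k = (p, \<gamma>)" by (cases k)
      have "(\<Sum>q<n. cmod (coef (b $ \<gamma> $ \<beta>) (if s then int q - int p else int p - int q))) \<le> norm (b $ \<gamma> $ \<beta>)" for \<beta>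
      proof -
        let ?g = "\<lambda>q. if s then int q - int p else int p - int q"
        have "(\<Sum>q<n. cmod (coef (b $ \<gamma> $ \<beta>) (?g q))) = (\<Sum>q\<in>?g ` {..<n}. cmod (coef (b $ \<gamma> $ \<beta>) q))"
          by (subst sum.reindex) (auto simp: inj_on_def)
        also have "\<dots> \<le> (\<Sum>\<^sub>\<infinity>q. cmod (coef (b $ \<gamma> $ \<beta>) q))" by (intro sum_coef_le) auto
        finally show ?thesis using infsum_coef_le_norm[of "b $ \<gamma> $ \<beta>"] by linarith
      qed
      then have "(\<Sum>i\<in>block_idx n. cmod (G s k i)) \<le> (\<Sum>\<beta>\<in>UNIV. norm (b $ \<gamma> $ \<beta>))"
        unfolding sum_block_idx using True by (intro sum_mono) (simp add: G_def k cong: if_cong)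
      then show ?thesis using sum_entries_le(1)[of b \<gamma>] by linarith
    qed (simp add: G_def)
    then show "(\<Sum>i\<in>block_idx n. cmod (G s k i)) \<le> real CARD('n) * norm b" for k n .
  qed
  have corn: "cornered (\<lambda>n i j. \<Sum>s\<in>UNIV. \<Sum>s'\<in>UNIV. hs_prod (\<lambda>l i. y s s' i l) (G s') (side n s i) (side n s' j))"
  proof (intro cornered_sum)
    fix s s'
    obtain a c where "hs_le (\<lambda>l i. y s s' i l) a" "hs_le (G s') c" using hs_ex G by meson
    then show "cornered (\<lambda>n i j. hs_prod (\<lambda>l i. y s s' i l) (G s') (side n s i) (side n s' j))"
      by (rule cornered_hs_prod)
  qed
  have eq: "(\<Sum>s\<in>UNIV. \<Sum>s'\<in>UNIV. hs_prod (\<lambda>l i. y s s' i l) (G s') (side n s i) (side n s' j)) =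
      mmul (block_idx n) (corner y n) (toep b) i j"
    if n: "n \<ge> m" and i: "i \<in> block_idx n" and j: "j \<in> block_idx n" for n i j
  proof -
    have "hs_prod (\<lambda>l i. y s s' i l) (G s') (side n s i) (side n s' j) =
        (\<Sum>l\<in>block_idx n. y s s' (side n s i) (side n s' l) * toep b l j)" for s s'
    proof -
      have "hs_prod (\<lambda>l i. y s s' i l) (G s') (side n s i) (side n s' j) =
          (\<Sum>\<^sub>\<infinity>l\<in>block_idx n. y s s' (side n s i) l * G s' l (side n s' j))"
        unfolding hs_prod_def using n by (intro infsum_cong_neutral) (auto simp: G_def mem_block_idx')
      also have "\<dots> = (\<Sum>l\<in>block_idx n. y s s' (side n s i) l * G s' l (side n s' j))" by simp
      also have "\<dots> = (\<Sum>l\<in>block_idx n. y s s' (side n s i) (side n s' l) * G s' (side n s' l) (side n s' j))"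
        by (rule sum.reindex_bij_betw[OF bij_side, symmetric])
      also have "\<dots> = (\<Sum>l\<in>block_idx n. y s s' (side n s i) (side n s' l) * toep b l j)"
      proof (rule sum.cong[OF refl])
        fix l :: "nat \<times> 'n" assume l: "l \<in> block_idx n"
        show "y s s' (side n s i) (side n s' l) * G s' (side n s' l) (side n s' j) =
            y s s' (side n s i) (side n s' l) * toep b l j"
        proof (cases "y s s' (side n s i) (side n s' l) = 0")
          case False
          then have "fst (side n s' l) < m" using y unfolding fsupp_def by blast
          then have "G s' (side n s' l) (side n s' j) = toep b l j"
            using l j by (cases l; cases j) (auto simp: G_def mem_block_idx' side_def toep_def of_nat_diff)
          then show ?thesis by simp
        qed simp
      qed
      finally show ?thesis .
    qed
    then have "(\<Sum>s\<in>UNIV. \<Sum>s'\<in>UNIV. hs_prod (\<lambda>l i. y s s' i l) (G s') (side n s i) (side n s' j)) =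
        (\<Sum>s\<in>UNIV. \<Sum>s'\<in>UNIV. \<Sum>l\<in>block_idx n. y s s' (side n s i) (side n s' l) * toep b l j)" by simp
    also have "\<dots> = (\<Sum>l\<in>block_idx n. \<Sum>s\<in>UNIV. \<Sum>s'\<in>UNIV. y s s' (side n s i) (side n s' l) * toep b l j)"
      by (simp add: UNIV_bool sum.distrib)
    also have "\<dots> = mmul (block_idx n) (corner y n) (toep b) i j"
      unfolding mmul_def corner_def by (intro sum.cong refl) (simp add: sum_distrib_right)
    finally show ?thesis .
  qed
  show ?thesis
  proof (rule cornered_cong[OF corn])
    show "\<forall>\<^sub>F n in sequentially. \<forall>i\<in>block_idx n. \<forall>j\<in>block_idx n.
        (\<Sum>s\<in>UNIV. \<Sum>s'\<in>UNIV. hs_prod (\<lambda>l i. y s s' i l) (G s') (side n s i) (side n s' j)) =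
        mmul (block_idx n) (corner y n) (toep b) i j"
      using eventually_ge_at_top[of m] by eventually_elim (intro ballI eq)
  qed
qed

text \<open>The Toeplitz matrices of \<open>b\<close> have operator norms bounded independently of
  n, so the approximation by corners survives the multiplication.\<close>

lemma cornered_mmul_toep:
  fixes b :: "wsym ^ 'n ^ 'n::finite"
  assumes X: "cornered X"
  shows "cornered (\<lambda>n. mmul (block_idx n) (X n) (toep b))"
proof (rule cornered_closure)
  fix \<epsilon> :: real assume e: "\<epsilon> > 0"
  define \<beta> where "\<beta> = real CARD('n) * norm b"
  have \<beta>: "\<beta> \<ge> 0" by (simp add: \<beta>_def)
  have "\<epsilon> / (\<beta> + 1) > 0" using e \<beta> by simp
  then obtain m y where y: "fsupp m y"
    and 1: "\<forall>\<^sub>F n in sequentially. nuc_le (block_idx n) (\<lambda>i j. X n i j - corner y n i j) (\<epsilon> / (\<beta> + 1))"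
    using X unfolding cornered_def by meson
  have "\<forall>\<^sub>F n in sequentially. nuc_le (block_idx n) (\<lambda>i j. mmul (block_idx n) (X n) (toep b) i j -
      mmul (block_idx n) (corner y n) (toep b) i j) \<epsilon>"
    using 1
  proof eventually_elim
    case (elim n)
    have "\<epsilon> / (\<beta> + 1) * \<beta> = \<epsilon> * (\<beta> / (\<beta> + 1))" by simp
    also have "\<dots> \<le> \<epsilon> * 1" using e \<beta> by (intro mult_left_mono div_add_one_le_one) auto
    finally have "\<epsilon> / (\<beta> + 1) * \<beta> \<le> \<epsilon>" by simp
    from nuc_le_mono[OF nuc_le_mmul[OF elim op_le_toep[of n b, folded \<beta>_def]] this]
    have "nuc_le (block_idx n) (mmul (block_idx n) (\<lambda>i j. X n i j - corner y n i j) (toep b)) \<epsilon>" .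
    then show ?case
      by (rule nuc_le_cong[THEN iffD1, rotated]) (simp add: mmul_def left_diff_distrib sum_subtractf)
  qed
  then show "\<exists>X'. cornered X' \<and> (\<forall>\<^sub>F n in sequentially.
      nuc_le (block_idx n) (\<lambda>i j. mmul (block_idx n) (X n) (toep b) i j - X' n i j) \<epsilon>)"
    using cornered_corner_mmul_toep[OF y] by blast
qed

subsection \<open>Widom's formula\<close>

text \<open>An infinite Hankel matrix contains its p-th coefficient once for each l < p, thus p
  times. This is the reason for the weight |k| in the norm of the algebra.\<close>

lemma sum_hankel_le:
  fixes g :: "nat \<Rightarrow> real"
  assumes g: "\<And>p. g p \<ge> 0"
  shows "(\<Sum>l<m. \<Sum>j<m. g (j + l + 1)) \<le> (\<Sum>p=1..2*m. real p * g p)"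
proof -
  have "(\<Sum>l<m. \<Sum>j<m. g (j + l + 1)) \<le> (\<Sum>l<m. \<Sum>p=1..2*m. if l < p then g p else 0)"
  proof (rule sum_mono)
    fix l assume l: "l \<in> {..<m}"
    have "(\<Sum>j<m. g (j + l + 1)) = (\<Sum>p\<in>(\<lambda>j. j + l + 1) ` {..<m}. g p)"
      by (subst sum.reindex) (auto simp: inj_on_def)
    also have "\<dots> = (\<Sum>p\<in>(\<lambda>j. j + l + 1) ` {..<m}. if l < p then g p else 0)"
      by (intro sum.cong) auto
    also have "\<dots> \<le> (\<Sum>p=1..2*m. if l < p then g p else 0)"
      using l g by (intro sum_mono2) auto
    finally show "(\<Sum>j<m. g (j + l + 1)) \<le> (\<Sum>p=1..2*m. if l < p then g p else 0)" .
  qed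
  also have "\<dots> = (\<Sum>p=1..2*m. \<Sum>l<m. if l < p then g p else 0)" by (rule sum.swap)
  also have "\<dots> \<le> (\<Sum>p=1..2*m. real p * g p)"
  proof (rule sum_mono)
    fix p
    have "(\<Sum>l<m. if l < p then g p else 0) = real (card {l. l < m \<and> l < p}) * g p"
      by (simp add: sum.If_cases Int_def)
    also have "card {l. l < m \<and> l < p} \<le> card {..<p}" by (intro card_mono) auto
    then have "real (card {l. l < m \<and> l < p}) * g p \<le> real p * g p"
      using g by (intro mult_right_mono) auto
    finally show "(\<Sum>l<m. if l < p then g p else 0) \<le> real p * g p" .
  qed
  finally show ?thesis .
qed

lemma hs_le_hankel:
  fixes w :: "'n::finite \<Rightarrow> wsym" and \<epsilon> :: int
  assumes \<epsilon>: "\<epsilon> = 1 \<or> \<epsilon> = -1" and w: "(\<Sum>\<alpha>\<in>UNIV. norm (w \<alpha>)) \<le> a"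
  shows "hs_le (\<lambda>l i. coef (w (snd i)) (\<epsilon> * (int (fst i) + int l + 1))) a"
proof -
  let ?H = "\<lambda>l i. coef (w (snd i)) (\<epsilon> * (int (fst i) + int l + 1))"
  have a: "a \<ge> 0" using w sum_nonneg[of UNIV "\<lambda>\<alpha>. norm (w \<alpha>)"] by simp
  have one: "(\<Sum>l<m. \<Sum>j<m. (cmod (coef v (\<epsilon> * (int j + int l + 1))))\<^sup>2) \<le> (norm v)\<^sup>2" for m v
  proof -
    have "(\<Sum>l<m. \<Sum>j<m. (cmod (coef v (\<epsilon> * (int j + int l + 1))))\<^sup>2) =
        (\<Sum>l<m. \<Sum>j<m. (\<lambda>p. (cmod (coef v (\<epsilon> * int p)))\<^sup>2) (j + l + 1))" by (simp add: algebra_simps)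
    also have "\<dots> \<le> (\<Sum>p=1..2*m. real p * (cmod (coef v (\<epsilon> * int p)))\<^sup>2)"
      by (rule sum_hankel_le) simp
    also have "\<dots> = (\<Sum>k\<in>(\<lambda>p. \<epsilon> * int p) ` {1..2*m}. \<bar>real_of_int k\<bar> * (cmod (coef v k))\<^sup>2)"
      using \<epsilon> by (subst sum.reindex) (auto simp: inj_on_def)
    also have "\<dots> \<le> (\<Sum>\<^sub>\<infinity>k. \<bar>real_of_int k\<bar> * (cmod (coef v k))\<^sup>2)"
      by (intro finite_sum_le_infsum coef_weighted_summable) auto
    also have "\<dots> \<le> (norm v)\<^sup>2" by (rule coef_weighted_infsum)
    finally show ?thesis .
  qed
  have "(\<Sum>(l, i)\<in>D. (cmod (?H l i))\<^sup>2) \<le> a\<^sup>2" if D: "finite D" for D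
  proof -
    define m where "m = Suc (Max (insert 0 (fst ` D \<union> fst ` snd ` D)))"
    have m: "fst p < m" "fst (snd p) < m" if "p \<in> D" for p
    proof -
      have "fst p \<le> Max (insert 0 (fst ` D \<union> fst ` snd ` D))"
           "fst (snd p) \<le> Max (insert 0 (fst ` D \<union> fst ` snd ` D))"
        using that D by (intro Max_ge; auto)+
      then show "fst p < m" "fst (snd p) < m" by (simp_all add: m_def)
    qed
    have "(\<Sum>(l, i)\<in>D. (cmod (?H l i))\<^sup>2) \<le> (\<Sum>(l, i)\<in>{..<m} \<times> block_idx m. (cmod (?H l i))\<^sup>2)"
      using m by (intro sum_mono2) (force simp: mem_block_idx')+
    also have "\<dots> = (\<Sum>l<m. \<Sum>i\<in>block_idx m. (cmod (?H l i))\<^sup>2)" by (simp add: sum.cartesian_product')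
    also have "\<dots> = (\<Sum>\<alpha>\<in>UNIV. \<Sum>l<m. \<Sum>j<m. (cmod (coef (w \<alpha>) (\<epsilon> * (int j + int l + 1))))\<^sup>2)"
      by (simp add: sum_block_idx) (rule sum.swap)
    also have "\<dots> \<le> (\<Sum>\<alpha>\<in>UNIV. (norm (w \<alpha>))\<^sup>2)" by (intro sum_mono one)
    also have "\<dots> \<le> (\<Sum>\<alpha>\<in>UNIV. norm (w \<alpha>))\<^sup>2"
      using L2_set_le_sum[of UNIV "\<lambda>\<alpha>. norm (w \<alpha>)"] by (simp add: L2_set_def sqrt_le_D)
    also have "\<dots> \<le> a\<^sup>2" using w by (intro power_mono) (auto intro: sum_nonneg)
    finally show ?thesis .
  qed
  then show ?thesis using a by (simp add: hs_le_def)
qed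

definition hankel_row :: "int \<Rightarrow> wsym ^ 'n ^ 'n::finite \<Rightarrow> 'n \<Rightarrow> nat \<Rightarrow> nat \<times> 'n \<Rightarrow> complex" where
  "hankel_row \<epsilon> A \<gamma> l i = coef (A $ snd i $ \<gamma>) (\<epsilon> * (int (fst i) + int l + 1))"

definition hankel_col :: "int \<Rightarrow> wsym ^ 'n ^ 'n::finite \<Rightarrow> 'n \<Rightarrow> nat \<Rightarrow> nat \<times> 'n \<Rightarrow> complex" where
  "hankel_col \<epsilon> C \<gamma> l i = coef (C $ \<gamma> $ snd i) (\<epsilon> * (int (fst i) + int l + 1))"

text \<open>Widom's correction P_n H(A) H(C~) P_n + W_n H(A~) H(C) W_n, where the tilde reverses the
  sign of the indices. The sum over the inner block index \<open>\<gamma>\<close> is kept outside of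
  the scalar Hankel products.\<close>

definition widom :: "wsym ^ 'n ^ 'n::finite \<Rightarrow> wsym ^ 'n ^ 'n \<Rightarrow> nat \<Rightarrow> (nat \<times> 'n) matrix" where
  "widom A C n i j = (\<Sum>\<gamma>\<in>UNIV. hs_prod (hankel_row 1 A \<gamma>) (hankel_col (-1) C \<gamma>) (side n False i) (side n False j)
     + hs_prod (hankel_row (-1) A \<gamma>) (hankel_col 1 C \<gamma>) (side n True i) (side n True j))"

lemma hs_le_hankel_row:
  "\<epsilon> = 1 \<or> \<epsilon> = -1 \<Longrightarrow> hs_le (hankel_row \<epsilon> A \<gamma>) (real CARD('n) * norm (A :: wsym ^ 'n ^ 'n::finite))"
  unfolding hankel_row_def by (intro hs_le_hankel sum_entries_le)

lemma hs_le_hankel_col: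
  "\<epsilon> = 1 \<or> \<epsilon> = -1 \<Longrightarrow> hs_le (hankel_col \<epsilon> A \<gamma>) (real CARD('n) * norm (A :: wsym ^ 'n ^ 'n::finite))"
  unfolding hankel_col_def by (intro hs_le_hankel sum_entries_le)

lemma cornered_widom: "cornered (widom A C)"
  unfolding widom_def
  by (intro cornered_sum cornered_add cornered_hs_prod[OF hs_le_hankel_row hs_le_hankel_col]) auto

lemma nuc_le_sum:
  assumes "finite S" "\<And>k. k \<in> S \<Longrightarrow> nuc_le F (M k) (c k)"
  shows "nuc_le F (\<lambda>i j. \<Sum>k\<in>S. M k i j) (\<Sum>k\<in>S. c k)"
  using assms
proof (induction S)
  case empty
  then show ?case by (simp add: nuc_le_def)
qed (auto intro: nuc_le_add)

lemma nuc_le_widom: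
  fixes A C :: "wsym ^ 'n ^ 'n::finite"
  shows "nuc_le (block_idx n) (widom A C n) (2 * real CARD('n) ^ 3 * norm A * norm C)"
proof -
  let ?N = "real CARD('n)"
  have "nuc_le (block_idx n) (widom A C n)
     (\<Sum>\<gamma>\<in>(UNIV :: 'n set). (?N * norm A) * (?N * norm C) + (?N * norm A) * (?N * norm C))"
    unfolding widom_def
    by (intro nuc_le_sum nuc_le_add hs_prod_nuc_le[OF hs_le_hankel_row hs_le_hankel_col] inj_on_side) auto
  then show ?thesis by (simp add: power3_eq_cube mult_ac)
qed

text \<open>Split the convolution over all integers l: the range from 0 to n - 1 is the matrix
  product, and the two tails, seen from the two ends of the section, are the Hankel
  products.\<close>

lemma toep_mult:
  fixes A C :: "wsym ^ 'n ^ 'n::finite"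
  assumes i: "i \<in> block_idx n" and j: "j \<in> block_idx n"
  shows "mmul (block_idx n) (toep A) (toep C) i j = toep (A ** C) i j - widom A C n i j"
proof -
  obtain p \<alpha> q \<beta> where ij: "i = (p, \<alpha>)" "j = (q, \<beta>)" by (cases i; cases j) auto
  have pq: "p < n" "q < n" using i j by (auto simp: ij)
  have one: "coef (A $ \<alpha> $ \<gamma> * C $ \<gamma> $ \<beta>) (int p - int q) =
      (\<Sum>l<n. coef (A $ \<alpha> $ \<gamma>) (int p - int l) * coef (C $ \<gamma> $ \<beta>) (int l - int q)) +
      hs_prod (hankel_row 1 A \<gamma>) (hankel_col (-1) C \<gamma>) (side n False i) (side n False j) +
      hs_prod (hankel_row (-1) A \<gamma>) (hankel_col 1 C \<gamma>) (side n True i) (side n True j)" for \<gamma>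
  proof -
    define u where "u = A $ \<alpha> $ \<gamma>"
    define v where "v = C $ \<gamma> $ \<beta>"
    define f where "f l = coef u (int p - l) * coef v (l - int q)" for l :: int
    have sf: "f summable_on UNIV"
      using conv_summable[of u v "int p - int q"] unfolding f_def
      by (subst summable_on_reindex_bij_witness[where i = "\<lambda>m. int p - m" and j = "\<lambda>l. int p - l" and T = UNIV
            and h = "\<lambda>m. coef u m * coef v (int p - int q - m)"]) (auto simp: algebra_simps)
    have s: "f summable_on S" for S by (rule summable_on_subset_banach[OF sf]) simp
    have "coef (u * v) (int p - int q) = (\<Sum>\<^sub>\<infinity>l. f l)"
      unfolding coef_mult f_def
      by (rule infsum_reindex_bij_witness[where i = "\<lambda>l. int p - l" and j = "\<lambda>l. int p - l"]) (auto simp: algebra_simps)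
    also have "UNIV = ({0..<int n} \<union> {..<0}) \<union> {int n..}" by auto
    also have "infsum f (({0..<int n} \<union> {..<0}) \<union> {int n..}) = (infsum f {0..<int n} + infsum f {..<0}) + infsum f {int n..}"
      by (subst infsum_Un_disjoint, auto simp: s)+
    also have "infsum f {0..<int n} = (\<Sum>l<n. f (int l))"
      unfolding infsum_finite[OF finite_atLeastLessThan_int]
      by (rule sum.reindex_bij_witness[of _ int nat]) auto
    \<comment> \<open>The tail begins at -1, hence the substitution l -> -1 - l and the summand 1 in
      the index of the Hankel entries.\<close>
    also have "infsum f {..<0} = (\<Sum>\<^sub>\<infinity>l. f (- 1 - int l))"
      by (rule infsum_reindex_bij_witness[where i = "\<lambda>l. - 1 - int l" and j = "\<lambda>k. nat (- 1 - k)"]) auto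
    also have "\<dots> = hs_prod (hankel_row 1 A \<gamma>) (hankel_col (-1) C \<gamma>) (side n False i) (side n False j)"
      unfolding hs_prod_def hankel_row_def hankel_col_def f_def u_def v_def
      by (intro infsum_cong) (simp add: side_def ij algebra_simps)
    also have "infsum f {int n..} = (\<Sum>\<^sub>\<infinity>l. f (int n + int l))"
      by (rule infsum_reindex_bij_witness[where i = "\<lambda>l. int n + int l" and j = "\<lambda>k. nat (k - int n)"]) auto
    also have "\<dots> = hs_prod (hankel_row (-1) A \<gamma>) (hankel_col 1 C \<gamma>) (side n True i) (side n True j)"
      unfolding hs_prod_def hankel_row_def hankel_col_def f_def u_def v_def
      using pq by (intro infsum_cong) (simp add: side_def ij of_nat_diff algebra_simps)
    finally show ?thesis by (simp add: u_def v_def f_def)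
  qed
  have "toep (A ** C) i j = (\<Sum>\<gamma>\<in>UNIV. coef (A $ \<alpha> $ \<gamma> * C $ \<gamma> $ \<beta>) (int p - int q))"
    by (simp add: toep_def ij matrix_matrix_mult_def coef_sum)
  also have "\<dots> = (\<Sum>\<gamma>\<in>UNIV. \<Sum>l<n. coef (A $ \<alpha> $ \<gamma>) (int p - int l) * coef (C $ \<gamma> $ \<beta>) (int l - int q)) + widom A C n i j"
    by (simp add: one widom_def sum.distrib)
  also have "(\<Sum>\<gamma>\<in>UNIV. \<Sum>l<n. coef (A $ \<alpha> $ \<gamma>) (int p - int l) * coef (C $ \<gamma> $ \<beta>) (int l - int q)) =
      mmul (block_idx n) (toep A) (toep C) i j"
    by (simp add: mmul_def sum_block_idx toep_def ij)
  finally show ?thesis by simp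
qed

subsection \<open>Triangular factors\<close>

text \<open>Peel off the last diagonal block. Which off-diagonal block vanishes depends on whether
  \<open>b\<close> is analytic or coanalytic, so the two parts enter
  \<open>fdet_block_triangular\<close> in different orders.\<close>

lemma fdet_toep_triangular:
  fixes b :: "wsym ^ 'n ^ 'n::finite"
  assumes pm: "plusM b \<or> minusM b"
  shows "fdet (block_idx n) (toep b) = det (const_block b) ^ n"
proof (induction n)
  case 0
  have "block_idx 0 = ({} :: (nat \<times> 'n) set)" by (simp add: block_idx_def)
  then show ?case by (simp add: fdet_def)
next
  case (Suc n)
  let ?R = "{n} \<times> (UNIV :: 'n set)"
  have R: "fdet ?R (toep b) = det (const_block b)"
  proof -
    have "fdet ?R (toep b) = fdet UNIV (\<lambda>\<alpha> \<beta>. toep b (n, \<alpha>) (n, \<beta>))"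
      by (intro fdet_reindex) (auto simp: bij_betw_def inj_on_def)
    then show ?thesis by (simp add: fdet_def det_def toep_def const_block_def)
  qed
  have split: "block_idx (Suc n) = block_idx n \<union> ?R" "block_idx (Suc n) = ?R \<union> block_idx n"
    by (auto simp: block_idx_def)
  show ?case
  proof (cases "plusM b")
    case True
    have "fdet (block_idx (Suc n)) (toep b) = fdet (block_idx n) (toep b) * fdet ?R (toep b)"
      unfolding split(1)
    proof (rule fdet_block_triangular)
      fix i j :: "nat \<times> 'n" assume "i \<in> block_idx n" "j \<in> ?R"
      then show "toep b i j = 0" using True by (cases i; cases j) (auto simp: toep_def plusM_def)
    qed auto
    then show ?thesis using Suc R by simp
  next
    case False
    then have m: "minusM b" using pm by simp
    have "fdet (block_idx (Suc n)) (toep b) = fdet ?R (toep b) * fdet (block_idx n) (toep b)"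
      unfolding split(2)
    proof (rule fdet_block_triangular)
      fix i j :: "nat \<times> 'n" assume "i \<in> ?R" "j \<in> block_idx n"
      then show "toep b i j = 0" using m by (cases i; cases j) (auto simp: toep_def minusM_def)
    qed auto
    then show ?thesis using Suc R by simp
  qed
qed

section \<open>Multiplication by the Toeplitz matrices of a list of factors\<close>

primrec tprod :: "nat \<Rightarrow> (nat \<times> 'n) matrix \<Rightarrow> (wsym ^ 'n ^ 'n::finite) list \<Rightarrow> (nat \<times> 'n) matrix" where
  "tprod n M [] = M"
| "tprod n M (b # bs) = tprod n (mmul (block_idx n) M (toep b)) bs"

lemma fdet_tprod:
  assumes "\<forall>b\<in>set bs. triangular1 b"
  shows "fdet (block_idx n) (tprod n M bs) =
    fdet (block_idx n) M * prod_list (map (\<lambda>b. det (const_block b)) bs) ^ n"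
  using assms
proof (induction bs arbitrary: M)
  case (Cons b bs)
  have "plusM b \<or> minusM b" using Cons.prems by (simp add: triangular1_def)
  then show ?case using Cons by (simp add: fdet_mmul fdet_toep_triangular power_mult_distrib)
qed simp

lemma tprod_step:
  assumes "\<And>i j. i \<in> block_idx n \<Longrightarrow> j \<in> block_idx n \<Longrightarrow> M i j = toep S i j + X i j"
    and i: "i \<in> block_idx n" and j: "j \<in> block_idx n"
  shows "mmul (block_idx n) M (toep b) i j =
     toep (S ** b) i j + (mmul (block_idx n) X (toep b) i j - widom S b n i j)"
proof -
  have "mmul (block_idx n) M (toep b) i j = mmul (block_idx n) (toep S) (toep b) i j + mmul (block_idx n) X (toep b) i j"
    using assms by (simp add: mmul_def distrib_right sum.distrib)
  then show ?thesis using toep_mult[OF i j, of S b] by simp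
qed

text \<open>A Toeplitz matrix plus a cornered sequence keeps this form under each multiplication:
  the symbols multiply, and the remainder is multiplied and loses a Widom correction, which is
  cornered too.\<close>

lemma tprod_cornered:
  assumes "cornered X" "\<And>n i j. n \<ge> 1 \<Longrightarrow> i \<in> block_idx n \<Longrightarrow> j \<in> block_idx n \<Longrightarrow> M n i j = toep S i j + X n i j"
  shows "\<exists>X'. cornered X' \<and> (\<forall>n\<ge>1. \<forall>i\<in>block_idx n. \<forall>j\<in>block_idx n.
     tprod n (M n) bs i j = toep (S ** lprod bs) i j + X' n i j)"
  using assms
proof (induction bs arbitrary: M S X)
  case Nil
  then show ?case by auto
next
  case (Cons b bs)
  have c: "cornered (\<lambda>n i j. mmul (block_idx n) (X n) (toep b) i j - widom S b n i j)"
    by (intro cornered_diff cornered_mmul_toep Cons.prems(1) cornered_widom)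
  have "mmul (block_idx n) (M n) (toep b) i j =
      toep (S ** b) i j + (mmul (block_idx n) (X n) (toep b) i j - widom S b n i j)"
    if "n \<ge> 1" "i \<in> block_idx n" "j \<in> block_idx n" for n i j
    by (rule tprod_step[OF Cons.prems(2)[OF that(1)] that(2,3)])
  from Cons.IH[OF c this] show ?case by (simp add: matrix_mul_assoc)
qed

text \<open>\<open>N\<close> is the block size, \<open>\<beta>\<close> bounds the factors,
  \<open>\<sigma>\<close> the symbol reached so far and \<open>c\<close> the trace norm of its
  remainder. \<open>N * \<beta>\<close> is the operator bound of one factor, and
  \<open>2 * N ^ 3 * \<sigma> * \<beta>\<close> comes from \<open>nuc_le_widom\<close>. Only the
  number of factors enters besides these bounds, not n or the factors themselves.\<close>

fun tprod_bound :: "real \<Rightarrow> real \<Rightarrow> nat \<Rightarrow> real \<Rightarrow> real \<Rightarrow> real" where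
  "tprod_bound N \<beta> 0 \<sigma> c = c"
| "tprod_bound N \<beta> (Suc r) \<sigma> c = tprod_bound N \<beta> r (\<sigma> * \<beta>) (c * (N * \<beta>) + 2 * N ^ 3 * \<sigma> * \<beta>)"

lemma tprod_nuc_le:
  fixes S :: "wsym ^ 'n ^ 'n::finite"
  assumes "nuc_le (block_idx n) X c" "norm S \<le> \<sigma>" "\<forall>b\<in>set bs. norm b \<le> \<beta>"
    "\<And>i j. i \<in> block_idx n \<Longrightarrow> j \<in> block_idx n \<Longrightarrow> M i j = toep S i j + X i j"
  shows "nuc_le (block_idx n) (\<lambda>i j. tprod n M bs i j - toep (S ** lprod bs) i j)
     (tprod_bound (real CARD('n)) \<beta> (length bs) \<sigma> c)"
  using assms
proof (induction bs arbitrary: M S X \<sigma> c)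
  case Nil
  show ?case using Nil(1) by (simp, rule nuc_le_cong[THEN iffD1, rotated]) (use Nil(4) in auto)
next
  case (Cons b bs)
  let ?N = "real CARD('n)"
  let ?X = "\<lambda>i j. mmul (block_idx n) X (toep b) i j - widom S b n i j"
  have b: "norm b \<le> \<beta>" using Cons.prems by simp
  have \<sigma>: "0 \<le> \<sigma>" using Cons.prems(2) norm_ge_zero order_trans by blast
  have c: "0 \<le> c" by (rule nuc_le_nonneg[OF Cons.prems(1)])
  have "nuc_le (block_idx n) ?X (c * (?N * norm b) + 2 * ?N ^ 3 * norm S * norm b)"
    by (intro nuc_le_diff nuc_le_mmul Cons.prems(1) op_le_toep nuc_le_widom)
  moreover have "c * (?N * norm b) + 2 * ?N ^ 3 * norm S * norm b \<le> c * (?N * \<beta>) + 2 * ?N ^ 3 * \<sigma> * \<beta>"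
    using b c \<sigma> Cons.prems(2) by (intro add_mono mult_left_mono mult_mono) auto
  ultimately have X: "nuc_le (block_idx n) ?X (c * (?N * \<beta>) + 2 * ?N ^ 3 * \<sigma> * \<beta>)"
    by (rule nuc_le_mono)
  have S: "norm (S ** b) \<le> \<sigma> * \<beta>"
    using Cons.prems(2) b \<sigma> by (intro order_trans[OF norm_matrix_mult_le] mult_mono) auto
  have "nuc_le (block_idx n) (\<lambda>i j. tprod n (mmul (block_idx n) M (toep b)) bs i j - toep ((S ** b) ** lprod bs) i j)
      (tprod_bound ?N \<beta> (length bs) (\<sigma> * \<beta>) (c * (?N * \<beta>) + 2 * ?N ^ 3 * \<sigma> * \<beta>))"
  proof (rule Cons.IH[OF X S])
    show "\<forall>b\<in>set bs. norm b \<le> \<beta>" using Cons.prems(3) by simp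
    show "mmul (block_idx n) M (toep b) i j = toep (S ** b) i j + ?X i j"
      if "i \<in> block_idx n" "j \<in> block_idx n" for i j
      by (rule tprod_step[OF Cons.prems(4) that])
  qed
  then show ?case by (simp add: matrix_mul_assoc)
qed

section \<open>Trace class operators\<close>

lemma orthonormal_sum_le:
  assumes u: "orthonormal_seq u" and I: "finite I"
  shows "(\<Sum>i\<in>I. (cmod (u k i))\<^sup>2) \<le> 1"
proof -
  have s: "(\<lambda>i. (cmod (u k i))\<^sup>2) summable_on UNIV" using u by (auto simp: orthonormal_seq_def ell2_def)
  have "of_real (\<Sum>\<^sub>\<infinity>i. (cmod (u k i))\<^sup>2) = ell2_inner (u k) (u k)"
    unfolding ell2_inner_def complex_norm_square[symmetric]
    by (rule infsumI[OF has_sum_of_real[OF has_sum_infsum[OF s]], symmetric])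
  also have "\<dots> = of_real 1" using u by (simp add: orthonormal_seq_def)
  finally have "(\<Sum>\<^sub>\<infinity>i. (cmod (u k i))\<^sup>2) = 1" by (simp only: of_real_eq_iff)
  then show ?thesis using finite_sum_le_infsum[OF s I] by simp
qed

lemma orthonormal_entry_le: "orthonormal_seq u \<Longrightarrow> cmod (u k i) \<le> 1"
  using orthonormal_sum_le[of u "{i}" k] by (simp add: power_le_one_iff abs_square_le_1)

lemma hs_le_weighted_orthonormal:
  assumes u: "orthonormal_seq u" and s: "\<And>k. s k \<ge> 0" "summable s" "suminf s \<le> c"
  shows "hs_le (\<lambda>k i. of_real (sqrt (s k)) * u k i) (sqrt c)"
proof -
  have c: "c \<ge> 0" using suminf_nonneg[OF s(2)] s by (meson order_trans)
  have "(\<Sum>(k, i)\<in>D. (cmod (of_real (sqrt (s k)) * u k i))\<^sup>2) \<le> (sqrt c)\<^sup>2" if D: "finite D" for D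
  proof -
    have "(\<Sum>(k, i)\<in>D. (cmod (of_real (sqrt (s k)) * u k i))\<^sup>2) \<le>
        (\<Sum>(k, i)\<in>fst ` D \<times> snd ` D. (cmod (of_real (sqrt (s k)) * u k i))\<^sup>2)"
      using D by (intro sum_mono2) (auto intro: rev_image_eqI)
    also have "\<dots> = (\<Sum>k\<in>fst ` D. s k * (\<Sum>i\<in>snd ` D. (cmod (u k i))\<^sup>2))"
      using s by (simp add: sum.cartesian_product' norm_mult power_mult_distrib sum_distrib_left)
    also have "\<dots> \<le> (\<Sum>k\<in>fst ` D. s k * 1)"
      using D s by (intro sum_mono mult_left_mono orthonormal_sum_le[OF u]) auto
    also have "\<dots> \<le> suminf s" using D s by (simp add: sum_le_suminf)
    finally show ?thesis using s c by simp
  qed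
  then show ?thesis using c by (simp add: hs_le_def)
qed

text \<open>Each singular value is split as a product of two square roots, one for each orthonormal
  system. The operator becomes a product of two Hilbert-Schmidt factors and falls under the results
  on \<open>hs_prod\<close>. The strict inequality selects an actual expansion from the
  infimum.\<close>

lemma trace_norm_imp_hs:
  assumes K: "trace_norm K < ennreal c"
  obtains H G :: "nat \<Rightarrow> 'i \<Rightarrow> complex"
  where "hs_le H (sqrt c)" "hs_le G (sqrt c)" "\<And>i j. op_matrix K i j = hs_prod H G i j"
proof -
  obtain s where s: "singular_values K s" "(\<Sum>k. ennreal (s k)) < ennreal c"
    using K unfolding trace_norm_def INF_less_iff by auto
  then obtain u v where s0: "\<And>k. s k \<ge> 0" and u: "orthonormal_seq u" and v: "orthonormal_seq v"
    and K: "\<And>x i. x \<in> ell2 \<Longrightarrow> (\<lambda>k. of_real (s k) * ell2_inner x (u k) * v k i) sums K x i"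
    unfolding singular_values_def by blast
  have ss: "summable s"
    using s(2) s0 by (intro summable_suminf_not_top) auto
  have "ennreal (suminf s) < ennreal c" using s(2) suminf_ennreal2[OF s0 ss] by simp
  then have sc: "suminf s \<le> c"
    using suminf_nonneg[OF ss s0] by (simp add: ennreal_less_iff)
  define H where "H k i = of_real (sqrt (s k)) * v k i" for k i
  define G where "G k i = of_real (sqrt (s k)) * cnj (u k i)" for k i
  have "hs_le H (sqrt c)" unfolding H_def by (rule hs_le_weighted_orthonormal[OF v s0 ss sc])
  moreover have "hs_le G (sqrt c)"
    by (rule hs_le_sub[OF hs_le_weighted_orthonormal[OF u s0 ss sc]]) (simp add: G_def norm_mult)
  moreover have "op_matrix K i j = hs_prod H G i j" for i j
  proof -
    let ?e = "\<lambda>l. if l = j then 1 else 0 :: complex"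
    have "?e \<in> ell2"
    proof -
      have "(\<lambda>i. (cmod (?e i))\<^sup>2) summable_on {j}" by simp
      then show ?thesis unfolding ell2_def mem_Collect_eq
        by (rule summable_on_cong_neutral[THEN iffD1, rotated -1]) auto
    qed
    from K[OF this, of i]
    have sums: "(\<lambda>k. of_real (s k) * ell2_inner ?e (u k) * v k i) sums op_matrix K i j"
      by (simp add: op_matrix_def)
    have "ell2_inner ?e (u k) = cnj (u k j)" for k
    proof -
      have "ell2_inner ?e (u k) = (\<Sum>\<^sub>\<infinity>l\<in>{j}. ?e l * cnj (u k l))"
        unfolding ell2_inner_def by (rule infsum_cong_neutral) auto
      then show ?thesis by simp
    qed
    moreover have "complex_of_real (s k) = of_real (sqrt (s k)) * of_real (sqrt (s k))" for k
      using s0[of k] by (simp flip: of_real_mult)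
    ultimately have eq: "of_real (s k) * ell2_inner ?e (u k) * v k i = H k i * G k j" for k
      by (simp add: H_def G_def mult_ac)
    have "summable (\<lambda>k. cmod (H k i * G k j))"
    proof (rule summable_comparison_test'[OF ss])
      fix k :: nat
      have "cmod (H k i * G k j) = s k * (cmod (v k i) * cmod (u k j))"
        using s0[of k] by (simp add: H_def G_def norm_mult mult_ac flip: real_sqrt_mult)
      also have "\<dots> \<le> s k * 1"
        using s0 by (intro mult_left_mono mult_le_one orthonormal_entry_le u v) auto
      finally show "norm (cmod (H k i * G k j)) \<le> s k" by simp
    qed
    then have "((\<lambda>k. H k i * G k j) has_sum op_matrix K i j) UNIV"
      using sums by (intro norm_summable_imp_has_sum) (simp_all add: eq)
    then show ?thesis by (simp add: hs_prod_def infsumI)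
  qed
  ultimately show ?thesis using that by blast
qed

section \<open>Sections of trace class operators at both ends\<close>

lemma op_matrix_P:
  assumes "i \<in> block_idx n" "j \<in> block_idx n"
  shows "op_matrix (P_op n \<circ> K \<circ> P_op n) i j = op_matrix K (side n False i) (side n False j)"
proof -
  have "P_op n (\<lambda>l. if l = j then 1 else 0) = (\<lambda>l. if l = j then 1 else 0)"
    using assms by (auto simp: P_op_def fun_eq_iff)
  then show ?thesis using assms by (cases i) (auto simp: op_matrix_def P_op_def side_def)
qed

lemma op_matrix_W:
  assumes "i \<in> block_idx n" "j \<in> block_idx n"
  shows "op_matrix (W_op n \<circ> K \<circ> W_op n) i j = op_matrix K (side n True i) (side n True j)"
proof -
  have "W_op n (\<lambda>l. if l = j then 1 else 0) = (\<lambda>l. if l = side n True j then 1 else 0)"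
    using assms by (cases j) (auto simp: W_op_def side_def fun_eq_iff)
  then show ?thesis using assms by (cases i) (auto simp: op_matrix_def W_op_def side_def)
qed

lemma op_matrix_matrix_op:
  assumes "i \<in> block_idx n" "j \<in> block_idx n"
  shows "op_matrix (matrix_op n C) i j = C i j"
proof -
  have "(\<Sum>l\<in>block_idx n. C i l * (if l = j then 1 else 0)) = (\<Sum>l\<in>block_idx n. if l = j then C i j else 0)"
    by (intro sum.cong) auto
  then show ?thesis using assms by (simp add: op_matrix_def matrix_op_def)
qed

lemma trace_norm_nuc_le:
  fixes \<sigma> :: "nat \<times> 'n::finite \<Rightarrow> nat \<times> 'n"
  assumes "trace_norm K < ennreal c" "inj_on \<sigma> (block_idx n)"
  shows "nuc_le (block_idx n) (\<lambda>i j. op_matrix K (\<sigma> i) (\<sigma> j)) c"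
proof -
  obtain H G :: "nat \<Rightarrow> nat \<times> 'n \<Rightarrow> complex" where HG: "hs_le H (sqrt c)" "hs_le G (sqrt c)"
    "\<And>i j. op_matrix K i j = hs_prod H G i j"
    by (rule trace_norm_imp_hs[OF assms(1)]) blast
  have "c \<ge> 0" using hs_le_nonneg[OF HG(1)] by simp
  then show ?thesis using hs_prod_nuc_le[OF HG(1,2) finite_block_idx assms(2,2)] by (simp add: HG(3))
qed

lemma trace_class_bound:
  assumes "trace_class K"
  obtains c where "trace_norm K < ennreal c"
proof -
  have "trace_norm K < top" using assms by (simp add: trace_class_def)
  then obtain r where "trace_norm K = ennreal r" "r \<ge> 0" by (cases "trace_norm K") auto
  then show ?thesis using that[of "r + 1"] by (simp add: ennreal_less_iff)
qed

lemma cornered_trace_class: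
  fixes K :: "(nat \<times> 'n::finite) op"
  assumes "trace_class K"
  shows "cornered (\<lambda>n i j. op_matrix K (side n s i) (side n s j))"
proof -
  obtain c where c: "trace_norm K < ennreal c" using trace_class_bound[OF assms] .
  obtain H G :: "nat \<Rightarrow> nat \<times> 'n \<Rightarrow> complex" where HG: "hs_le H (sqrt c)" "hs_le G (sqrt c)"
    "\<And>i j. op_matrix K i j = hs_prod H G i j"
    by (rule trace_norm_imp_hs[OF c]) blast
  show ?thesis unfolding HG(3) by (rule cornered_hs_prod[OF HG(1,2)])
qed

lemma nuc_le_trace_norm:
  fixes C :: "(nat \<times> 'n::finite) matrix"
  assumes "trace_norm (matrix_op n C) < ennreal c"
  shows "nuc_le (block_idx n) C c"
proof -
  have "nuc_le (block_idx n) (\<lambda>i j. op_matrix (matrix_op n C) (id i) (id j)) c"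
    by (rule trace_norm_nuc_le[OF assms]) simp
  then show ?thesis by (rule nuc_le_cong[THEN iffD1, rotated]) (simp add: op_matrix_matrix_op)
qed

section \<open>The sequence algebra\<close>

text \<open>All but the Toeplitz part. It depends on a decomposition only through the symbol, so
  that remainders belonging to different decompositions can be combined.\<close>

definition rest :: "(nat \<Rightarrow> (nat \<times> 'n::finite) matrix) \<Rightarrow> (complex \<Rightarrow> complex ^ 'n ^ 'n) \<Rightarrow>
    nat \<Rightarrow> (nat \<times> 'n) matrix" where
  "rest A a n i j = A n i j - toep (msym a) i j"

lemma norm_msym_le:
  assumes "a \<in> BM_alg"
  shows "norm (msym a) \<le> BM_norm a"
proof -
  have "norm (msym a) \<le> (\<Sum>i\<in>UNIV. \<Sum>j\<in>UNIV. norm (msym a $ i $ j))"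
    by (rule norm_matrix_le_sum)
  also have "\<dots> \<le> BM_norm a"
    unfolding BM_norm_def using assms
    by (intro sum_mono norm_le_B_norm) (auto simp: msym_def coef_sym BM_alg_def)
  finally show ?thesis .
qed

lemma rest_eq:
  assumes "F_decomp A a K L C" "n \<ge> 1" "i \<in> block_idx n" "j \<in> block_idx n"
  shows "rest A a n i j = op_matrix K (side n False i) (side n False j) +
    op_matrix L (side n True i) (side n True j) + C n i j"
proof -
  have "a \<in> BM_alg" "A n i j = toeplitz a i j + op_matrix (P_op n \<circ> K \<circ> P_op n) i j
                + op_matrix (W_op n \<circ> L \<circ> W_op n) i j + C n i j"
    using assms unfolding F_decomp_def by blast+
  then show ?thesis
    by (simp add: rest_def toeplitz_eq_toep op_matrix_P[OF assms(3,4)] op_matrix_W[OF assms(3,4)])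
qed

lemma rest_nuc_le:
  assumes "F_decomp A a K L C" "n \<ge> 1"
    and "trace_norm K < ennreal c" "trace_norm L < ennreal d" "trace_norm (matrix_op n (C n)) < ennreal e"
  shows "nuc_le (block_idx n) (rest A a n) (c + d + e)"
proof -
  have "nuc_le (block_idx n) (\<lambda>i j. op_matrix K (side n False i) (side n False j) +
      op_matrix L (side n True i) (side n True j) + C n i j) (c + d + e)"
    by (intro nuc_le_add trace_norm_nuc_le nuc_le_trace_norm assms inj_on_side)
  then show ?thesis
    by (rule nuc_le_cong[THEN iffD1, rotated]) (simp add: rest_eq[OF assms(1,2)])
qed

lemma
  assumes dec: "F_decomp A a K L C"
  shows rest_cornered: "cornered (rest A a)"
    and rest_bound: "\<exists>c. \<forall>\<^sub>F n in sequentially. nuc_le (block_idx n) (rest A a n) c"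
proof -
  have K: "trace_class K" and L: "trace_class L" and C: "N_seq C"
    using dec by (auto simp: F_decomp_def)
  have Ce: "\<forall>\<^sub>F n in sequentially. trace_norm (matrix_op n (C n)) < ennreal \<epsilon>" if "\<epsilon> > 0" for \<epsilon>
    using C that unfolding N_seq_def by (intro order_tendstoD) (auto simp: ennreal_less_iff)
  have "cornered C"
  proof (rule cornered_small)
    fix \<epsilon> :: real assume "\<epsilon> > 0"
    from Ce[OF this] show "\<forall>\<^sub>F n in sequentially. nuc_le (block_idx n) (C n) \<epsilon>"
      by (rule eventually_mono) (rule nuc_le_trace_norm)
  qed
  then have "cornered (\<lambda>n i j. op_matrix K (side n False i) (side n False j) +
      op_matrix L (side n True i) (side n True j) + C n i j)"
    by (intro cornered_add cornered_trace_class K L)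
  then show "cornered (rest A a)"
    by (rule cornered_cong)
      (use eventually_ge_at_top[of 1] in eventually_elim, auto simp: rest_eq[OF dec])
  obtain c d where cd: "trace_norm K < ennreal c" "trace_norm L < ennreal d"
    using trace_class_bound K L by metis
  have "\<forall>\<^sub>F n in sequentially. nuc_le (block_idx n) (rest A a n) (c + d + 1)"
    using Ce[of 1, simplified] eventually_ge_at_top[of 1]
    by eventually_elim (use rest_nuc_le[OF dec _ cd, of _ 1] in simp)
  then show "\<exists>c. \<forall>\<^sub>F n in sequentially. nuc_le (block_idx n) (rest A a n) c" by blast
qed

text \<open>The remainder has three parts, each with trace norm below \<epsilon>, hence the factor
  3.\<close>

lemma F_norm_lessD:
  fixes A :: "nat \<Rightarrow> (nat \<times> 'n::finite) matrix"
  assumes "F_norm A < ennreal \<epsilon>"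
  obtains a K L C where "F_decomp A a K L C" "norm (msym a) < \<epsilon>"
    "\<And>n. n \<ge> 1 \<Longrightarrow> nuc_le (block_idx n) (rest A a n) (3 * \<epsilon>)"
proof -
  obtain a K L C where dec: "F_decomp A a K L C"
    and lt: "ennreal (BM_norm a) + trace_norm K + trace_norm L
     + (SUP n\<in>{1..}. trace_norm (matrix_op n (C n))) < ennreal \<epsilon>"
    using assms unfolding F_norm_def INF_less_iff by auto
  have a: "a \<in> BM_alg" using dec by (simp add: F_decomp_def)
  have K: "trace_norm K < ennreal \<epsilon>" and L: "trace_norm L < ennreal \<epsilon>"
    and B: "ennreal (BM_norm a) < ennreal \<epsilon>"
    and S: "(SUP n\<in>{1..}. trace_norm (matrix_op n (C n))) < ennreal \<epsilon>"
    by (rule le_less_trans[OF _ lt], simp add: add_increasing add_increasing2)+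
  have "0 \<le> BM_norm a" using norm_msym_le[OF a] norm_ge_zero order_trans by blast
  then have "norm (msym a) < \<epsilon>" using norm_msym_le[OF a] B by (simp add: ennreal_less_iff)
  moreover have "nuc_le (block_idx n) (rest A a n) (3 * \<epsilon>)" if n: "n \<ge> 1" for n
  proof -
    have "trace_norm (matrix_op n (C n)) < ennreal \<epsilon>"
      using n by (intro le_less_trans[OF SUP_upper S]) auto
    from rest_nuc_le[OF dec n K L this] show ?thesis by simp
  qed
  ultimately show ?thesis using that dec by blast
qed

text \<open>Far from both ends a cornered sequence has small entries, whereas the diagonal with
  index difference d carries the same Fourier coefficient for all n. This is the uniqueness of the
  symbol of a sequence.\<close>

lemma cornered_toep_imp_0:
  fixes S :: "wsym ^ 'n ^ 'n::finite"
  assumes "cornered (\<lambda>n. toep S)"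
  shows "S = 0"
proof -
  have "coef (S $ \<alpha> $ \<beta>) d = 0" for \<alpha> \<beta> d
  proof -
    have "cmod (coef (S $ \<alpha> $ \<beta>) d) \<le> 0 + \<epsilon>" if e: "\<epsilon> > 0" for \<epsilon>
    proof -
      obtain m y where y: "fsupp m y" and ev: "\<forall>\<^sub>F n in sequentially.
          nuc_le (block_idx n) (\<lambda>i j. toep S i j - corner y n i j) \<epsilon>"
        using assms e unfolding cornered_def by meson
      \<comment> \<open>The shift by |d| makes both coordinates of the entry at least m, and the
        choice of n below keeps them equally far from the other end.\<close>
      define k where "k = m + nat \<bar>d\<bar>"
      define p where "p = nat (int k + d)"
      obtain n where n: "n \<ge> 2 * m + 2 * nat \<bar>d\<bar> + m + 1"
          and nuc: "nuc_le (block_idx n) (\<lambda>i j. toep S i j - corner y n i j) \<epsilon>"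
        using eventually_happens'[OF _ eventually_conj[OF ev eventually_ge_at_top]] by auto
      have mid: "m \<le> p" "p + m < n" "m \<le> k" "k + m < n" "int p - int k = d"
        using n by (auto simp: p_def k_def)
      have "y s s' (side n s (p, \<alpha>)) j = 0" for s s' j
      proof (rule ccontr)
        assume "y s s' (side n s (p, \<alpha>)) j \<noteq> 0"
        then have "fst (side n s (p, \<alpha>)) < m" using y unfolding fsupp_def by blast
        then show False using mid by (cases s) (auto simp: side_def)
      qed
      then have "corner y n (p, \<alpha>) (k, \<beta>) = 0" by (simp add: corner_def)
      then show ?thesis
        using nuc_le_entry[OF _ nuc, of "(p, \<alpha>)" "(k, \<beta>)"] mid by (simp add: toep_def)
    qed
    then have "cmod (coef (S $ \<alpha> $ \<beta>) d) \<le> 0" by (rule field_le_epsilon)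
    then show ?thesis by simp
  qed
  then show ?thesis by (auto simp: vec_eq_iff intro!: wsym_eqI)
qed

subsection \<open>Analytic families\<close>

text \<open>Complex multiples, needed for difference quotients in a complex parameter; the vector
  space structure of \<open>wsym\<close> is real.\<close>

lift_definition wscale :: "complex \<Rightarrow> wsym \<Rightarrow> wsym" is "\<lambda>c f k. c * f k"
  by (rule wcoef_scale)

lemma coef_wscale [simp]: "coef (wscale c f) k = c * coef f k"
  by (simp add: wscale.rep_eq)

lemma ev_wscale: "ev (wscale c f) z = c * ev f z"
  by (simp add: ev_def mult.assoc infsum_cmult_right')

lemma norm_wscale: "norm (wscale c f) \<le> cmod c * norm f"
  by (rule norm_wsym_leI) (simp add: wscale.rep_eq wN_scale wN_le_norm mult_left_mono)

definition mscale :: "complex \<Rightarrow> wsym ^ 'n ^ 'n::finite \<Rightarrow> wsym ^ 'n ^ 'n" where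
  "mscale c S = (\<chi> i j. wscale c (S $ i $ j))"

lemma toep_mscale: "toep (mscale c S) i j = c * toep S i j"
  by (cases i; cases j) (simp add: toep_def mscale_def)

lemma toep_add: "toep (S + S') i j = toep S i j + toep S' i j"
  by (cases i; cases j) (simp add: toep_def)

lemma evm_mscale: "evm (mscale c S) z $ i $ j = c * evm S z $ i $ j"
  by (simp add: evm_def mscale_def ev_wscale)

lemma norm_mscale: "norm (mscale c S) \<le> cmod c * norm S"
proof -
  have "norm (mscale c S $ i) \<le> cmod c * norm (S $ i)" for i
  proof -
    have "norm (mscale c S $ i) \<le> L2_set (\<lambda>j. cmod c * norm (S $ i $ j)) UNIV"
      unfolding norm_vec_def[of "mscale c S $ i"]
      by (intro L2_set_mono) (auto simp: mscale_def norm_wscale)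
    also have "\<dots> = cmod c * norm (S $ i)"
      by (subst L2_set_right_distrib[symmetric]) (auto simp: norm_vec_def)
    finally show ?thesis .
  qed
  then have "norm (mscale c S) \<le> L2_set (\<lambda>i. cmod c * norm (S $ i)) UNIV"
    unfolding norm_vec_def[of "mscale c S"] by (intro L2_set_mono) auto
  also have "\<dots> = cmod c * norm S"
    by (subst L2_set_right_distrib[symmetric]) (auto simp: norm_vec_def)
  finally show ?thesis .
qed

locale analytic_family =
  fixes \<Omega> :: "complex set"
    and A :: "complex \<Rightarrow> nat \<Rightarrow> (nat \<times> 'n::finite) matrix"
    and a :: "complex \<Rightarrow> complex \<Rightarrow> complex ^ 'n ^ 'n"
    and K L :: "complex \<Rightarrow> (nat \<times> 'n) op"
    and C :: "complex \<Rightarrow> nat \<Rightarrow> (nat \<times> 'n) matrix"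
  assumes open_Omega: "open \<Omega>"
    and dec: "\<And>t. t \<in> \<Omega> \<Longrightarrow> F_decomp (A t) (a t) (K t) (L t) (C t)"
    and analytic: "F_analytic_on A \<Omega>"
    and comp: "\<And>t. t \<in> \<Omega> \<Longrightarrow> a t \<in> G1BM"
begin

lemma a_BM: "t \<in> \<Omega> \<Longrightarrow> a t \<in> BM_alg"
  using dec unfolding F_decomp_def by blast

text \<open>The remainder of the difference quotient has a decomposition of its own; as the symbol of a
  sequence is unique, it is compatible with the given one.\<close>

lemma differentiable:
  assumes t: "t \<in> \<Omega>"
  obtains S D where "\<exists>c. \<forall>\<^sub>F n in sequentially. nuc_le (block_idx n) (\<lambda>i j. D n i j - toep S i j) c"
    "\<And>\<epsilon>. \<epsilon> > 0 \<Longrightarrow> \<forall>\<^sub>F s in at t. \<exists>U.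
       norm U < \<epsilon> \<and> msym (a s) = msym (a t) + mscale (s - t) (S + U) \<and>
       (\<forall>n\<ge>1. nuc_le (block_idx n) (\<lambda>i j. (A s n i j - A t n i j) / (s - t) - D n i j - toep U i j) (3 * \<epsilon>))"
proof -
  obtain D where D: "D \<in> F_alg"
    and lim: "((\<lambda>s. F_norm (\<lambda>n i j. (A s n i j - A t n i j) / (s - t) - D n i j)) \<longlongrightarrow> 0) (at t)"
    using analytic t unfolding F_analytic_on_def by blast
  obtain d K' L' C' where dD: "F_decomp D d K' L' C'" using D unfolding F_alg_def by blast
  show ?thesis
  proof (rule that)
    show "\<exists>c. \<forall>\<^sub>F n in sequentially. nuc_le (block_idx n) (\<lambda>i j. D n i j - toep (msym d) i j) c"
      using rest_bound[OF dD] by (simp add: rest_def[abs_def])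
    fix \<epsilon> :: real assume e: "\<epsilon> > 0"
    have "\<forall>\<^sub>F s in at t. F_norm (\<lambda>n i j. (A s n i j - A t n i j) / (s - t) - D n i j) < ennreal \<epsilon>"
      using lim e by (intro order_tendstoD) (auto simp: ennreal_less_iff)
    moreover have "\<forall>\<^sub>F s in at t. s \<in> \<Omega>"
      using open_Omega t by (rule eventually_at_in_open')
    ultimately show "\<forall>\<^sub>F s in at t. \<exists>U. norm U < \<epsilon> \<and> msym (a s) = msym (a t) + mscale (s - t) (msym d + U) \<and>
       (\<forall>n\<ge>1. nuc_le (block_idx n) (\<lambda>i j. (A s n i j - A t n i j) / (s - t) - D n i j - toep U i j) (3 * \<epsilon>))"
      using eventually_neq_at_within[of t t UNIV]
    proof eventually_elim
      case (elim s)
      let ?R = "\<lambda>n i j. (A s n i j - A t n i j) / (s - t) - D n i j"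
      obtain r K'' L'' C'' where R: "F_decomp ?R r K'' L'' C''" "norm (msym r) < \<epsilon>"
        "\<And>n. n \<ge> 1 \<Longrightarrow> nuc_le (block_idx n) (rest ?R r n) (3 * \<epsilon>)"
        by (rule F_norm_lessD[OF elim(1)]) blast
      let ?Z = "msym (a s) - (msym (a t) + mscale (s - t) (msym d + msym r))"
      have "cornered (\<lambda>n i j. (rest (A t) (a t) n i j + (s - t) * (rest D d n i j + rest ?R r n i j))
          - rest (A s) (a s) n i j)"
        by (intro cornered_diff cornered_add cornered_scale rest_cornered[OF dec[OF t]]
            rest_cornered[OF dec[OF elim(2)]] rest_cornered[OF dD] rest_cornered[OF R(1)])
      moreover have "(rest (A t) (a t) n i j + (s - t) * (rest D d n i j + rest ?R r n i j))
          - rest (A s) (a s) n i j = toep ?Z i j" for n i j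
        using elim(3) by (simp add: rest_def toep_diff toep_add toep_mscale field_simps)
      ultimately have "cornered (\<lambda>n. toep ?Z)" by simp
      then have "?Z = 0" by (rule cornered_toep_imp_0)
      then have "msym (a s) = msym (a t) + mscale (s - t) (msym d + msym r)" by simp
      then show ?case using R(2,3) by (intro exI[of _ "msym r"]) (simp add: rest_def[abs_def])
    qed
  qed
qed

lemma entry_differentiable:
  assumes t: "t \<in> \<Omega>" and n: "n \<ge> 1" and ij: "i \<in> block_idx n" "j \<in> block_idx n"
  shows "(\<lambda>s. A s n i j) field_differentiable (at t)"
proof -
  obtain S D where D: "\<And>\<epsilon>. \<epsilon> > 0 \<Longrightarrow> \<forall>\<^sub>F s in at t. \<exists>U.
       norm U < \<epsilon> \<and> msym (a s) = msym (a t) + mscale (s - t) (S + U) \<and>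
       (\<forall>n\<ge>1. nuc_le (block_idx n) (\<lambda>i j. (A s n i j - A t n i j) / (s - t) - D n i j - toep U i j) (3 * \<epsilon>))"
    by (rule differentiable[OF t]) blast
  have "((\<lambda>s. (A s n i j - A t n i j) / (s - t)) \<longlongrightarrow> D n i j) (at t)"
  proof (rule tendstoI)
    fix e :: real assume e: "e > 0"
    \<comment> \<open>The Toeplitz part contributes at most e/8 and the remainder 3 e/8, together
      less than e.\<close>
    have "\<forall>\<^sub>F s in at t. \<exists>U. norm U < e / 8 \<and> msym (a s) = msym (a t) + mscale (s - t) (S + U) \<and>
       (\<forall>n\<ge>1. nuc_le (block_idx n) (\<lambda>i j. (A s n i j - A t n i j) / (s - t) - D n i j - toep U i j) (3 * (e / 8)))"
      using e by (intro D) simp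
    then show "\<forall>\<^sub>F s in at t. dist ((A s n i j - A t n i j) / (s - t)) (D n i j) < e"
    proof eventually_elim
      case (elim s)
      then obtain U where U: "norm U < e / 8"
        "nuc_le (block_idx n) (\<lambda>i j. (A s n i j - A t n i j) / (s - t) - D n i j - toep U i j) (3 * (e / 8))"
        using n by blast
      have "cmod (toep U i j) \<le> norm U"
        unfolding toep_def by (cases i; cases j) (auto intro: order_trans[OF coef_le_norm norm_entry_le])
      moreover have "cmod ((A s n i j - A t n i j) / (s - t) - D n i j - toep U i j) \<le> 3 * (e / 8)"
        by (rule nuc_le_entry[OF _ U(2) ij]) simp
      ultimately have "cmod ((A s n i j - A t n i j) / (s - t) - D n i j) < e"
        using U(1) e norm_triangle_ineq[of "(A s n i j - A t n i j) / (s - t) - D n i j - toep U i j" "toep U i j"]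
        by simp
      then show ?case by (simp add: dist_norm)
    qed
  qed
  then show ?thesis by (auto simp: field_differentiable_def has_field_derivative_iff)
qed

lemma symbol_differentiable:
  assumes t: "t \<in> \<Omega>" and z: "cmod z = 1"
  shows "(\<lambda>s. evm (msym (a s)) z $ i $ j) field_differentiable (at t)"
proof -
  obtain S D where D: "\<And>\<epsilon>. \<epsilon> > 0 \<Longrightarrow> \<forall>\<^sub>F s in at t. \<exists>U.
       norm U < \<epsilon> \<and> msym (a s) = msym (a t) + mscale (s - t) (S + U) \<and>
       (\<forall>n\<ge>1. nuc_le (block_idx n) (\<lambda>i j. (A s n i j - A t n i j) / (s - t) - D n i j - toep U i j) (3 * \<epsilon>))"
    by (rule differentiable[OF t]) blast
  have "((\<lambda>s. (evm (msym (a s)) z $ i $ j - evm (msym (a t)) z $ i $ j) / (s - t)) \<longlongrightarrow> evm S z $ i $ j) (at t)"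
  proof (rule tendstoI)
    fix e :: real assume e: "e > 0"
    show "\<forall>\<^sub>F s in at t. dist ((evm (msym (a s)) z $ i $ j - evm (msym (a t)) z $ i $ j) / (s - t)) (evm S z $ i $ j) < e"
      using D[OF e] eventually_neq_at_within[of t t UNIV]
    proof eventually_elim
      case (elim s)
      then obtain U where U: "norm U < e" "msym (a s) = msym (a t) + mscale (s - t) (S + U)" by blast
      have evm_add: "evm (V + W) z = evm V z + evm W z" for V W :: "wsym ^ 'n ^ 'n"
        by (simp add: evm_def vec_eq_iff ev_add z)
      have "(evm (msym (a s)) z $ i $ j - evm (msym (a t)) z $ i $ j) / (s - t) = evm S z $ i $ j + evm U z $ i $ j"
        using elim(2) by (simp add: U(2) evm_add evm_mscale)
      moreover have "cmod (evm U z $ i $ j) < e"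
        using cmod_evm_le[OF z, of U i j] norm_entry_le[of U i j] U(1) by linarith
      ultimately show ?case by (simp add: dist_norm)
    qed
  qed
  then show ?thesis by (auto simp: field_differentiable_def has_field_derivative_iff)
qed

text \<open>Differentiability writes \<open>A s\<close> as \<open>A t\<close> plus (s - t) times the
  derivative and a small sequence. The bounds for \<open>A t\<close> and for the derivative hold for
  large n only, but they do not involve s, so one \<open>n0\<close> serves the whole disc.\<close>

lemma local_bounds:
  assumes t: "t \<in> \<Omega>" and d: "d > 0"
  obtains r c n0 where "r > 0" "ball t r \<subseteq> \<Omega>" "n0 \<ge> 1"
    "\<And>s. s \<in> ball t r \<Longrightarrow> norm (msym (a s) - msym (a t)) < d"
    "\<And>s n. s \<in> ball t r \<Longrightarrow> n \<ge> n0 \<Longrightarrow> nuc_le (block_idx n) (rest (A s) (a s) n) c"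
proof -
  obtain S D where SD: "\<exists>c. \<forall>\<^sub>F n in sequentially. nuc_le (block_idx n) (\<lambda>i j. D n i j - toep S i j) c"
    and D: "\<And>\<epsilon>. \<epsilon> > 0 \<Longrightarrow> \<forall>\<^sub>F s in at t. \<exists>U.
       norm U < \<epsilon> \<and> msym (a s) = msym (a t) + mscale (s - t) (S + U) \<and>
       (\<forall>n\<ge>1. nuc_le (block_idx n) (\<lambda>i j. (A s n i j - A t n i j) / (s - t) - D n i j - toep U i j) (3 * \<epsilon>))"
    by (rule differentiable[OF t]) blast
  obtain c1 where c1: "\<forall>\<^sub>F n in sequentially. nuc_le (block_idx n) (\<lambda>i j. D n i j - toep S i j) c1"
    using SD by blast
  obtain c2 where c2: "\<forall>\<^sub>F n in sequentially. nuc_le (block_idx n) (rest (A t) (a t) n) c2"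
    using rest_bound[OF dec[OF t]] by blast
  obtain n0 where n0: "n0 \<ge> 1" "\<And>n. n \<ge> n0 \<Longrightarrow> nuc_le (block_idx n) (\<lambda>i j. D n i j - toep S i j) c1"
      "\<And>n. n \<ge> n0 \<Longrightarrow> nuc_le (block_idx n) (rest (A t) (a t) n) c2"
    using eventually_conj[OF c1 eventually_conj[OF c2 eventually_ge_at_top[of 1]]]
    unfolding eventually_sequentially by blast
  have c10: "c1 \<ge> 0" using nuc_le_nonneg n0(2) by blast
  \<comment> \<open>The 1 lets |s - t| be dropped from the trace norm bound. The other term keeps
    the symbol within d of that at t, as its difference quotient S + U has norm below norm S +
    1.\<close>
  define q where "q = min 1 (d / (norm S + 1))"
  have q: "q > 0" using d by (simp add: q_def add_nonneg_pos)
  have "\<forall>\<^sub>F s in at t. (\<exists>U. norm U < 1 \<and> msym (a s) = msym (a t) + mscale (s - t) (S + U) \<and>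
       (\<forall>n\<ge>1. nuc_le (block_idx n) (\<lambda>i j. (A s n i j - A t n i j) / (s - t) - D n i j - toep U i j) (3 * 1))) \<and> s \<in> \<Omega>"
    using eventually_conj[OF D[of 1] eventually_at_in_open'[OF open_Omega t]] by simp
  then obtain r0 where r0: "r0 > 0" "\<And>s. s \<noteq> t \<Longrightarrow> dist s t < r0 \<Longrightarrow>
     (\<exists>U. norm U < 1 \<and> msym (a s) = msym (a t) + mscale (s - t) (S + U) \<and>
       (\<forall>n\<ge>1. nuc_le (block_idx n) (\<lambda>i j. (A s n i j - A t n i j) / (s - t) - D n i j - toep U i j) (3 * 1))) \<and> s \<in> \<Omega>"
    unfolding eventually_at by blast
  define r where "r = min r0 q"
  have sd: "s \<in> \<Omega> \<and> norm (msym (a s) - msym (a t)) < d \<and>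
      (\<forall>n\<ge>n0. nuc_le (block_idx n) (rest (A s) (a s) n) (c2 + (c1 + 3)))" if s: "s \<in> ball t r" for s
  proof (cases "s = t")
    case True
    have "nuc_le (block_idx n) (rest (A t) (a t) n) (c2 + (c1 + 3))" if "n \<ge> n0" for n
      by (rule nuc_le_mono[OF n0(3)[OF that]]) (use c10 in simp)
    then show ?thesis using True t d by simp
  next
    case False
    have st: "cmod (s - t) < r0" "cmod (s - t) < q" using s by (auto simp: r_def dist_norm norm_minus_commute)
    obtain U where U: "norm U < 1" "msym (a s) = msym (a t) + mscale (s - t) (S + U)"
       "\<And>n. n \<ge> 1 \<Longrightarrow> nuc_le (block_idx n) (\<lambda>i j. (A s n i j - A t n i j) / (s - t) - D n i j - toep U i j) 3"
       "s \<in> \<Omega>"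
      using r0(2)[OF False] st by (auto simp: dist_norm)
    have "norm (msym (a s) - msym (a t)) \<le> cmod (s - t) * norm (S + U)"
      using norm_mscale[of "s - t" "S + U"] by (simp add: U(2))
    also have "\<dots> \<le> cmod (s - t) * (norm S + 1)"
      using U(1) norm_triangle_ineq[of S U] by (intro mult_left_mono) auto
    also have "\<dots> < q * (norm S + 1)"
      using st by (intro mult_strict_right_mono) (auto simp: add_nonneg_pos)
    also have "\<dots> \<le> d / (norm S + 1) * (norm S + 1)"
      by (intro mult_right_mono) (auto simp: q_def)
    also have "\<dots> = d" using norm_ge_zero[of S] by (simp add: add_nonneg_eq_0_iff)
    finally have 1: "norm (msym (a s) - msym (a t)) < d" .
    have "nuc_le (block_idx n) (rest (A s) (a s) n) (c2 + (c1 + 3))" if n: "n \<ge> n0" for n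
    proof -
      let ?Y = "\<lambda>i j. (D n i j - toep S i j) + ((A s n i j - A t n i j) / (s - t) - D n i j - toep U i j)"
      have "nuc_le (block_idx n) (\<lambda>i j. rest (A t) (a t) n i j + (s - t) * ?Y i j) (c2 + cmod (s - t) * (c1 + 3))"
        using n n0(1) by (intro nuc_le_add nuc_le_scale n0 U(3)) auto
      moreover have "rest (A t) (a t) n i j + (s - t) * ?Y i j = rest (A s) (a s) n i j" for i j
        using False by (simp add: rest_def U(2) toep_add toep_mscale field_simps)
      ultimately have "nuc_le (block_idx n) (rest (A s) (a s) n) (c2 + cmod (s - t) * (c1 + 3))" by simp
      moreover have "cmod (s - t) * (c1 + 3) \<le> 1 * (c1 + 3)"
        using st c10 by (intro mult_right_mono) (auto simp: q_def)
      ultimately show ?thesis using nuc_le_mono by fastforce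
    qed
    then show ?thesis using 1 U(4) by blast
  qed
  show ?thesis
    by (rule that[of r n0 "c2 + (c1 + 3)"]) (use sd r0(1) q n0(1) in \<open>auto simp: r_def\<close>)
qed

end

section \<open>Locally bounded sequences of holomorphic functions\<close>

text \<open>By Cauchy's estimate the functions share a Lipschitz constant on the disc of half the
  radius, and so does the pointwise limit. Convergence at the finitely many centres of a covering by
  small discs then controls all points at once.\<close>

lemma vitali:
  fixes f :: "nat \<Rightarrow> complex \<Rightarrow> complex"
  assumes r: "r > 0" and hol: "\<And>n. n \<ge> N \<Longrightarrow> f n holomorphic_on ball t r"
    and bd: "\<And>n s. n \<ge> N \<Longrightarrow> s \<in> ball t r \<Longrightarrow> cmod (f n s) \<le> M"
    and lim: "\<And>s. s \<in> ball t r \<Longrightarrow> (\<lambda>n. f n s) \<longlonglongrightarrow> g s"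
  shows "uniform_limit (cball t (r/2)) f g sequentially" "g holomorphic_on ball t (r/2)"
proof -
  \<comment> \<open>Circles of radius r/4 about points of the half disc remain in the disc where the
    bound M holds.\<close>
  define B where "B = 4 * M / r"
  have "cmod (f N t) \<le> M" using r by (intro bd) auto
  then have M: "M \<ge> 0" by (rule order_trans[OF norm_ge_zero])
  have B: "B \<ge> 0" using M r by (simp add: B_def)
  have sub: "cball t (r/2) \<subseteq> ball t r" using r by auto
  have lip: "cmod (f n x - f n y) \<le> B * cmod (x - y)"
    if n: "n \<ge> N" and xy: "x \<in> cball t (r/2)" "y \<in> cball t (r/2)" for n x y
  proof (rule field_differentiable_bound[OF convex_cball _ _ xy])
    fix w assume w: "w \<in> cball t (r/2)"
    have wb: "ball w (r/2) \<subseteq> ball t r"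
    proof
      fix v assume "v \<in> ball w (r/2)"
      then show "v \<in> ball t r" using w dist_triangle[of t v w] by auto
    qed
    show "(f n has_field_derivative deriv (f n) w) (at w within cball t (r/2))"
      using holomorphic_derivI[OF hol[OF n] open_ball] w sub has_field_derivative_at_within by blast
    have "cmod ((deriv ^^ 1) (f n) w) \<le> fact 1 * M / (r/4) ^ 1"
    proof (rule Cauchy_inequality)
      have s: "cball w (r/4) \<subseteq> ball t r" using r wb by (auto simp: subset_iff)
      show "f n holomorphic_on ball w (r/4)"
        by (rule holomorphic_on_subset[OF hol[OF n]]) (use s in auto)
      show "continuous_on (cball w (r/4)) (f n)"
        by (rule continuous_on_subset[OF holomorphic_on_imp_continuous_on[OF hol[OF n]] s])
      show "cmod (f n x) \<le> M" if "cmod (w - x) = r / 4" for x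
        by (rule bd[OF n]) (use s that in \<open>auto simp: dist_norm subset_iff\<close>)
    qed (use r in auto)
    then show "cmod (deriv (f n) w) \<le> B" by (simp add: B_def field_simps)
  qed
  have lipg: "cmod (g x - g y) \<le> B * cmod (x - y)" if xy: "x \<in> cball t (r/2)" "y \<in> cball t (r/2)" for x y
  proof (rule tendsto_upperbound)
    show "(\<lambda>n. cmod (f n x - f n y)) \<longlonglongrightarrow> cmod (g x - g y)"
      by (intro tendsto_intros lim) (use xy sub in auto)
    show "\<forall>\<^sub>F n in sequentially. cmod (f n x - f n y) \<le> B * cmod (x - y)"
      using eventually_ge_at_top[of N] by eventually_elim (rule lip[OF _ xy])
  qed simp
  show unif: "uniform_limit (cball t (r/2)) f g sequentially"
  proof (rule uniform_limitI)
    fix e :: real assume e: "e > 0"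
    define \<delta> where "\<delta> = e / (3 * (B + 1))"
    have \<delta>: "\<delta> > 0" "B * \<delta> \<le> e / 3"
    proof -
      show "\<delta> > 0" using e B by (simp add: \<delta>_def)
      then have "B * \<delta> \<le> (B + 1) * \<delta>" by simp
      also have "\<dots> = e / 3" using B by (simp add: \<delta>_def field_simps)
      finally show "B * \<delta> \<le> e / 3" .
    qed
    obtain X where X: "finite X" "X \<subseteq> cball t (r/2)" "cball t (r/2) \<subseteq> (\<Union>x\<in>X. ball x \<delta>)"
      by (rule compactE_image[OF compact_cball, of "cball t (r/2)" "\<lambda>x. ball x \<delta>" t "r/2"]) (use \<delta>(1) in auto)
    have "\<forall>\<^sub>F n in sequentially. \<forall>x\<in>X. cmod (f n x - g x) < e / 3"
    proof (rule eventually_ball_finite[OF X(1)], rule ballI)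
      fix x assume "x \<in> X"
      then have "(\<lambda>n. f n x) \<longlonglongrightarrow> g x" using X(2) sub by (intro lim) auto
      then show "\<forall>\<^sub>F n in sequentially. cmod (f n x - g x) < e / 3"
        using e by (auto dest!: tendstoD[of _ _ _ "e/3"] simp: dist_norm)
    qed
    then show "\<forall>\<^sub>F n in sequentially. \<forall>x\<in>cball t (r/2). dist (f n x) (g x) < e"
      using eventually_ge_at_top[of N]
    proof eventually_elim
      case (elim n)
      show ?case
      proof
        fix s assume s: "s \<in> cball t (r/2)"
        then obtain x where x: "x \<in> X" "dist x s < \<delta>" using X(3) by auto
        have xs: "B * cmod (s - x) \<le> e / 3"
          using x(2) B \<delta>(2) mult_left_mono[of "cmod (s - x)" \<delta> B] by (simp add: dist_norm norm_minus_commute)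
        have xc: "x \<in> cball t (r/2)" using x X by auto
        have "cmod (f n s - g s) \<le> cmod (f n s - f n x) + cmod (f n x - g x) + cmod (g x - g s)"
          using norm_triangle_ineq[of "f n s - f n x" "f n x - g x"]
            norm_triangle_ineq[of "f n s - g x" "g x - g s"] by simp
        also have "\<dots> < e"
          using lip[OF elim(2) s xc] lipg[OF s xc] xs elim(1) x(1) norm_minus_commute[of "g x" "g s"]
          by force
        finally show "dist (f n s) (g s) < e" by (simp add: dist_norm)
      qed
    qed
  qed
  obtain "continuous_on (cball t (r/2)) g" "g holomorphic_on ball t (r/2)"
  proof (rule holomorphic_uniform_limit[OF _ unif])
    show "\<forall>\<^sub>F n in sequentially. continuous_on (cball t (r/2)) (f n) \<and> f n holomorphic_on ball t (r/2)"
      using eventually_ge_at_top[of N]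
    proof eventually_elim
      case (elim n)
      show ?case
        using continuous_on_subset[OF holomorphic_on_imp_continuous_on[OF hol[OF elim]] sub]
          holomorphic_on_subset[OF hol[OF elim] order_trans[OF ball_subset_cball sub]] by simp
    qed
  qed auto
  then show "g holomorphic_on ball t (r/2)" by simp
qed

text \<open>After rescaling to the unit interval, uniform continuity compares the integral over each
  step with the value at its left end. \<open>Suc m\<close> nodes avoid division by zero.\<close>

lemma riemann_sums_mean:
  assumes g: "continuous_on (sphere 0 1) g"
  shows "(\<lambda>m. (\<Sum>j<Suc m. g (cis (2 * pi * real j / real (Suc m)))) / of_nat (Suc m)) \<longlonglongrightarrow> mean g"
proof (rule LIMSEQ_I)
  define h where "h x = g (cis (2 * pi * x))" for x
  have hc: "continuous_on UNIV h"
    unfolding h_def using continuous_on_circle_cis[OF g, of UNIV]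
    by (rule continuous_on_compose2) (auto intro!: continuous_intros)
  have hi: "h integrable_on {u..v}" for u v
    using hc continuous_on_subset by (intro integrable_continuous_real) blast
  have mean: "mean g = integral {0..1} h"
  proof -
    have "((\<lambda>x. g (cis x)) has_integral integral {0..2*pi} (\<lambda>x. g (cis x))) (cbox 0 (2*pi))"
      using integrable_continuous_real[OF continuous_on_circle_cis[OF g]] by (simp add: integrable_integral)
    from has_integral_affinity[OF this, of "2 * pi" 0]
    have "((\<lambda>x. g (cis (2 * pi * x))) has_integral (1 / (2 * pi)) *\<^sub>R integral {0..2*pi} (\<lambda>x. g (cis x)))
        ((\<lambda>x. x / (2 * pi)) ` {0..2*pi})" by simp
    moreover have "(\<lambda>x. x / (2 * pi)) ` {0..2*pi} = {0..1}"
      using image_affinity_atLeastAtMost[of "1 / (2 * pi)" 0 0 "2 * pi"] by simp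
    ultimately show ?thesis
      by (simp add: mean_integral[OF g] h_def[abs_def] integral_unique scaleR_conv_of_real)
  qed
  fix e :: real assume e: "e > 0"
  have "uniformly_continuous_on {0..1} h"
    using hc continuous_on_subset by (intro compact_uniformly_continuous) auto
  then obtain d where d: "d > 0" "\<And>x y. x \<in> {0..1} \<Longrightarrow> y \<in> {0..1} \<Longrightarrow> dist y x < d \<Longrightarrow> dist (h y) (h x) < e / 2"
    unfolding uniformly_continuous_on_def using e by (metis half_gt_zero)
  obtain m0 :: nat where m0: "1 / d < real m0" using reals_Archimedean2 by blast
  have "cmod ((\<Sum>j<Suc m. h (real j / real (Suc m))) / of_nat (Suc m) - integral {0..1} h) < e"
    if m: "m \<ge> m0" for m
  proof -
    let ?n = "real (Suc m)"
    define x where "x j = real j / ?n" for j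
    have step: "x (Suc j) - x j = 1 / ?n" for j by (simp add: x_def add_divide_distrib)
    have small: "1 / ?n < d"
    proof -
      have "1 / d < ?n" using m0 m by linarith
      then show ?thesis using d(1) by (simp add: field_simps)
    qed
    have split: "integral {0..x k} h = (\<Sum>j<k. integral {x j..x (Suc j)} h)" for k
    proof (induction k)
      case 0
      then show ?case by (simp add: x_def)
    next
      case (Suc k)
      have "integral {0..x k} h + integral {x k..x (Suc k)} h = integral {0..x (Suc k)} h"
        by (rule Henstock_Kurzweil_Integration.integral_combine) (auto simp: x_def hi divide_right_mono)
      then show ?case using Suc by simp
    qed
    have one: "cmod (h (x j) / of_nat (Suc m) - integral {x j..x (Suc j)} h) \<le> e / 2 / ?n" if j: "j < Suc m" for j
    proof -
      have le: "x j \<le> x (Suc j)" by (simp add: x_def divide_right_mono)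
      have x01: "x j \<ge> 0" "x (Suc j) \<le> 1" using j by (simp_all add: x_def)
      have "h (x j) / of_nat (Suc m) = integral {x j..x (Suc j)} (\<lambda>_. h (x j))"
        using le step[of j] by (simp add: scaleR_conv_of_real)
      then have "h (x j) / of_nat (Suc m) - integral {x j..x (Suc j)} h = integral {x j..x (Suc j)} (\<lambda>y. h (x j) - h y)"
        by (simp only:) (rule integral_diff[symmetric], auto simp: hi)
      also have "cmod \<dots> \<le> e / 2 * (x (Suc j) - x j)"
      proof (rule integral_bound[OF le])
        show "continuous_on {x j..x (Suc j)} (\<lambda>y. h (x j) - h y)"
          by (intro continuous_intros continuous_on_subset[OF hc]) auto
        fix y assume y: "y \<in> {x j..x (Suc j)}"
        then have "dist y (x j) < d" using step[of j] small by (simp add: dist_real_def)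
        then have "dist (h y) (h (x j)) < e / 2" using y x01 le by (intro d(2)) auto
        then show "cmod (h (x j) - h y) \<le> e / 2" by (simp add: dist_norm norm_minus_commute)
      qed
      finally show ?thesis using step[of j] by simp
    qed
    have "x (Suc m) = 1" by (simp add: x_def)
    then have "(\<Sum>j<Suc m. h (real j / ?n)) / of_nat (Suc m) - integral {0..1} h =
        (\<Sum>j<Suc m. h (x j) / of_nat (Suc m) - integral {x j..x (Suc j)} h)"
      using split[of "Suc m"] by (simp add: sum_subtractf sum_divide_distrib x_def del: sum.lessThan_Suc)
    also have "cmod \<dots> \<le> (\<Sum>j<Suc m. e / 2 / ?n)"
      by (intro order_trans[OF norm_sum] sum_mono one) auto
    also have "\<dots> = e / 2" by (simp add: field_simps del: sum.lessThan_Suc)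
    also have "\<dots> < e" using e by simp
    finally show ?thesis .
  qed
  then show "\<exists>no. \<forall>n\<ge>no. norm ((\<Sum>j<Suc n. g (cis (2 * pi * real j / real (Suc n)))) / of_nat (Suc n) - mean g) < e"
    unfolding mean h_def by (intro exI[of _ m0]) simp
qed

text \<open>The mean is the limit of its Riemann sums, which are holomorphic and uniformly bounded.\<close>

lemma mean_Ln_holomorphic:
  fixes q :: "complex \<Rightarrow> complex \<Rightarrow> complex"
  assumes r: "r > 0" and hol: "\<And>z. cmod z = 1 \<Longrightarrow> (\<lambda>s. q s z) holomorphic_on ball t r"
    and cont: "\<And>s. s \<in> ball t r \<Longrightarrow> continuous_on (sphere 0 1) (q s)"
    and near: "\<And>s z. s \<in> ball t r \<Longrightarrow> cmod z = 1 \<Longrightarrow> cmod (q s z - 1) < 1/2"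
  shows "(\<lambda>s. mean (\<lambda>z. Ln (q s z))) holomorphic_on ball t (r/2)"
proof -
  have nonpos: "q s z \<notin> \<real>\<^sub>\<le>\<^sub>0" if "s \<in> ball t r" "cmod z = 1" for s z
    using near[OF that] by (intro not_nonpos_near1) simp
  \<comment> \<open>By compactness this gives one bound for the logarithms at all nodes and
    parameters, and thus for all Riemann sums.\<close>
  have "continuous_on (cball 1 (1/2)) Ln"
  proof (rule continuous_on_Ln)
    fix w :: complex assume "w \<in> cball 1 (1/2)"
    then have "cmod (w - 1) < 1" by (simp add: dist_norm norm_minus_commute)
    then show "w \<notin> \<real>\<^sub>\<le>\<^sub>0" by (rule not_nonpos_near1)
  qed
  then have "bounded (Ln ` cball (1::complex) (1/2))" by (intro compact_imp_bounded compact_continuous_image) auto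
  then obtain M where M: "\<forall>w\<in>Ln ` cball (1::complex) (1/2). cmod w \<le> M" unfolding bounded_iff by blast
  have LnM: "cmod (Ln (q s z)) \<le> M" if "s \<in> ball t r" "cmod z = 1" for s z
  proof -
    have "q s z \<in> cball 1 (1/2)" using near[OF that] by (simp add: dist_norm norm_minus_commute)
    then show ?thesis using M by simp
  qed
  let ?f = "\<lambda>m s. (\<Sum>j<Suc m. Ln (q s (cis (2 * pi * real j / real (Suc m))))) / of_nat (Suc m)"
  show ?thesis
  proof (rule vitali(2)[OF r, where N = 0 and f = ?f and M = M])
    show "?f m holomorphic_on ball t r" for m
      by (intro holomorphic_intros holomorphic_on_Ln' hol nonpos; simp del: of_nat_Suc)
    show "cmod (?f m s) \<le> M" if s: "s \<in> ball t r" for m s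
    proof -
      have "cmod (\<Sum>j<Suc m. Ln (q s (cis (2 * pi * real j / real (Suc m))))) \<le> (\<Sum>j<Suc m. M)"
        by (intro order_trans[OF norm_sum] sum_mono LnM s) auto
      also have "\<dots> = M * real (Suc m)" by (simp del: sum.lessThan_Suc)
      finally show ?thesis by (simp add: norm_divide divide_le_eq del: sum.lessThan_Suc of_nat_Suc)
    qed
    show "(\<lambda>m. ?f m s) \<longlonglongrightarrow> mean (\<lambda>z. Ln (q s z))" if s: "s \<in> ball t r" for s
    proof (rule riemann_sums_mean)
      show "continuous_on (sphere 0 1) (\<lambda>z. Ln (q s z))"
        using cont[OF s] nonpos[OF s] by (intro continuous_on_Ln') auto
    qed
  qed
qed

section \<open>The limit theorem\<close>

context analytic_family
begin

definition det_quot :: "nat \<Rightarrow> complex \<Rightarrow> complex" where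
  "det_quot n s = block_det n (A s n) / G_const (a s) ^ n"

lemma det_quot_eq:
  assumes s: "s \<in> \<Omega>" and bs: "factors (msym (a s)) bs"
  shows "det_quot n s = fdet (block_idx n) (tprod n (A s n) bs)" and "G_const (a s) \<noteq> 0"
proof -
  have g: "G_const (a s) * prod_list (map (\<lambda>b. det (const_block b)) bs) = 1"
    by (rule factors_G_const[OF bs a_BM[OF s]])
  then show "G_const (a s) \<noteq> 0" by auto
  have "fdet (block_idx n) (tprod n (A s n) bs) =
      block_det n (A s n) * prod_list (map (\<lambda>b. det (const_block b)) bs) ^ n"
    using bs by (simp add: factors_def fdet_tprod block_det_eq_fdet)
  also have "prod_list (map (\<lambda>b. det (const_block b)) bs) = inverse (G_const (a s))"
    using g by (metis inverse_unique)
  finally show "det_quot n s = fdet (block_idx n) (tprod n (A s n) bs)"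
    by (simp add: det_quot_def divide_inverse power_inverse)
qed

lemma A_eq: "A s n i j = toep (msym (a s)) i j + rest (A s) (a s) n i j"
  by (simp add: rest_def)

lemma det_quot_bound:
  assumes s: "s \<in> \<Omega>" and bs: "factors (msym (a s)) bs"
    and X: "nuc_le (block_idx n) (rest (A s) (a s) n) c" and \<sigma>: "norm (msym (a s)) \<le> \<sigma>"
    and \<beta>: "\<forall>b\<in>set bs. norm b \<le> \<beta>" and c': "c' = tprod_bound (real CARD('n)) \<beta> (length bs) \<sigma> c"
  shows "nuc_le (block_idx n) (\<lambda>i j. tprod n (A s n) bs i j - idm i j) c'"
    and "cmod (det_quot n s) \<le> exp (c' + c'\<^sup>2 / 2)"
proof -
  have "msym (a s) ** lprod bs = mat 1" using bs by (simp add: factors_def)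
  then show 1: "nuc_le (block_idx n) (\<lambda>i j. tprod n (A s n) bs i j - idm i j) c'"
    using tprod_nuc_le[OF X \<sigma> \<beta> A_eq] by (simp add: toep_one c')
  show "cmod (det_quot n s) \<le> exp (c' + c'\<^sup>2 / 2)"
    using fdet_one_plus_bound[OF _ 1] by (simp add: det_quot_eq[OF s bs])
qed

text \<open>At a fixed parameter any factorization will do: after multiplication by its factors the
  symbol is 1, and what is left is a cornered sequence with bounded trace norms.\<close>

lemma det_quot_convergent:
  assumes s: "s \<in> \<Omega>"
  shows "convergent (\<lambda>n. det_quot n s)"
proof -
  obtain bs where bs: "factors (msym (a s)) bs" using G1BM_imp_factors(2)[OF comp[OF s]] by blast
  obtain c where c: "\<forall>\<^sub>F n in sequentially. nuc_le (block_idx n) (rest (A s) (a s) n) c"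
    using rest_bound[OF dec[OF s]] by blast
  obtain X' where X': "cornered X'"
    and eq: "\<forall>n\<ge>1. \<forall>i\<in>block_idx n. \<forall>j\<in>block_idx n.
      tprod n (A s n) bs i j = toep (msym (a s) ** lprod bs) i j + X' n i j"
    using tprod_cornered[OF rest_cornered[OF dec[OF s]], of "A s" "msym (a s)" bs] A_eq by blast
  have one: "msym (a s) ** lprod bs = mat 1" using bs by (simp add: factors_def)
  define \<beta> where "\<beta> = sum_list (map norm bs)"
  have \<beta>: "\<forall>b\<in>set bs. norm b \<le> \<beta>"
    unfolding \<beta>_def by (auto intro!: member_le_sum_list)
  let ?c = "tprod_bound (real CARD('n)) \<beta> (length bs) (norm (msym (a s))) c"
  have "\<forall>\<^sub>F n in sequentially. nuc_le (block_idx n) (X' n) ?c"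
    using c eventually_ge_at_top[of 1]
  proof eventually_elim
    case (elim n)
    have "nuc_le (block_idx n) (\<lambda>i j. tprod n (A s n) bs i j - idm i j) ?c"
      by (rule det_quot_bound(1)[OF s bs elim(1) order_refl \<beta> refl])
    then show ?case
      by (rule nuc_le_cong[THEN iffD1, rotated]) (use eq elim(2) in \<open>simp add: one toep_one\<close>)
  qed
  from fdet_cornered_convergent[OF X' this]
  have conv: "convergent (\<lambda>n. fdet (block_idx n) (\<lambda>i j. idm i j + X' n i j))" .
  have eq: "\<forall>\<^sub>F n in sequentially. fdet (block_idx n) (\<lambda>i j. idm i j + X' n i j) = det_quot n s"
    using eventually_ge_at_top[of 1]
  proof eventually_elim
    case (elim n)
    have "fdet (block_idx n) (tprod n (A s n) bs) = fdet (block_idx n) (\<lambda>i j. idm i j + X' n i j)"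
      by (rule fdet_cong) (use eq elim in \<open>simp add: one toep_one\<close>)
    then show ?case by (simp add: det_quot_eq[OF s bs])
  qed
  show ?thesis using convergent_cong[OF eq] conv by simp
qed

text \<open>The factorization at the centre serves all nearby s after adding two factors that depend
  on s but lie within distance 1 of the identity; this bounds the quotients uniformly. Their
  holomorphy does not use these factors: the numerator is a polynomial in the entries, and the
  denominator is given by the logarithmic formula for \<open>G_const\<close>.\<close>

lemma local_uniform:
  assumes t: "t \<in> \<Omega>"
  obtains r where "r > 0" "ball t r \<subseteq> \<Omega>"
    "uniform_limit (ball t r) det_quot (\<lambda>s. lim (\<lambda>n. det_quot n s)) sequentially"
    "(\<lambda>s. lim (\<lambda>n. det_quot n s)) holomorphic_on ball t r"
proof -
  obtain bs where bs: "factors (msym (a t)) bs" using G1BM_imp_factors(2)[OF comp[OF t]] by blast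
  define R where "R = lprod bs"
  have R: "msym (a t) ** R = mat 1" using bs by (simp add: factors_def R_def)
  show ?thesis
  proof (rule factors_local[OF R])
    fix d :: real
    assume d: "d > 0"
      and d2: "\<And>S. norm (S - msym (a t)) < d \<Longrightarrow>
          norm (R ** S - mat 1) < 1/2 \<and> near1 (R ** S) \<and> (\<exists>R'. S ** R' = mat 1)"
      and d3: "\<And>S bs. norm (S - msym (a t)) < d \<Longrightarrow> factors (msym (a t)) bs \<Longrightarrow>
          \<exists>p m. factors S (p # m # bs) \<and> norm (p - mat 1) < 1 \<and> norm (m - mat 1) < 1"
    show ?thesis
    proof (rule local_bounds[OF t d])
      fix r c :: real and n0 :: nat
      assume r: "r > 0" and sub: "ball t r \<subseteq> \<Omega>" and n0: "n0 \<ge> 1"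
        and near: "\<And>s. s \<in> ball t r \<Longrightarrow> norm (msym (a s) - msym (a t)) < d"
        and nuc: "\<And>s n. s \<in> ball t r \<Longrightarrow> n \<ge> n0 \<Longrightarrow> nuc_le (block_idx n) (rest (A s) (a s) n) c"
      have fac: "\<exists>p m. factors (msym (a s)) (p # m # bs) \<and> norm (p - mat 1) < 1 \<and> norm (m - mat 1) < 1"
        if "s \<in> ball t r" for s
        by (rule d3[OF near[OF that] bs])
      have detnear: "cmod (det (evm (R ** msym (a s)) z) - 1) < 1/2" if "s \<in> ball t r" "cmod z = 1" for s z
        using near1_det[OF _ that(2)] d2[OF near[OF that(1)]] by blast
      have G: "G_const (a s) = G_const (a t) * exp (mean (\<lambda>z. Ln (det (evm (R ** msym (a s)) z))))"
        if s: "s \<in> ball t r" for s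
        by (rule G_const_perturb[OF a_BM[OF t] bs a_BM R detnear[OF s]]) (use s sub in auto)
      have "(\<lambda>s. mean (\<lambda>z. Ln (det (evm (R ** msym (a s)) z)))) holomorphic_on ball t (r/2)"
      proof (rule mean_Ln_holomorphic[OF r _ _ detnear])
        fix z :: complex assume z: "cmod z = 1"
        have e: "(\<lambda>s. evm (msym (a s)) z $ i $ j) holomorphic_on ball t r" for i j
          unfolding holomorphic_on_def
          using symbol_differentiable[OF _ z] sub field_differentiable_at_within by blast
        have "(\<lambda>s. det (evm R z) * det (evm (msym (a s)) z)) holomorphic_on ball t r"
          unfolding det_def[of "evm (msym _) z"] by (intro holomorphic_intros e)
        then show "(\<lambda>s. det (evm (R ** msym (a s)) z)) holomorphic_on ball t r"
          by (simp add: evm_mult z det_mul)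
      qed (auto intro: continuous_on_det continuous_on_evm)
      then have "(\<lambda>s. G_const (a t) * exp (mean (\<lambda>z. Ln (det (evm (R ** msym (a s)) z))))) holomorphic_on ball t (r/2)"
        by (intro holomorphic_intros)
      then have Gh: "(\<lambda>s. G_const (a s)) holomorphic_on ball t (r/2)"
      proof (rule holomorphic_transform)
        fix s assume "s \<in> ball t (r/2)"
        then have "s \<in> ball t r" using r by auto
        from G[OF this] show "G_const (a t) * exp (mean (\<lambda>z. Ln (det (evm (R ** msym (a s)) z)))) = G_const (a s)"
          by (rule sym)
      qed
      \<comment> \<open>The first two summands bound the new factors p and m, which are within
        distance 1 of the identity; the last one bounds the fixed list.\<close>
      define \<beta> where "\<beta> = 1 + norm (mat 1 :: wsym ^ 'n ^ 'n) + sum_list (map norm bs)"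
      have \<beta>: "\<forall>b\<in>set bs. norm b \<le> \<beta>"
      proof
        fix b assume "b \<in> set bs"
        then have "norm b \<le> sum_list (map norm bs)" by (auto intro!: member_le_sum_list)
        then show "norm b \<le> \<beta>"
          using norm_ge_zero[of "mat 1 :: wsym ^ 'n ^ 'n"] unfolding \<beta>_def by linarith
      qed
      have \<beta>1: "norm p \<le> \<beta>" if "norm (p - mat 1) < 1" for p :: "wsym ^ 'n ^ 'n"
      proof -
        have "0 \<le> sum_list (map norm bs)" by (rule sum_list_nonneg) auto
        moreover have "norm p \<le> norm (p - mat 1) + norm (mat 1 :: wsym ^ 'n ^ 'n)"
          using norm_triangle_ineq[of "p - mat 1" "mat 1"] by simp
        ultimately show ?thesis using that unfolding \<beta>_def by linarith
      qed
      define c' where "c' = tprod_bound (real CARD('n)) \<beta> (Suc (Suc (length bs))) (norm (msym (a t)) + d) c"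
      have bound: "cmod (det_quot n s) \<le> exp (c' + c'\<^sup>2 / 2)" if s: "s \<in> ball t r" and n: "n \<ge> n0" for n s
      proof -
        obtain p m where pm: "factors (msym (a s)) (p # m # bs)" "norm (p - mat 1) < 1" "norm (m - mat 1) < 1"
          using fac[OF s] by blast
        have sO: "s \<in> \<Omega>" using s sub by blast
        have "norm (msym (a s)) \<le> norm (msym (a s) - msym (a t)) + norm (msym (a t))"
          using norm_triangle_ineq[of "msym (a s) - msym (a t)" "msym (a t)"] by simp
        then have \<sigma>: "norm (msym (a s)) \<le> norm (msym (a t)) + d" using near[OF s] by linarith
        have \<beta>': "\<forall>b\<in>set (p # m # bs). norm b \<le> \<beta>" using \<beta> \<beta>1[OF pm(2)] \<beta>1[OF pm(3)] by simp
        have "c' = tprod_bound (real CARD('n)) \<beta> (length (p # m # bs)) (norm (msym (a t)) + d) c"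
          by (simp add: c'_def)
        from det_quot_bound(2)[OF sO pm(1) nuc[OF s n] \<sigma> \<beta>' this] show ?thesis .
      qed
      have hol: "det_quot n holomorphic_on ball t (r/2)" if n: "n \<ge> n0" for n
      proof -
        have sub2: "ball t (r/2) \<subseteq> \<Omega>" using sub r by auto
        have e: "(\<lambda>s. A s n i j) holomorphic_on ball t (r/2)" if "i \<in> block_idx n" "j \<in> block_idx n" for i j
          unfolding holomorphic_on_def
        proof
          fix s assume "s \<in> ball t (r/2)"
          then have "s \<in> \<Omega>" using sub2 by blast
          from entry_differentiable[OF this _ that]
          show "(\<lambda>s. A s n i j) field_differentiable at s within ball t (r/2)"
            using n n0 by (simp add: field_differentiable_at_within)
        qed
        have "(\<lambda>s. block_det n (A s n)) holomorphic_on ball t (r/2)"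
          unfolding block_det_def
          by (intro holomorphic_intros e) (auto simp: permutes_in_image)
        moreover have "G_const (a s) \<noteq> 0" if "s \<in> ball t (r/2)" for s
        proof -
          have s: "s \<in> ball t r" using that r by auto
          obtain bs' where "factors (msym (a s)) bs'" using fac[OF s] by blast
          then show ?thesis using det_quot_eq(2) s sub by blast
        qed
        ultimately show ?thesis unfolding det_quot_def using Gh by (intro holomorphic_intros) auto
      qed
      have lim: "(\<lambda>n. det_quot n s) \<longlonglongrightarrow> lim (\<lambda>n. det_quot n s)" if "s \<in> ball t (r/2)" for s
        using det_quot_convergent[of s] that sub r by (simp add: convergent_LIMSEQ_iff subset_iff)
      have b: "cmod (det_quot n s) \<le> exp (c' + c'\<^sup>2 / 2)" if "n \<ge> n0" "s \<in> ball t (r/2)" for n s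
        using bound[OF _ that(1)] that(2) r by simp
      \<comment> \<open>The radius is halved once for the holomorphy of \<open>G_const\<close> and
        once more by \<open>vitali\<close>.\<close>
      have r2: "r/2 > 0" using r by simp
      have u: "uniform_limit (cball t (r/2/2)) det_quot (\<lambda>s. lim (\<lambda>n. det_quot n s)) sequentially"
        by (rule vitali(1)[OF r2 hol b lim])
      have h: "(\<lambda>s. lim (\<lambda>n. det_quot n s)) holomorphic_on ball t (r/2/2)"
        by (rule vitali(2)[OF r2 hol b lim])
      show ?thesis
      proof (rule that[of "r/2/2"])
        show "r/2/2 > 0" using r by simp
        show "ball t (r/2/2) \<subseteq> \<Omega>"
          using sub r subset_ball[of "r/2/2" r t] by simp
        show "uniform_limit (ball t (r/2/2)) det_quot (\<lambda>s. lim (\<lambda>n. det_quot n s)) sequentially"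
          by (rule uniform_limit_on_subset[OF u ball_subset_cball])
        show "(\<lambda>s. lim (\<lambda>n. det_quot n s)) holomorphic_on ball t (r/2/2)" by (rule h)
      qed
    qed
  qed
qed

end

theorem theorem3p1:
  fixes \<Omega> :: "complex set"
    and A :: "complex \<Rightarrow> nat \<Rightarrow> (nat \<times> 'n::finite) matrix"
    and a :: "complex \<Rightarrow> complex \<Rightarrow> complex ^ 'n ^ 'n"
    and K L :: "complex \<Rightarrow> (nat \<times> 'n) op"
    and C :: "complex \<Rightarrow> nat \<Rightarrow> (nat \<times> 'n) matrix"
  assumes "open \<Omega>"
    and "\<And>t. t \<in> \<Omega> \<Longrightarrow> F_decomp (A t) (a t) (K t) (L t) (C t)"
    and "F_analytic_on A \<Omega>"
    and "\<And>t. t \<in> \<Omega> \<Longrightarrow> a t \<in> G1BM"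
  shows "\<exists>E. (\<forall>t\<in>\<Omega>. (\<lambda>n. block_det n (A t n) / G_const (a t) ^ n) \<longlonglongrightarrow> E t) \<and>
    (\<forall>t\<in>\<Omega>. \<exists>U. open U \<and> t \<in> U \<and> U \<subseteq> \<Omega> \<and>
       uniform_limit U (\<lambda>n s. block_det n (A s n) / G_const (a s) ^ n) E sequentially) \<and>
    E analytic_on \<Omega>"
proof -
  interpret analytic_family \<Omega> A a K L C by unfold_locales (fact assms)+
  let ?E = "\<lambda>s. lim (\<lambda>n. det_quot n s)"
  have loc: "\<exists>r>0. ball t r \<subseteq> \<Omega> \<and> uniform_limit (ball t r) det_quot ?E sequentially \<and> ?E holomorphic_on ball t r"
    if "t \<in> \<Omega>" for t
  proof (rule local_uniform[OF that])
    fix r assume "r > 0" "ball t r \<subseteq> \<Omega>" "uniform_limit (ball t r) det_quot ?E sequentially"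
      "?E holomorphic_on ball t r"
    then show ?thesis by (intro exI[of _ r] conjI)
  qed
  have 1: "\<forall>t\<in>\<Omega>. (\<lambda>n. det_quot n t) \<longlonglongrightarrow> ?E t"
    using det_quot_convergent by (simp add: convergent_LIMSEQ_iff)
  have 2: "\<forall>t\<in>\<Omega>. \<exists>U. open U \<and> t \<in> U \<and> U \<subseteq> \<Omega> \<and> uniform_limit U det_quot ?E sequentially"
  proof
    fix t assume t: "t \<in> \<Omega>"
    obtain r where r: "r > 0 \<and> ball t r \<subseteq> \<Omega> \<and> uniform_limit (ball t r) det_quot ?E sequentially \<and> ?E holomorphic_on ball t r"
      using loc[OF t] by (rule exE)
    from r show "\<exists>U. open U \<and> t \<in> U \<and> U \<subseteq> \<Omega> \<and> uniform_limit U det_quot ?E sequentially"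
      by (intro exI[of _ "ball t r"] conjI; elim conjE) simp_all
  qed
  have 3: "?E analytic_on \<Omega>"
    unfolding analytic_on_def
  proof
    fix t assume t: "t \<in> \<Omega>"
    obtain r where r: "r > 0 \<and> ball t r \<subseteq> \<Omega> \<and> uniform_limit (ball t r) det_quot ?E sequentially \<and> ?E holomorphic_on ball t r"
      using loc[OF t] by (rule exE)
    from r show "\<exists>e>0. ?E holomorphic_on ball t e" by (intro exI[of _ r] conjI; elim conjE)
  qed
  show ?thesis
    unfolding det_quot_def[symmetric] by (rule exI[of _ ?E], intro conjI, rule 1, rule 2, rule 3)
qed

end
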